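(* Let $m\in\mathbb{N}$, $c>0$, and let $(Y_t(x))_{(t,x)\in\mathbb{R}\times\mathbb{R}^m}$ be a $c$-class MSTOU process, $(\gamma,\Sigma,\nu,\pi)$ the characteristic quadruplet of its driving Lévy basis and $f(\lambda)$ the density of $\pi$ with respect to Lebesgue measure on $(0,\infty)$. Put $\psi(h)=\frac{1}{\sqrt{c^2+1}}\frac{h}{\sqrt{m+1}}$, $V_m(c)=\frac{(\Gamma(1/2)c)^m}{\Gamma(\frac m2+1)}$ (the volume of the $m$-dimensional ball of radius $c$), $\Sigma_\Lambda=\Sigma+\int_{\mathbb{R}}x^2\nu(dx)$. The following hold for all $h>0$. (i) If $\int_{|x|>1}x^2\nu(dx)<\infty$ and $\gamma+\int_{|x|>1}x\,\nu(dx)=0$, then $Y$ is $\theta$-lex-weakly dependent. If $c\in(0,1]$, then for $m=1$ $$\theta_Y(h)\le\Big(2c\Sigma_\Lambda\int_0^\infty\frac{2\lambda\psi(h)+1}{\lambda^2}e^{-2\lambda\psi(h)}f(\lambda)\,d\lambda\Big)^{1/2},$$ and for $m\ge2$ $$\theta_Y(h)\le2\Big(V_m(c)\Sigma_\Lambda\int_0^\infty\frac{m!\sum_{k=0}^m\frac1{k!}(2\lambda\psi(h))^k}{(2\lambda)^{m+1}}e^{-2\lambda\psi(h)}f(\lambda)\,d\lambda\Big)^{1/2}.$$ If $c>1$, then for $m=1$ $$\theta_Y(h)\le2\Big(c\Sigma_\Lambda\int_0^\infty\frac{2\lambda\frac{\psi(h)}c+1}{2\lambda^2}e^{-2\lambda\frac{\psi(h)}c}f(\lambda)\,d\lambda\Big)^{1/2},$$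 and for $m\ge2$ $$\theta_Y(h)\le2\Big(V_m(c)\Sigma_\Lambda\int_0^\infty\frac{m!\sum_{k=0}^m\frac1{k!}(2\frac{\lambda\psi(h)}c)^k}{(2\lambda)^{m+1}}e^{-2\frac{\lambda\psi(h)}c}f(\lambda)\,d\lambda\Big)^{1/2}.$$ (ii) If $\int_{\mathbb{R}}|x|\,\nu(dx)<\infty$ and $\Sigma=0$, put $\gamma_0=\gamma-\int_{|x|\le1}x\,\nu(dx)$ and $\gamma_{abs}=|\gamma_0|+\int_{\mathbb{R}}|x|\nu(dx)$. Then $Y$ is $\theta$-lex-weakly dependent, and for every $m\in\mathbb{N}$: if $c\in(0,1]$, $$\theta_Y(h)\le2V_m(c)\gamma_{abs}\int_0^\infty\frac{m!\sum_{k=0}^m\frac1{k!}(\lambda\psi(h))^k}{\lambda^{m+1}}e^{-\lambda\psi(h)}f(\lambda)\,d\lambda,$$ whereas if $c>1$, $$\theta_Y(h)\le2V_m(c)\gamma_{abs}\int_0^\infty\frac{m!\sum_{k=0}^m\frac1{k!}(\frac{\lambda\psi(h)}c)^k}{\lambda^{m+1}}e^{-\frac{\lambda\psi(h)}c}f(\lambda)\,d\lambda.$$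
   Context: A real-valued Lévy basis on $(0,\infty)\times\mathbb{R}\times\mathbb{R}^m$ with characteristic quadruplet $(\gamma,\Sigma,\nu,\pi)$ is a family $\Lambda=\{\Lambda(B)\}$ of real random variables indexed by the bounded Borel sets $B$, with independent values on disjoint sets, almost surely $\sigma$-additive, and with $E[e^{iu\Lambda(B)}]=e^{\Phi(u)(\pi\times Leb)(B)}$, where $\Phi(u)=i\gamma u-\frac12\Sigma u^2+\int_{\mathbb{R}}(e^{iux}-1-iux\mathbb{1}_{[0,1]}(|x|))\nu(dx)$; $\pi$ is a probability measure on $(0,\infty)$. Stochastic integrals are in the sense of Rajput and Rosiński (1989). $c$-class MSTOU process (mixed spatio-temporal Ornstein–Uhlenbeck process): $\int_{|x|>1}x^2\nu(dx)<\infty$, $\pi$ has a density $f$ with $\int_0^\infty\lambda^{-(m+1)}f(\lambda)\,d\lambda<\infty$, and $$Y_t(x)=\int_0^\infty\int_{A_t(x)}e^{-\lambda(t-s)}\,\Lambda(d\lambda,ds,d\xi),\qquad A_t(x)=\{(s,\xi)\in\mathbb{R}\times\mathbb{R}^m:s\le t,\ \|x-\xi\|\le c|t-s|\}.$$ Lexicographic order on $\mathbb{R}^{m+1}=\mathbb{R}\times\mathbb{R}^m$ (time coordinate first): for $y\ne z$, $y<_{lex}z$ iff at the first coordinate where they differ $y$ is smaller. $V_p=\{q:q<_{lex}p\}\cup\{p\}$, $V_p^h=V_p\cap\{q:\|p-q\|_\infty\ge h\}$. $\theta$-lex-weak dependence of a real-valued field $Y=(Y_p)_{p\in\mathbb{R}^{m+1}}$: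 $\theta_Y(h)=\sup_{u\in\mathbb{N}}\theta_u(h)\to0$ as $h\to\infty$, where $\theta_u(h)$ is the supremum of $|Cov(F(Y_\Gamma),G(Y_p))|/(\|F\|_\infty Lip(G))$ over bounded Borel $F:\mathbb{R}^u\to\mathbb{R}$, bounded Lipschitz $G:\mathbb{R}\to\mathbb{R}$ (non-zero denominator), $p\in\mathbb{R}^{m+1}$ and $\Gamma\subset V_p^h$ with $|\Gamma|=u$. *)

theory Defs
  imports "HOL-Probability.Probability"
begin

text \<open>
  The spatial dimension \<open>m\<close> is \<open>CARD('m)\<close>. The class \<open>linorder\<close> on the index type is used only by
  the lexicographic order; every \<open>m \<ge> 1\<close> is the cardinality of such a type (\<open>num1\<close> and the
  numeral types \<open>2, 3, \<dots>\<close>).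
\<close>

section \<open>Levy bases\<close>

definition levy_measure :: "real measure \<Rightarrow> bool" where
  "levy_measure \<nu> \<longleftrightarrow>
     sets \<nu> = sets borel \<and> emeasure \<nu> {0} = 0 \<and> integrable \<nu> (\<lambda>x. min 1 (x\<^sup>2))"

definition levy_exponent :: "real \<Rightarrow> real \<Rightarrow> real measure \<Rightarrow> real \<Rightarrow> complex" where
  "levy_exponent \<gamma> S \<nu> u =
     \<i> * of_real (\<gamma> * u) - of_real (S * u\<^sup>2 / 2) +
     (CLINT x|\<nu>. iexp (u * x) - 1 - \<i> * of_real (u * x * indicator {0..1} \<bar>x\<bar>))"

definition levy_space :: "(real \<times> real \<times> (real ^ 'm)) set" where
  "levy_space = {0<..} \<times> UNIV"

definition bounded_borel_sets :: "(real \<times> real \<times> (real ^ 'm)) set set" where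
  "bounded_borel_sets = {B \<in> sets borel. B \<subseteq> levy_space \<and> bounded B}"

text \<open>
  A probability measure on \<open>(0,\<infinity>)\<close> is represented by a Borel measure on the reals that gives no
  mass to \<open>(-\<infinity>,0]\<close>.
\<close>

definition levy_basis ::
  "'w measure \<Rightarrow> ((real \<times> real \<times> (real ^ 'm)) set \<Rightarrow> 'w \<Rightarrow> real) \<Rightarrow>
   real \<Rightarrow> real \<Rightarrow> real measure \<Rightarrow> real measure \<Rightarrow> bool" where
  "levy_basis M \<Lambda> \<gamma> S \<nu> \<pi> \<longleftrightarrow>
     prob_space M \<and>
     0 \<le> S \<and> levy_measure \<nu> \<and>
     prob_space \<pi> \<and> sets \<pi> = sets borel \<and> emeasure \<pi> {..0} = 0 \<and>
     (\<forall>B\<in>bounded_borel_sets. \<Lambda> B \<in> borel_measurable M) \<and>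
     (\<forall>B :: nat \<Rightarrow> _. range B \<subseteq> bounded_borel_sets \<longrightarrow> disjoint_family B \<longrightarrow>
        prob_space.indep_vars M (\<lambda>_. borel) (\<lambda>n. \<Lambda> (B n)) UNIV) \<and>
     (\<forall>B :: nat \<Rightarrow> _. range B \<subseteq> bounded_borel_sets \<longrightarrow> disjoint_family B \<longrightarrow>
        (\<Union>n. B n) \<in> bounded_borel_sets \<longrightarrow>
        (AE \<omega> in M. (\<lambda>n. \<Lambda> (B n) \<omega>) sums \<Lambda> (\<Union>n. B n) \<omega>)) \<and>
     (\<forall>B\<in>bounded_borel_sets. \<forall>u.
        (CLINT \<omega>|M. iexp (u * \<Lambda> B \<omega>)) =
        exp (levy_exponent \<gamma> S \<nu> u * of_real (measure (\<pi> \<Otimes>\<^sub>M lborel) B)))"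

section \<open>Stochastic integrals in the sense of Rajput and Rosinski\<close>

definition tendsto_in_prob :: "'w measure \<Rightarrow> (nat \<Rightarrow> 'w \<Rightarrow> real) \<Rightarrow> ('w \<Rightarrow> real) \<Rightarrow> bool" where
  "tendsto_in_prob M X Z \<longleftrightarrow>
     (\<forall>\<epsilon>>0. (\<lambda>n. measure M {\<omega> \<in> space M. \<epsilon> < \<bar>X n \<omega> - Z \<omega>\<bar>}) \<longlonglongrightarrow> 0)"

definition levy_simple :: "(real \<times> real \<times> (real ^ 'm) \<Rightarrow> real) \<Rightarrow> bool" where
  "levy_simple \<phi> \<longleftrightarrow>
     \<phi> \<in> borel_measurable borel \<and> finite (range \<phi>) \<and> {z. \<phi> z \<noteq> 0} \<in> bounded_borel_sets"

definition simple_levy_integral ::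
  "((real \<times> real \<times> (real ^ 'm)) set \<Rightarrow> 'w \<Rightarrow> real) \<Rightarrow> (real \<times> real \<times> (real ^ 'm)) set \<Rightarrow>
   (real \<times> real \<times> (real ^ 'm) \<Rightarrow> real) \<Rightarrow> 'w \<Rightarrow> real" where
  "simple_levy_integral \<Lambda> A \<phi> \<omega> = (\<Sum>y\<in>range \<phi> - {0}. y * \<Lambda> (A \<inter> \<phi> -` {y}) \<omega>)"

text \<open>
  \<open>X\<close> is a version of \<open>\<integral> g d\<Lambda>\<close>, where \<open>\<Lambda>\<close> has control measure \<open>\<mu>\<close>: along some sequence of simple
  functions converging \<open>\<mu>\<close>-a.e. to \<open>g\<close>, the integrals over every Borel set converge in probability,
  and those over the whole space converge to \<open>X\<close>.
\<close>

definition has_levy_integral ::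
  "'w measure \<Rightarrow> ((real \<times> real \<times> (real ^ 'm)) set \<Rightarrow> 'w \<Rightarrow> real) \<Rightarrow>
   (real \<times> real \<times> (real ^ 'm)) measure \<Rightarrow>
   (real \<times> real \<times> (real ^ 'm) \<Rightarrow> real) \<Rightarrow> ('w \<Rightarrow> real) \<Rightarrow> bool" where
  "has_levy_integral M \<Lambda> \<mu> g X \<longleftrightarrow>
     g \<in> borel_measurable borel \<and> X \<in> borel_measurable M \<and>
     (\<exists>\<phi>. (\<forall>n. levy_simple (\<phi> n)) \<and>
          (AE z in \<mu>. (\<lambda>n. \<phi> n z) \<longlonglongrightarrow> g z) \<and>
          (\<forall>A\<in>sets borel. A \<subseteq> levy_space \<longrightarrow>
             (\<exists>Z\<in>borel_measurable M.
                tendsto_in_prob M (\<lambda>n. simple_levy_integral \<Lambda> A (\<phi> n)) Z)) \<and>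
          tendsto_in_prob M (\<lambda>n. simple_levy_integral \<Lambda> levy_space (\<phi> n)) X)"

section \<open>MSTOU processes\<close>

definition ambit_set :: "real \<Rightarrow> real \<times> (real ^ 'm) \<Rightarrow> (real \<times> (real ^ 'm)) set" where
  "ambit_set c = (\<lambda>(t, x). {(s, \<xi>). s \<le> t \<and> norm (x - \<xi>) \<le> c * \<bar>t - s\<bar>})"

definition mstou_kernel ::
  "real \<Rightarrow> real \<times> (real ^ 'm) \<Rightarrow> real \<times> real \<times> (real ^ 'm) \<Rightarrow> real" where
  "mstou_kernel c p = (\<lambda>(l, s, \<xi>). exp (- l * (fst p - s)) * indicator (ambit_set c p) (s, \<xi>))"

text \<open>
  The measure \<open>\<pi> \<Otimes>\<^sub>M lborel\<close> has the null sets of the control measure constructed by Rajput and Rosinski,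
  unless \<open>\<gamma>\<close>, \<open>S\<close> and \<open>\<nu>\<close> all vanish; in that case every stochastic integral is almost surely zero.
\<close>

definition c_class_MSTOU ::
  "'w measure \<Rightarrow> ((real \<times> real \<times> (real ^ 'm)) set \<Rightarrow> 'w \<Rightarrow> real) \<Rightarrow>
   real \<Rightarrow> real \<Rightarrow> real measure \<Rightarrow> real measure \<Rightarrow> (real \<Rightarrow> real) \<Rightarrow> real \<Rightarrow>
   (real \<times> (real ^ 'm) \<Rightarrow> 'w \<Rightarrow> real) \<Rightarrow> bool" where
  "c_class_MSTOU M \<Lambda> \<gamma> S \<nu> \<pi> f c Y \<longleftrightarrow>
     levy_basis M \<Lambda> \<gamma> S \<nu> \<pi> \<and>
     set_integrable \<nu> {x. 1 < \<bar>x\<bar>} (\<lambda>x. x\<^sup>2) \<and>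
     set_borel_measurable borel {0<..} f \<and> (\<forall>l>0. 0 \<le> f l) \<and>
     \<pi> = density lborel (\<lambda>l. ennreal (indicator {0<..} l * f l)) \<and>
     set_integrable lborel {0<..} (\<lambda>l. f l / l ^ (CARD('m) + 1)) \<and>
     (\<forall>p. has_levy_integral M \<Lambda> (\<pi> \<Otimes>\<^sub>M lborel) (mstou_kernel c p) (Y p))"

section \<open>Theta-lex-weak dependence\<close>

definition lex_less ::
  "real \<times> (real ^ 'm::{finite,linorder}) \<Rightarrow> real \<times> (real ^ 'm::{finite,linorder}) \<Rightarrow> bool" where
  "lex_less y z \<longleftrightarrow>
     fst y < fst z \<or>
     fst y = fst z \<and> (\<exists>i. snd y $ i < snd z $ i \<and> (\<forall>j<i. snd y $ j = snd z $ j))"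

definition lex_past ::
  "real \<times> (real ^ 'm::{finite,linorder}) \<Rightarrow> (real \<times> (real ^ 'm::{finite,linorder})) set" where
  "lex_past p = {q. lex_less q p} \<union> {p}"

text \<open>On the Euclidean space \<open>real \<times> real ^ 'm\<close>, \<open>infnorm\<close> is the maximum norm of the coordinates.\<close>

definition lex_past_dist ::
  "real \<times> (real ^ 'm::{finite,linorder}) \<Rightarrow> real \<Rightarrow> (real \<times> (real ^ 'm::{finite,linorder})) set" where
  "lex_past_dist p h = lex_past p \<inter> {q. h \<le> infnorm (p - q)}"

definition covariance :: "'w measure \<Rightarrow> ('w \<Rightarrow> real) \<Rightarrow> ('w \<Rightarrow> real) \<Rightarrow> real" where
  "covariance M X Z =
     (LINT \<omega>|M. (X \<omega> - (LINT \<omega>'|M. X \<omega>')) * (Z \<omega> - (LINT \<omega>'|M. Z \<omega>')))"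

definition sup_norm_on :: "'a set \<Rightarrow> ('a \<Rightarrow> real) \<Rightarrow> real" where
  "sup_norm_on A F = (SUP v\<in>A. \<bar>F v\<bar>)"

definition Lip :: "(real \<Rightarrow> real) \<Rightarrow> real" where
  "Lip G = (SUP (x, y)\<in>{(x, y). x \<noteq> y}. \<bar>G x - G y\<bar> / \<bar>x - y\<bar>)"

text \<open>
  \<open>\<real>\<^sup>u\<close>, with \<open>u\<close> ranging over the naturals, is the product space of \<open>u\<close> copies of the Borel space
  of the reals.
\<close>

abbreviation borel_pow :: "nat \<Rightarrow> (nat \<Rightarrow> real) measure" where
  "borel_pow u \<equiv> (\<Pi>\<^sub>M i\<in>{..<u}. borel)"

text \<open>
  The finite set \<open>\<Gamma>\<close> is given by an injective enumeration \<open>q\<close>, so that \<open>Y\<^sub>\<Gamma>\<close> is the vector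
  \<open>(Y (q 0), \<dots>, Y (q (u - 1)))\<close>.
\<close>

definition theta_lex_u ::
  "'w measure \<Rightarrow> (real \<times> (real ^ 'm::{finite,linorder}) \<Rightarrow> 'w \<Rightarrow> real) \<Rightarrow>
   nat \<Rightarrow> real \<Rightarrow> ennreal" where
  "theta_lex_u M Y u h =
     (SUP (F, G, p, q) \<in>
        {(F, G, p, q).
           F \<in> borel_measurable (borel_pow u) \<and> bounded (F ` space (borel_pow u)) \<and>
           bounded (range G) \<and> (\<exists>L. L-lipschitz_on UNIV G) \<and>
           sup_norm_on (space (borel_pow u)) F * Lip G \<noteq> 0 \<and>
           inj_on q {..<u} \<and> q ` {..<u} \<subseteq> lex_past_dist p h}.
        ennreal (\<bar>covariance M (\<lambda>\<omega>. F (\<lambda>i\<in>{..<u}. Y (q i) \<omega>)) (\<lambda>\<omega>. G (Y p \<omega>))\<bar> /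
                 (sup_norm_on (space (borel_pow u)) F * Lip G)))"

definition theta_lex ::
  "'w measure \<Rightarrow> (real \<times> (real ^ 'm::{finite,linorder}) \<Rightarrow> 'w \<Rightarrow> real) \<Rightarrow> real \<Rightarrow> ennreal" where
  "theta_lex M Y h = (SUP u\<in>{1..}. theta_lex_u M Y u h)"

definition theta_lex_weakly_dependent ::
  "'w measure \<Rightarrow> (real \<times> (real ^ 'm::{finite,linorder}) \<Rightarrow> 'w \<Rightarrow> real) \<Rightarrow> bool" where
  "theta_lex_weakly_dependent M Y \<longleftrightarrow> (theta_lex M Y \<longlongrightarrow> 0) at_top"

section \<open>Constants in the bounds\<close>

definition psi :: "nat \<Rightarrow> real \<Rightarrow> real \<Rightarrow> real" where
  "psi m c h = 1 / sqrt (c\<^sup>2 + 1) * (h / sqrt (real m + 1))"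

definition ball_volume :: "nat \<Rightarrow> real \<Rightarrow> real" where
  "ball_volume m c = (Gamma (1 / 2) * c) ^ m / Gamma (real m / 2 + 1)"

definition Sigma_L :: "real \<Rightarrow> real measure \<Rightarrow> real" where
  "Sigma_L S \<nu> = S + (LINT x|\<nu>. x\<^sup>2)"

definition gamma_zero :: "real \<Rightarrow> real measure \<Rightarrow> real" where
  "gamma_zero \<gamma> \<nu> = \<gamma> - (LINT x:{x. \<bar>x\<bar> \<le> 1}|\<nu>. x)"

definition gamma_abs :: "real \<Rightarrow> real measure \<Rightarrow> real" where
  "gamma_abs \<gamma> \<nu> = \<bar>gamma_zero \<gamma> \<nu>\<bar> + (LINT x|\<nu>. \<bar>x\<bar>)"

end

theory Submission
  imports Defs
begin

text \<open>
  Fix a point \<open>p = (t, x)\<close> and a lag \<open>h\<close>. The kernel of \<open>Y p\<close> lives on the backward cone with apex \<open>p\<close>. Cut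
  off the part of this cone that lies within time \<open>\<tau>\<close> of the apex. If \<open>\<tau> \<le> h\<close> and \<open>2 * c * \<tau> \<le> h\<close>, then this
  near part meets none of the cones of the points \<open>q\<close> that precede \<open>p\<close> at distance at least \<open>h\<close>
  (lemma \<open>near_cone_disjoint\<close>), and \<open>psi\<close>, divided by \<open>c\<close> when \<open>c > 1\<close>, is such a \<open>\<tau>\<close>. Hence \<open>Y p = V + R\<close>, where
  \<open>V\<close>, the integral over the near part, is independent of all the \<open>Y q\<close>, so that
  \<open>\<bar>Cov (F (Y q)\<^sub>q) (G (Y p))\<bar> = \<bar>Cov (F (Y q)\<^sub>q) (G (V + R) - G V)\<bar> \<le> 2 * \<parallel>F\<parallel> * Lip G * E \<bar>R\<bar>\<close>.
  It remains to bound \<open>E \<bar>R\<bar>\<close> by the integral of the kernel, or of its square, over the complement of the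
  near part. In polar coordinates this is an incomplete gamma integral, which has the closed form of
  the statement.

  Stochastic integrals are only given as limits in probability along some sequence of simple functions
  that converges almost everywhere, without domination. The main analytic step is that the limit
  nevertheless has the expected law: its characteristic function at \<open>u\<close> is the exponential of
  \<open>\<integral> \<Phi> (u * g)\<close> (lemma \<open>chf_levy_limit\<close>). On the sets where the approximating sequence is uniformly bounded
  this is dominated convergence; that these sets exhaust the integral is a Nikodym type theorem
  (lemma \<open>gliding_hump\<close>), which exploits convergence over every Borel set.

  The law gives three things. An integral over a set on which the kernel vanishes is zero almost surely.
  In the centred case \<open>\<bar>\<Phi> v\<bar> \<le> Sigma_L * v\<^sup>2 / 2\<close>, and Fatou's lemma applied to \<open>2 * (1 - cos (R / n)) * n\<^sup>2\<close>
  bounds \<open>E R\<^sup>2\<close>. In the finite variation case a bound on the characteristic function is not enough, as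
  the Cauchy law shows. There \<open>E \<bar>\<Lambda> B\<bar>\<close> is estimated by cutting \<open>B\<close> into thin time slices, on which
  the basis hardly jumps (lemma \<open>first_moment_compensated\<close>); the bound passes to simple integrals by the triangle
  inequality and to \<open>R\<close> by Fatou's lemma, in the identity that expresses \<open>E \<bar>X\<bar>\<close> as the integral of
  \<open>(1 - Re chf) / u\<^sup>2\<close> up to a constant factor.
\<close>

section \<open>A Nikodym convergence theorem\<close>

text \<open>
  If the tails did not tend to one, there would be disjoint blocks \<open>T K - T K'\<close> and indices \<open>n\<close> such that \<open>e n\<close>
  of the block stays away from one while \<open>e n\<close> is nearly one on everything beyond it. Blocks
  alternate with gaps, each with its own index. On the union \<open>A\<close> of the blocks the indices of the
  gaps see only the initial part of \<open>A\<close>, whereas those of the blocks see one more factor. Both sequences converge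
  to the same nonzero limit \<open>l A\<close>, so this factor tends to one. The convergence on the single set \<open>A\<close>, which
  depends on all the choices, is what rules the humps out.
\<close>
lemma gliding_hump:
  fixes N :: "'a measure" and e :: "nat \<Rightarrow> 'a set \<Rightarrow> complex" and T :: "nat \<Rightarrow> 'a set"
  assumes mult: "\<And>n A B. A \<in> sets N \<Longrightarrow> B \<in> sets N \<Longrightarrow> A \<inter> B = {} \<Longrightarrow> e n (A \<union> B) = e n A * e n B"
    and bound: "\<And>n A. A \<in> sets N \<Longrightarrow> norm (e n A) \<le> 1"
    and T: "\<And>k. T k \<in> sets N" "decseq T"
    and small: "\<And>n \<epsilon>. 0 < \<epsilon> \<Longrightarrow> \<exists>K. \<forall>A\<in>sets N. A \<subseteq> T K \<longrightarrow> norm (e n A - 1) < \<epsilon>"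
    and lim: "\<And>A. A \<in> sets N \<Longrightarrow> (\<lambda>n. e n A) \<longlonglongrightarrow> l A"
    and nz: "\<And>A. A \<in> sets N \<Longrightarrow> l A \<noteq> 0"
  shows "(\<lambda>k. l (T k)) \<longlonglongrightarrow> 1"
proof (rule ccontr)
  assume "\<not> (\<lambda>k. l (T k)) \<longlonglongrightarrow> 1"
  then obtain \<epsilon> where \<epsilon>: "\<epsilon> > 0" and bad: "\<And>N. \<exists>K\<ge>N. \<epsilon> \<le> norm (l (T K) - 1)"
    unfolding LIMSEQ_iff by (meson not_le)
  have anti: "T j \<subseteq> T i" if "i \<le> j" for i j
    using T(2) that by (auto simp: decseq_def)
  have near: "\<exists>n\<ge>j. norm (e n A - l A) < \<delta> \<and> norm (e n B - l B) < \<delta>'"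
    if "A \<in> sets N" "B \<in> sets N" "\<delta> > 0" "\<delta>' > 0" for A B \<delta> \<delta>' and j :: nat
  proof -
    have "\<forall>\<^sub>F n in sequentially. norm (e n A - l A) < \<delta>"
      using tendstoD[OF lim[OF that(1)] that(3)] by (simp add: dist_norm)
    moreover have "\<forall>\<^sub>F n in sequentially. norm (e n B - l B) < \<delta>'"
      using tendstoD[OF lim[OF that(2)] that(4)] by (simp add: dist_norm)
    ultimately have "\<forall>\<^sub>F n in sequentially. n \<ge> j \<and> norm (e n A - l A) < \<delta> \<and> norm (e n B - l B) < \<delta>'"
      using eventually_ge_at_top[of j] by eventually_elim auto
    then show ?thesis by (auto simp: eventually_sequentially)
  qed
  define r :: "nat \<Rightarrow> real" where "r j = 1 / (real j + 1)" for j
  have r: "r j > 0" for j by (simp add: r_def)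
  have r0: "r \<longlonglongrightarrow> 0"
    unfolding r_def using LIMSEQ_inverse_real_of_nat by (simp add: inverse_eq_divide add.commute)
  \<comment> \<open>A state is the union of the blocks chosen so far and the index of a tail beyond them that is still bad.\<close>
  define St where "St s \<longleftrightarrow> fst s \<in> sets N \<and> fst s \<inter> T (snd s) = {} \<and> \<epsilon> \<le> norm (l (T (snd s)) - 1)"
    for s :: "'a set \<times> nat"
  \<comment> \<open>\<open>n\<close> and \<open>n'\<close> are the indices of the next block \<open>T (snd s) - T K\<close> and of the gap \<open>T K - T (snd s')\<close> that follows it.\<close>
  define Tr where "Tr j s s' n n' K \<longleftrightarrow> n \<ge> j \<and> n' \<ge> j \<and> snd s \<le> K \<and> K \<le> snd s' \<and>
      fst s' = fst s \<union> (T (snd s) - T K) \<and>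
      norm (e n (fst s) - l (fst s)) < r j \<and> norm (e n (T (snd s)) - l (T (snd s))) < \<epsilon> / 2 \<and>
      (\<forall>A\<in>sets N. A \<subseteq> T K \<longrightarrow> norm (e n A - 1) < r j) \<and>
      norm (e n' (fst s') - l (fst s')) < r j \<and>
      (\<forall>A\<in>sets N. A \<subseteq> T (snd s') \<longrightarrow> norm (e n' A - 1) < r j)"
    for j :: nat and s s' :: "'a set \<times> nat" and n n' K :: nat
  have "\<exists>s. \<forall>j. St (s j) \<and> (\<exists>n n' K. Tr j (s j) (s (Suc j)) n n' K)"
  proof (rule dependent_nat_choice)
    obtain K where "\<epsilon> \<le> norm (l (T K) - 1)" using bad by blast
    then show "\<exists>s. St s" by (intro exI[of _ "({}, K)"]) (auto simp: St_def)
  next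
    fix s :: "'a set \<times> nat" and j :: nat
    assume s: "St s"
    then have P: "fst s \<in> sets N" by (simp add: St_def)
    obtain n where n: "n \<ge> j" "norm (e n (fst s) - l (fst s)) < r j"
        "norm (e n (T (snd s)) - l (T (snd s))) < \<epsilon> / 2"
      using near[OF P T(1)[of "snd s"] r, of "\<epsilon> / 2" j] \<epsilon> by auto
    obtain K0 where K0: "\<forall>A\<in>sets N. A \<subseteq> T K0 \<longrightarrow> norm (e n A - 1) < r j"
      using small[OF r] by blast
    define K where "K = max K0 (snd s)"
    have K: "\<forall>A\<in>sets N. A \<subseteq> T K \<longrightarrow> norm (e n A - 1) < r j" "snd s \<le> K"
      using K0 anti[of K0 K] by (auto simp: K_def)
    define P' where "P' = fst s \<union> (T (snd s) - T K)"
    have P': "P' \<in> sets N" using P T(1) by (auto simp: P'_def)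
    obtain n' where n': "n' \<ge> j" "norm (e n' P' - l P') < r j"
      using near[OF P' P' r r, of j] by auto
    obtain K1 where K1: "\<forall>A\<in>sets N. A \<subseteq> T K1 \<longrightarrow> norm (e n' A - 1) < r j"
      using small[OF r] by blast
    obtain K' where K': "K' \<ge> max K K1" "\<epsilon> \<le> norm (l (T K') - 1)" using bad by blast
    have "P' \<inter> T K' = {}"
      using s anti[of "snd s" K'] anti[of K K'] K' K(2) by (auto simp: P'_def St_def)
    then have "St (P', K')" using P' K' by (simp add: St_def)
    moreover have "Tr j s (P', K') n n' K"
      using n n' K K' K1 anti[of K1 K'] by (auto simp: Tr_def P'_def)
    ultimately show "\<exists>s'. St s' \<and> (\<exists>n n' K. Tr j s s' n n' K)" by blast
  qed
  then obtain s n n' K where St: "\<And>j. St (s j)" and Tr: "\<And>j. Tr j (s j) (s (Suc j)) (n j) (n' j) (K j)"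
    by metis
  define P where "P j = fst (s j)" for j
  define k where "k j = snd (s j)" for j
  have P: "P j \<in> sets N" "P j \<inter> T (k j) = {}" and kbad: "\<epsilon> \<le> norm (l (T (k j)) - 1)" for j
    using St[of j] by (auto simp: St_def P_def k_def)
  have Tr': "n j \<ge> j" "n' j \<ge> j" "k j \<le> K j" "K j \<le> k (Suc j)" "P (Suc j) = P j \<union> (T (k j) - T (K j))"
     "norm (e (n j) (P j) - l (P j)) < r j" "norm (e (n j) (T (k j)) - l (T (k j))) < \<epsilon> / 2"
     "\<And>A. A \<in> sets N \<Longrightarrow> A \<subseteq> T (K j) \<Longrightarrow> norm (e (n j) A - 1) < r j"
     "norm (e (n' j) (P (Suc j)) - l (P (Suc j))) < r j"
     "\<And>A. A \<in> sets N \<Longrightarrow> A \<subseteq> T (k (Suc j)) \<Longrightarrow> norm (e (n' j) A - 1) < r j" for j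
    using Tr[of j] by (auto simp: Tr_def P_def k_def)
  define A where "A = (\<Union>j. P j)"
  have A: "A \<in> sets N" unfolding A_def using P(1) by blast
  have incP: "incseq P" by (rule incseq_SucI) (auto simp: Tr'(5))
  have kmono: "incseq k" by (rule incseq_SucI) (meson Tr'(3,4) order_trans)
  have later: "P i \<subseteq> P j \<union> T (k j)" if "j \<le> i" for i j
    using that
  proof (induction rule: dec_induct)
    case (step i)
    have "T (k i) \<subseteq> T (k j)" using kmono step by (auto simp: incseq_def intro!: anti)
    then show ?case using step by (auto simp: Tr'(5))
  qed auto
  have split: "A = P j \<union> (A \<inter> T (k j))" for j
  proof -
    have "P i \<subseteq> P j \<union> T (k j)" for i
      using later[of j i] incP[unfolded incseq_def] by (metis le_supI1 nat_le_linear)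
    then show ?thesis by (auto simp: A_def)
  qed
  have along: "(\<lambda>j. e (q j) A) \<longlonglongrightarrow> l A" if "\<And>j. q j \<ge> j" for q
    using filterlim_compose[OF lim[OF A], of q sequentially] filterlim_at_top_mono[OF filterlim_ident, of q] that
    by simp
  \<comment> \<open>Along the gaps, \<open>A\<close> looks like its initial part, so the limit \<open>l\<close> is continuous along the initial parts.\<close>
  have "(\<lambda>j. e (n' j) A - l (P (Suc j))) \<longlonglongrightarrow> 0"
  proof (rule Lim_null_comparison)
    show "\<forall>\<^sub>F j in sequentially. norm (e (n' j) A - l (P (Suc j))) \<le> 2 * r j"
    proof (intro always_eventually allI)
      fix j
      let ?R = "A \<inter> T (k (Suc j))"
      have R: "?R \<in> sets N" using A T by auto
      have "e (n' j) A = e (n' j) (P (Suc j)) * e (n' j) ?R"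
        using mult[of "P (Suc j)" ?R] split[of "Suc j"] P[of "Suc j"] R by (metis Int_left_commute Int_empty_right)
      then have "e (n' j) A - l (P (Suc j)) =
          e (n' j) (P (Suc j)) * (e (n' j) ?R - 1) + (e (n' j) (P (Suc j)) - l (P (Suc j)))"
        by (simp add: algebra_simps)
      also have "norm \<dots> \<le> norm (e (n' j) (P (Suc j))) * norm (e (n' j) ?R - 1) + norm (e (n' j) (P (Suc j)) - l (P (Suc j)))"
        by (metis norm_mult norm_triangle_ineq)
      also have "\<dots> \<le> 1 * r j + r j"
        using bound[OF P(1)] Tr'(10)[OF R, of j] Tr'(9)[of j]
        by (intro add_mono mult_mono) (auto intro: less_imp_le)
      finally show "norm (e (n' j) A - l (P (Suc j))) \<le> 2 * r j" by simp
    qed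
    show "(\<lambda>j. 2 * r j) \<longlonglongrightarrow> 0" using tendsto_mult_right_zero[OF r0] by simp
  qed
  from tendsto_diff[OF along[OF Tr'(2)] this] have "(\<lambda>j. l (P (Suc j))) \<longlonglongrightarrow> l A" by simp
  then have lP: "(\<lambda>j. l (P j)) \<longlonglongrightarrow> l A" by (rule LIMSEQ_imp_Suc)
  have "(\<lambda>j. e (n j) (P j) - l (P j)) \<longlonglongrightarrow> 0"
    by (rule Lim_null_comparison[OF _ r0]) (auto intro!: always_eventually less_imp_le[OF Tr'(6)])
  from tendsto_add[OF this lP] have x: "(\<lambda>j. e (n j) (P j)) \<longlonglongrightarrow> l A" by simp
  let ?B = "\<lambda>j. T (k j) - T (K j)"
  let ?R = "\<lambda>j. A \<inter> T (k (Suc j))"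
  have R: "?R j \<in> sets N" "?R j \<subseteq> T (K j)" for j using A T anti[OF Tr'(4)[of j]] by auto
  have y: "(\<lambda>j. e (n j) (?R j)) \<longlonglongrightarrow> 1"
    by (rule LIM_zero_cancel, rule Lim_null_comparison[OF _ r0])
       (auto intro!: always_eventually less_imp_le[OF Tr'(8)] R)
  have z: "(\<lambda>j. e (n j) (T (K j))) \<longlonglongrightarrow> 1"
    by (rule LIM_zero_cancel, rule Lim_null_comparison[OF _ r0])
       (auto intro!: always_eventually less_imp_le[OF Tr'(8)] T(1))
  have B: "?B j \<in> sets N" for j using T by auto
  have eA: "e (n j) A = e (n j) (P j) * e (n j) (?R j) * e (n j) (?B j)" for j
  proof -
    have "e (n j) (P (Suc j)) = e (n j) (P j) * e (n j) (?B j)"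
      unfolding Tr'(5) using P[of j] B[of j] by (intro mult) auto
    moreover have "e (n j) A = e (n j) (P (Suc j)) * e (n j) (?R j)"
      using mult[of "P (Suc j)" "?R j"] split[of "Suc j"] P[of "Suc j"] R[of j] by (metis Int_left_commute Int_empty_right)
    ultimately show ?thesis by simp
  qed
  have xy: "(\<lambda>j. e (n j) (P j) * e (n j) (?R j)) \<longlonglongrightarrow> l A"
    using tendsto_mult[OF x y] by simp
  have "(\<lambda>j. e (n j) A / (e (n j) (P j) * e (n j) (?R j))) \<longlonglongrightarrow> 1"
    using tendsto_divide[OF along[OF Tr'(1)] xy nz[OF A]] nz[OF A] by simp
  moreover have "\<forall>\<^sub>F j in sequentially. e (n j) A / (e (n j) (P j) * e (n j) (?R j)) = e (n j) (?B j)"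
    using tendsto_imp_eventually_ne[OF xy nz[OF A]] by eventually_elim (simp add: eA)
  ultimately have b: "(\<lambda>j. e (n j) (?B j)) \<longlonglongrightarrow> 1"
    using tendsto_cong by fastforce
  have eT: "e (n j) (T (k j)) = e (n j) (?B j) * e (n j) (T (K j))" for j
  proof -
    have "T (k j) = ?B j \<union> T (K j)" using anti[OF Tr'(3)[of j]] by auto
    then show ?thesis using mult[OF B T(1), of j "K j" "n j"] by auto
  qed
  have "(\<lambda>j. e (n j) (T (k j))) \<longlonglongrightarrow> 1" unfolding eT using tendsto_mult[OF b z] by simp
  then have "\<forall>\<^sub>F j in sequentially. dist (e (n j) (T (k j))) 1 < \<epsilon> / 2"
    using \<epsilon> by (intro tendstoD) auto
  then obtain j where j: "norm (e (n j) (T (k j)) - 1) < \<epsilon> / 2"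
    by (auto simp: eventually_sequentially dist_norm)
  have "norm (l (T (k j)) - 1) \<le> norm (e (n j) (T (k j)) - 1) + norm (e (n j) (T (k j)) - l (T (k j)))"
    by (metis add.commute dist_commute dist_norm dist_triangle)
  with j Tr'(7)[of j] kbad[of j] show False by linarith
qed

section \<open>Characteristic functions and convergence in probability\<close>

definition chf :: "'w measure \<Rightarrow> ('w \<Rightarrow> real) \<Rightarrow> real \<Rightarrow> complex" where
  "chf M X u = (CLINT \<omega>|M. iexp (u * X \<omega>))"

lemma norm_iexp_minus_1_le: "norm (iexp x - 1) \<le> \<bar>x\<bar>"
  using iexp_approx1[of x 0] by simp

lemma min_2_mult_le: "min 2 (a * d) \<le> (2 + a) * min 1 d" if "0 \<le> a" "0 \<le> d" for a d :: real
  using that mult_nonneg_nonneg[OF that] mult_left_mono[of 1 d a] by (auto simp: min_def distrib_right)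

lemma norm_iexp_diff_le: "norm (iexp a - iexp b) \<le> min 2 \<bar>a - b\<bar>"
proof -
  have "iexp a - iexp b = iexp b * (iexp (a - b) - 1)"
    by (simp add: algebra_simps flip: exp_add)
  then have "norm (iexp a - iexp b) = norm (iexp (a - b) - 1)"
    by (simp add: norm_mult)
  also have "\<dots> \<le> \<bar>a - b\<bar>" by (rule norm_iexp_minus_1_le)
  finally have 1: "norm (iexp a - iexp b) \<le> \<bar>a - b\<bar>" .
  have "norm (iexp a - iexp b) \<le> norm (iexp a) + norm (iexp b)" by (rule norm_triangle_ineq4)
  then show ?thesis using 1 by simp
qed

text \<open>
  If \<open>f\<close> is not integrable, its integral is zero by convention.
\<close>
lemma norm_integral_le:
  fixes f :: "'a \<Rightarrow> 'b::{banach,second_countable_topology}"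
  assumes g: "integrable M g" and le: "AE x in M. norm (f x) \<le> g x"
  shows "norm (integral\<^sup>L M f) \<le> integral\<^sup>L M g"
proof (cases "integrable M f")
  case True
  have "norm (integral\<^sup>L M f) \<le> (LINT x|M. norm (f x))" by (rule integral_norm_bound)
  also have "\<dots> \<le> integral\<^sup>L M g" using True g le by (intro integral_mono_AE) auto
  finally show ?thesis .
next
  case False
  have "AE x in M. 0 \<le> g x" using le by eventually_elim (use norm_ge_zero order_trans in blast)
  then show ?thesis using False by (simp add: not_integrable_integral_eq integral_nonneg_AE)
qed

context prob_space
begin

lemma integrable_min_1: "X \<in> borel_measurable M \<Longrightarrow> integrable M (\<lambda>\<omega>. min 1 \<bar>X \<omega> :: real\<bar>)"
  by (rule integrable_const_bound[of _ 1]) auto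

text \<open>
  Truncated \<open>L\<^sup>1\<close> distances obey the triangle inequality and yield almost surely convergent subsequences.
\<close>
lemma tendsto_in_prob_imp_L1:
  assumes [measurable]: "\<And>n. X n \<in> borel_measurable M" "Z \<in> borel_measurable M"
    and lim: "tendsto_in_prob M X Z"
  shows "(\<lambda>n. LINT \<omega>|M. min 1 \<bar>X n \<omega> - Z \<omega>\<bar>) \<longlonglongrightarrow> 0"
proof (rule LIMSEQ_I)
  fix \<epsilon> :: real assume "\<epsilon> > 0"
  define d where "d = \<epsilon> / 2"
  have d: "d > 0" using \<open>\<epsilon> > 0\<close> by (simp add: d_def)
  have "(\<lambda>n. measure M {\<omega> \<in> space M. d < \<bar>X n \<omega> - Z \<omega>\<bar>}) \<longlonglongrightarrow> 0"
    using lim d by (auto simp: tendsto_in_prob_def)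
  then have "\<forall>\<^sub>F n in sequentially. measure M {\<omega> \<in> space M. d < \<bar>X n \<omega> - Z \<omega>\<bar>} < d"
    using d by (auto dest: order_tendstoD)
  then obtain N where N: "\<And>n. n \<ge> N \<Longrightarrow> measure M {\<omega> \<in> space M. d < \<bar>X n \<omega> - Z \<omega>\<bar>} < d"
    by (auto simp: eventually_sequentially)
  have "norm (LINT \<omega>|M. min 1 \<bar>X n \<omega> - Z \<omega>\<bar>) < \<epsilon>" if "n \<ge> N" for n
  proof -
    let ?E = "{\<omega> \<in> space M. d < \<bar>X n \<omega> - Z \<omega>\<bar>}"
    have E: "?E \<in> sets M" by measurable
    have "(LINT \<omega>|M. min 1 \<bar>X n \<omega> - Z \<omega>\<bar>) \<le> (LINT \<omega>|M. d + indicator ?E \<omega>)"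
    proof (rule integral_mono)
      show "integrable M (\<lambda>\<omega>. d + indicator ?E \<omega>)"
        using E by (auto intro!: Bochner_Integration.integrable_add integrable_real_indicator simp: emeasure_eq_measure)
    qed (use d in \<open>auto intro!: integrable_min_1 simp: indicator_def\<close>)
    also have "\<dots> = d + measure M ?E"
      using E by (subst Bochner_Integration.integral_add) (auto simp: prob_space emeasure_eq_measure)
    also have "\<dots> < \<epsilon>" using N[OF that] by (simp add: d_def)
    finally show ?thesis by (simp add: integral_nonneg_AE)
  qed
  then show "\<exists>N. \<forall>n\<ge>N. norm ((LINT \<omega>|M. min 1 \<bar>X n \<omega> - Z \<omega>\<bar>) - 0) < \<epsilon>" by auto
qed

lemma integrable_iexp_rv: "X \<in> borel_measurable M \<Longrightarrow> integrable M (\<lambda>\<omega>. iexp (u * X \<omega>))"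
  by (rule integrable_iexp) auto

lemma chf_tendsto:
  assumes [measurable]: "\<And>n. X n \<in> borel_measurable M" "Z \<in> borel_measurable M"
    and lim: "tendsto_in_prob M X Z"
  shows "(\<lambda>n. chf M (X n) u) \<longlonglongrightarrow> chf M Z u"
proof (rule LIM_zero_cancel, rule Lim_null_comparison)
  show "(\<lambda>n. (2 + \<bar>u\<bar>) * (LINT \<omega>|M. min 1 \<bar>X n \<omega> - Z \<omega>\<bar>)) \<longlonglongrightarrow> 0"
    using tendsto_mult_right_zero[OF tendsto_in_prob_imp_L1[OF assms]] by simp
  have "norm (chf M (X n) u - chf M Z u) \<le> (2 + \<bar>u\<bar>) * (LINT \<omega>|M. min 1 \<bar>X n \<omega> - Z \<omega>\<bar>)" for n
  proof -
    have "chf M (X n) u - chf M Z u = (CLINT \<omega>|M. iexp (u * X n \<omega>) - iexp (u * Z \<omega>))"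
      unfolding chf_def by (subst Bochner_Integration.integral_diff) (auto simp del: of_real_mult intro!: integrable_iexp_rv)
    also have "norm \<dots> \<le> (LINT \<omega>|M. (2 + \<bar>u\<bar>) * min 1 \<bar>X n \<omega> - Z \<omega>\<bar>)"
    proof (rule norm_integral_le, goal_cases)
      case 1
      show ?case by (auto intro!: integrable_min_1 integrable_mult_right)
    next
      case 2
      show ?case
      proof (rule AE_I2)
      fix \<omega>
      have "norm (iexp (u * X n \<omega>) - iexp (u * Z \<omega>)) \<le> min 2 \<bar>u * X n \<omega> - u * Z \<omega>\<bar>"
        by (rule norm_iexp_diff_le)
      also have "\<dots> = min 2 (\<bar>u\<bar> * \<bar>X n \<omega> - Z \<omega>\<bar>)"
        by (simp add: abs_mult flip: right_diff_distrib)
      also have "\<dots> \<le> (2 + \<bar>u\<bar>) * min 1 \<bar>X n \<omega> - Z \<omega>\<bar>"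
        by (rule min_2_mult_le) auto
      finally show "norm (iexp (u * X n \<omega>) - iexp (u * Z \<omega>)) \<le> (2 + \<bar>u\<bar>) * min 1 \<bar>X n \<omega> - Z \<omega>\<bar>" .
    qed
    qed
    finally show ?thesis by simp
  qed
  then show "\<forall>\<^sub>F n in sequentially. norm (chf M (X n) u - chf M Z u) \<le> (2 + \<bar>u\<bar>) * (LINT \<omega>|M. min 1 \<bar>X n \<omega> - Z \<omega>\<bar>)"
    by simp
qed

text \<open>
  Besides uniqueness of limits in probability (take \<open>X2\<close> and \<open>Z2\<close> zero), this splits an integral along two
  disjoint sets.
\<close>
lemma tendsto_in_prob_add_unique:
  assumes meas[measurable]: "\<And>n. X n \<in> borel_measurable M" "Z \<in> borel_measurable M"
      "\<And>n. X1 n \<in> borel_measurable M" "Z1 \<in> borel_measurable M"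
      "\<And>n. X2 n \<in> borel_measurable M" "Z2 \<in> borel_measurable M"
    and lim: "tendsto_in_prob M X Z" "tendsto_in_prob M X1 Z1" "tendsto_in_prob M X2 Z2"
    and add: "\<And>n. AE \<omega> in M. X n \<omega> = X1 n \<omega> + X2 n \<omega>"
  shows "AE \<omega> in M. Z \<omega> = Z1 \<omega> + Z2 \<omega>"
proof -
  let ?D = "\<lambda>X Z \<omega>. min 1 \<bar>X \<omega> - Z \<omega> :: real\<bar>"
  have le: "(LINT \<omega>|M. min 1 \<bar>Z \<omega> - (Z1 \<omega> + Z2 \<omega>)\<bar>) \<le>
      (LINT \<omega>|M. ?D (X n) Z \<omega>) + (LINT \<omega>|M. ?D (X1 n) Z1 \<omega>) + (LINT \<omega>|M. ?D (X2 n) Z2 \<omega>)" for n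
  proof -
    have "(LINT \<omega>|M. min 1 \<bar>Z \<omega> - (Z1 \<omega> + Z2 \<omega>)\<bar>) \<le>
      (LINT \<omega>|M. ?D (X n) Z \<omega> + ?D (X1 n) Z1 \<omega> + ?D (X2 n) Z2 \<omega>)"
      by (rule integral_mono_AE)
         (use add[of n] in \<open>auto intro!: integrable_min_1 Bochner_Integration.integrable_add elim!: eventually_mono\<close>)
    also have "\<dots> = (LINT \<omega>|M. ?D (X n) Z \<omega>) + (LINT \<omega>|M. ?D (X1 n) Z1 \<omega>) + (LINT \<omega>|M. ?D (X2 n) Z2 \<omega>)"
      by (subst Bochner_Integration.integral_add, (auto intro!: integrable_min_1 Bochner_Integration.integrable_add)[2])+ simp
    finally show ?thesis .
  qed
  have "(\<lambda>n. (LINT \<omega>|M. ?D (X n) Z \<omega>) + (LINT \<omega>|M. ?D (X1 n) Z1 \<omega>) + (LINT \<omega>|M. ?D (X2 n) Z2 \<omega>)) \<longlonglongrightarrow> 0 + 0 + 0"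
    by (intro tendsto_add tendsto_in_prob_imp_L1 meas lim)
  then have "(LINT \<omega>|M. min 1 \<bar>Z \<omega> - (Z1 \<omega> + Z2 \<omega>)\<bar>) \<le> 0 + 0 + 0"
    by (rule LIMSEQ_le_const) (use le in auto)
  moreover have "(LINT \<omega>|M. min 1 \<bar>Z \<omega> - (Z1 \<omega> + Z2 \<omega>)\<bar>) \<ge> 0"
    by (rule integral_nonneg_AE) auto
  ultimately have "(LINT \<omega>|M. min 1 \<bar>Z \<omega> - (Z1 \<omega> + Z2 \<omega>)\<bar>) = 0" by simp
  then have "AE \<omega> in M. min 1 \<bar>Z \<omega> - (Z1 \<omega> + Z2 \<omega>)\<bar> = 0"
    by (subst (asm) integral_nonneg_eq_0_iff_AE) (auto intro!: integrable_min_1)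
  then show ?thesis by eventually_elim (auto simp: min_def split: if_splits)
qed

lemma tendsto_in_prob_AE_subseq:
  assumes I: "finite I"
    and meas[measurable]: "\<And>i n. i \<in> I \<Longrightarrow> X i n \<in> borel_measurable M" "\<And>i. i \<in> I \<Longrightarrow> Z i \<in> borel_measurable M"
    and lim: "\<And>i. i \<in> I \<Longrightarrow> tendsto_in_prob M (X i) (Z i)"
  shows "\<exists>r::nat \<Rightarrow> nat. strict_mono r \<and> (AE \<omega> in M. \<forall>i\<in>I. (\<lambda>n. X i (r n) \<omega>) \<longlonglongrightarrow> Z i \<omega>)"
proof -
  define D where "D n \<omega> = (\<Sum>i\<in>I. min 1 \<bar>X i n \<omega> - Z i \<omega>\<bar>)" for n \<omega>
  have int: "integrable M (D n)" for n
    unfolding D_def by (intro Bochner_Integration.integrable_sum integrable_min_1 borel_measurable_diff meas)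
  have "(\<lambda>n. LINT \<omega>|M. norm (D n \<omega>)) \<longlonglongrightarrow> 0"
  proof -
    have "(LINT \<omega>|M. norm (D n \<omega>)) = (\<Sum>i\<in>I. LINT \<omega>|M. min 1 \<bar>X i n \<omega> - Z i \<omega>\<bar>)" for n
    proof -
      have "norm (D n \<omega>) = D n \<omega>" for \<omega> unfolding D_def real_norm_def by (intro abs_of_nonneg sum_nonneg) auto
      then have "(LINT \<omega>|M. norm (D n \<omega>)) = (LINT \<omega>|M. D n \<omega>)" by simp
      also have "\<dots> = (\<Sum>i\<in>I. LINT \<omega>|M. min 1 \<bar>X i n \<omega> - Z i \<omega>\<bar>)"
        unfolding D_def by (intro Bochner_Integration.integral_sum integrable_min_1 borel_measurable_diff meas)
      finally show ?thesis .
    qed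
    then show ?thesis
      using tendsto_null_sum[of I "\<lambda>n i. LINT \<omega>|M. min 1 \<bar>X i n \<omega> - Z i \<omega>\<bar>" sequentially]
        tendsto_in_prob_imp_L1[OF meas lim] by simp
  qed
  then obtain r where r: "strict_mono r" "AE \<omega> in M. (\<lambda>n. D (r n) \<omega>) \<longlonglongrightarrow> 0"
    using tendsto_L1_AE_subseq[of M D] int by blast
  have "AE \<omega> in M. \<forall>i\<in>I. (\<lambda>n. X i (r n) \<omega>) \<longlonglongrightarrow> Z i \<omega>"
    using r(2)
  proof eventually_elim
    case (elim \<omega>)
    show ?case
    proof
      fix i assume i: "i \<in> I"
      have le: "min 1 \<bar>X i (r n) \<omega> - Z i \<omega>\<bar> \<le> D (r n) \<omega>" for n
        unfolding D_def using i I by (intro member_le_sum) auto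
      have "\<forall>\<^sub>F n in sequentially. D (r n) \<omega> < 1" using elim by (rule order_tendstoD) simp
      then have "\<forall>\<^sub>F n in sequentially. norm (X i (r n) \<omega> - Z i \<omega>) \<le> D (r n) \<omega>"
        proof eventually_elim
        case (elim n)
        then show ?case using le[of n] by (auto simp: min_def split: if_splits)
      qed
      from Lim_null_comparison[OF this elim] show "(\<lambda>n. X i (r n) \<omega>) \<longlonglongrightarrow> Z i \<omega>"
        by (rule LIM_zero_cancel)
    qed
  qed
  with r(1) show ?thesis by blast
qed

lemma one_minus_Re_chf:
  assumes [measurable]: "X \<in> borel_measurable M"
  shows "(LINT \<omega>|M. 1 - cos (u * X \<omega>)) = 1 - Re (chf M X u)"
    and "integrable M (\<lambda>\<omega>. 1 - cos (u * X \<omega>))"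
proof -
  have i: "integrable M (\<lambda>\<omega>. cos (u * X \<omega>))"
    by (rule integrable_const_bound[of _ 1]) auto
  have "Re (chf M X u) = (LINT \<omega>|M. Re (iexp (u * X \<omega>)))"
    unfolding chf_def by (rule integral_Re[symmetric]) (auto simp del: of_real_mult intro!: integrable_iexp_rv)
  then have "Re (chf M X u) = (LINT \<omega>|M. cos (u * X \<omega>))" by (simp add: Re_exp)
  with i show "(LINT \<omega>|M. 1 - cos (u * X \<omega>)) = 1 - Re (chf M X u)"
    by (subst Bochner_Integration.integral_diff) (auto simp: prob_space)
  show "integrable M (\<lambda>\<omega>. 1 - cos (u * X \<omega>))" using i by auto
qed

lemma norm_chf_le_1: "norm (chf M X u) \<le> 1"
proof (cases "integrable M (\<lambda>\<omega>. iexp (u * X \<omega>))")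
  case True
  have "norm (chf M X u) \<le> (LINT \<omega>|M. norm (iexp (u * X \<omega>)))"
    unfolding chf_def by (rule integral_norm_bound)
  also have "\<dots> = 1" by (simp add: prob_space del: of_real_mult)
  finally show ?thesis .
qed (simp add: chf_def not_integrable_integral_eq)

lemma isCont_chf:
  assumes [measurable]: "X \<in> borel_measurable M"
  shows "isCont (chf M X) u"
  unfolding continuous_at_sequentially
proof safe
  fix U assume U: "U \<longlonglongrightarrow> u"
  show "(chf M X \<circ> U) \<longlonglongrightarrow> chf M X u"
    unfolding comp_def chf_def
    by (rule integral_dominated_convergence[where w="\<lambda>_. 1"]) (auto intro!: tendsto_intros U)
qed

lemma chf_0: "chf M X 0 = 1"
  by (simp add: chf_def prob_space)

lemma two_one_minus_cos_tendsto: "(\<lambda>n. 2 * (1 - cos (1 / real (Suc n) * x)) * (real (Suc n))\<^sup>2) \<longlonglongrightarrow> x\<^sup>2"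
proof -
  have "((\<lambda>h. sin (x * h)) has_real_derivative x) (at 0)"
    by (auto intro!: derivative_eq_intros)
  then have *: "((\<lambda>h. sin (x * h) / h) \<longlongrightarrow> x) (at 0)"
    by (simp add: has_field_derivative_iff)
  have "filterlim (\<lambda>n. 1 / (2 * real (Suc n))) (at 0) sequentially"
  proof -
    have "(\<lambda>n. 1 / (2 * real (Suc n))) \<longlonglongrightarrow> 0"
      using tendsto_mult_right_zero[OF LIMSEQ_inverse_real_of_nat, of "1/2"] by (simp add: field_simps)
    then show ?thesis by (auto simp: filterlim_at)
  qed
  from filterlim_compose[OF * this]
  have "(\<lambda>n. sin (x * (1 / (2 * real (Suc n)))) / (1 / (2 * real (Suc n)))) \<longlonglongrightarrow> x" .
  from tendsto_power[OF this, of 2]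
  have 2: "(\<lambda>n. (sin (x * (1 / (2 * real (Suc n)))) / (1 / (2 * real (Suc n))))\<^sup>2) \<longlonglongrightarrow> x\<^sup>2" .
  have "2 * (1 - cos (1 / k * x)) * k\<^sup>2 = (sin (x * (1 / (2 * k))) / (1 / (2 * k)))\<^sup>2" if "k > 0" for k :: real
  proof -
    have "cos (2 * (x / (2 * k))) = 1 - 2 * (sin (x / (2 * k)))\<^sup>2" by (rule cos_double_sin)
    then have "1 - cos (1 / k * x) = 2 * (sin (x * (1 / (2 * k))))\<^sup>2" using that by simp
    then show ?thesis using that by (simp add: power_divide power_mult_distrib)
  qed
  then show ?thesis using 2 by (simp only: of_nat_0_less_iff zero_less_Suc)
qed

text \<open>
  Fatou's lemma for \<open>2 * (1 - cos (x / n)) * n\<^sup>2 \<longlonglongrightarrow> x\<^sup>2\<close>; finiteness of the second moment comes out as a by-product.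
\<close>
lemma second_moment_le:
  assumes [measurable]: "X \<in> borel_measurable M" and le: "\<And>u. 1 - Re (chf M X u) \<le> C * u\<^sup>2 / 2"
  shows "(\<integral>\<^sup>+\<omega>. ennreal ((X \<omega>)\<^sup>2) \<partial>M) \<le> ennreal C"
proof -
  let ?f = "\<lambda>n \<omega>. 2 * (1 - cos (1 / real (Suc n) * X \<omega>)) * (real (Suc n))\<^sup>2"
  have "(\<integral>\<^sup>+\<omega>. ennreal ((X \<omega>)\<^sup>2) \<partial>M) = (\<integral>\<^sup>+\<omega>. liminf (\<lambda>n. ennreal (?f n \<omega>)) \<partial>M)"
  proof (rule nn_integral_cong)
    fix \<omega>
    have "(\<lambda>n. ennreal (?f n \<omega>)) \<longlonglongrightarrow> ennreal ((X \<omega>)\<^sup>2)"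
      by (intro tendsto_ennrealI two_one_minus_cos_tendsto)
    then show "ennreal ((X \<omega>)\<^sup>2) = liminf (\<lambda>n. ennreal (?f n \<omega>))"
      by (rule lim_imp_Liminf[OF sequentially_bot, symmetric])
  qed
  also have "\<dots> \<le> liminf (\<lambda>n. \<integral>\<^sup>+\<omega>. ennreal (?f n \<omega>) \<partial>M)"
    by (rule nn_integral_liminf) measurable
  also have "\<dots> \<le> liminf (\<lambda>n. ennreal C)"
  proof (rule Liminf_mono, rule always_eventually, rule allI)
    fix n
    define k where "k = real (Suc n)"
    have k: "k > 0" by (simp add: k_def)
    have i: "integrable M (\<lambda>\<omega>. 2 * (1 - cos (1 / k * X \<omega>)) * k\<^sup>2)"
      using one_minus_Re_chf(2)[of X "1 / k"] by (intro integrable_mult_left integrable_mult_right) auto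
    have "(\<integral>\<^sup>+\<omega>. ennreal (?f n \<omega>) \<partial>M) = ennreal (LINT \<omega>|M. ?f n \<omega>)"
      using i by (intro nn_integral_eq_integral) (auto simp: k_def)
    also have "(LINT \<omega>|M. ?f n \<omega>) = 2 * (1 - Re (chf M X (1 / k))) * k\<^sup>2"
      unfolding k_def[symmetric] by (simp only: integral_mult_left_zero integral_mult_right_zero one_minus_Re_chf(1)[OF assms(1)])
    also have "\<dots> \<le> 2 * (C * (1 / k)\<^sup>2 / 2) * k\<^sup>2"
      by (intro mult_right_mono mult_left_mono le) auto
    also have "\<dots> = C" using k by (simp add: field_simps)
    finally show "(\<integral>\<^sup>+\<omega>. ennreal (?f n \<omega>) \<partial>M) \<le> ennreal C" by (simp add: ennreal_leI)
  qed
  also have "\<dots> = ennreal C" by (simp add: Liminf_const)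
  finally show ?thesis .
qed

lemma chf_eq_1_imp_AE_0:
  assumes [measurable]: "X \<in> borel_measurable M" and "\<And>u. chf M X u = 1"
  shows "AE \<omega> in M. X \<omega> = 0"
proof -
  have "(\<integral>\<^sup>+\<omega>. ennreal ((X \<omega>)\<^sup>2) \<partial>M) \<le> ennreal 0"
    by (rule second_moment_le) (auto simp: assms)
  then have "AE \<omega> in M. ennreal ((X \<omega>)\<^sup>2) = 0"
    by (subst (asm) ennreal_0, subst nn_integral_0_iff_AE[symmetric]) auto
  then show ?thesis by eventually_elim auto
qed

lemma first_moment_le_sqrt_second_moment:
  assumes [measurable]: "X \<in> borel_measurable M" and "(\<integral>\<^sup>+\<omega>. ennreal ((X \<omega>)\<^sup>2) \<partial>M) \<le> ennreal C" and C: "C \<ge> 0"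
  shows "integrable M X" "(LINT \<omega>|M. \<bar>X \<omega>\<bar>) \<le> sqrt C"
proof -
  have fin: "(\<integral>\<^sup>+\<omega>. ennreal ((X \<omega>)\<^sup>2) \<partial>M) < \<infinity>"
    using assms(2) by (rule order_le_less_trans) simp
  have i2: "integrable M (\<lambda>\<omega>. (X \<omega>)\<^sup>2)"
    by (rule integrableI_bounded) (use fin in auto)
  show i: "integrable M X"
    by (rule square_integrable_imp_integrable[OF _ i2]) auto
  have "ennreal (LINT \<omega>|M. (X \<omega>)\<^sup>2) \<le> ennreal C"
    using assms(2) by (subst nn_integral_eq_integral[symmetric]) (auto intro: i2)
  then have "(LINT \<omega>|M. (X \<omega>)\<^sup>2) \<le> C" using C by (simp add: ennreal_le_iff)
  moreover have "variance (\<lambda>\<omega>. \<bar>X \<omega>\<bar>) = (LINT \<omega>|M. (X \<omega>)\<^sup>2) - (LINT \<omega>|M. \<bar>X \<omega>\<bar>)\<^sup>2"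
    using i i2 by (subst variance_eq) auto
  moreover have "variance (\<lambda>\<omega>. \<bar>X \<omega>\<bar>) \<ge> 0" by (rule variance_positive)
  ultimately have "(LINT \<omega>|M. \<bar>X \<omega>\<bar>)\<^sup>2 \<le> C" by linarith
  then show "(LINT \<omega>|M. \<bar>X \<omega>\<bar>) \<le> sqrt C" by (rule real_le_rsqrt)
qed

end

section \<open>First moments from characteristic functions\<close>

text \<open>
  The integral is \<open>\<pi>\<close>. As the constant occurs on both sides of every estimate, positivity and
  finiteness are enough.
\<close>
definition cos_const :: ennreal where
  "cos_const = (\<integral>\<^sup>+u. ennreal ((1 - cos u) / u\<^sup>2) \<partial>lborel)"

lemma one_minus_cos_le: "1 - cos x \<le> x\<^sup>2 / 2" for x :: real
proof -
  have "cos (2 * (x / 2)) = 1 - 2 * (sin (x / 2))\<^sup>2" by (rule cos_double_sin)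
  moreover have "(sin (x / 2))\<^sup>2 \<le> (x / 2)\<^sup>2"
    using abs_sin_x_le_abs_x[of "x / 2"] by (metis abs_le_square_iff)
  ultimately show ?thesis by (simp add: power2_eq_square)
qed

lemma nn_integral_inverse_1_plus_square_finite: "(\<integral>\<^sup>+x. ennreal (inverse (1 + x\<^sup>2)) \<partial>lborel) < \<infinity>"
proof -
  have "integrable lborel (\<lambda>x::real. inverse (1 + x\<^sup>2))"
    using integrable_inverse_1_plus_square by (simp add: set_integrable_def)
  then show ?thesis by (auto simp: integrable_iff_bounded)
qed

lemma nn_integral_min_2_square_finite: "(\<integral>\<^sup>+u. ennreal (min 2 (C * u\<^sup>2) / u\<^sup>2) \<partial>lborel) < \<infinity>" if "C \<ge> 0"
proof -
  have "(\<integral>\<^sup>+u. ennreal (min 2 (C * u\<^sup>2) / u\<^sup>2) \<partial>lborel) \<le> (\<integral>\<^sup>+u. ennreal (2 + C) * ennreal (inverse (1 + u\<^sup>2)) \<partial>lborel)"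
  proof (rule nn_integral_mono)
    fix u :: real
    have "min 2 (C * u\<^sup>2) / u\<^sup>2 \<le> (2 + C) * inverse (1 + u\<^sup>2)"
    proof (cases "u = 0")
      case False
      then have u: "u\<^sup>2 > 0" by simp
      have "1 + u\<^sup>2 > 0" by (simp add: add_pos_nonneg)
      moreover have "min 2 (C * u\<^sup>2) * (1 + u\<^sup>2) \<le> (2 + C) * u\<^sup>2"
        using mult_right_mono[of "min 2 (C * u\<^sup>2)" 2 "u\<^sup>2"] by (simp add: algebra_simps)
      ultimately have "min 2 (C * u\<^sup>2) \<le> (2 + C) * u\<^sup>2 / (1 + u\<^sup>2)" by (simp add: pos_le_divide_eq)
      then have "min 2 (C * u\<^sup>2) / u\<^sup>2 \<le> ((2 + C) * u\<^sup>2 / (1 + u\<^sup>2)) / u\<^sup>2" by (rule divide_right_mono) simp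
      also have "\<dots> = (2 + C) * inverse (1 + u\<^sup>2)" using u by (simp add: divide_inverse)
      finally show ?thesis .
    qed (use that in simp)
    then show "ennreal (min 2 (C * u\<^sup>2) / u\<^sup>2) \<le> ennreal (2 + C) * ennreal (inverse (1 + u\<^sup>2))"
      using that by (subst ennreal_mult[symmetric]) (auto intro: ennreal_leI)
  qed
  also have "\<dots> = ennreal (2 + C) * (\<integral>\<^sup>+u. ennreal (inverse (1 + u\<^sup>2)) \<partial>lborel)"
    by (rule nn_integral_cmult) measurable
  also have "\<dots> < \<infinity>" using nn_integral_inverse_1_plus_square_finite
    by (simp add: ennreal_mult_less_top)
  finally show ?thesis .
qed

lemma cos_const_finite: "cos_const < \<infinity>"
proof -
  have "cos_const \<le> (\<integral>\<^sup>+u. ennreal (min 2 (1/2 * u\<^sup>2) / u\<^sup>2) \<partial>lborel)"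
    unfolding cos_const_def
  proof (rule nn_integral_mono, rule ennreal_leI, rule divide_right_mono)
    fix u :: real
    have "1 - cos u \<le> 2" using cos_ge_minus_one[of u] by linarith
    then show "1 - cos u \<le> min 2 (1/2 * u\<^sup>2)" using one_minus_cos_le[of u] by simp
  qed simp
  also have "\<dots> < \<infinity>" by (rule nn_integral_min_2_square_finite) simp
  finally show ?thesis .
qed

lemma cos_const_pos: "cos_const > 0"
proof (rule ccontr)
  assume "\<not> cos_const > 0"
  then have "(\<integral>\<^sup>+u. ennreal ((1 - cos u) / u\<^sup>2) \<partial>lborel) = 0" by (simp add: cos_const_def zero_less_iff_neq_zero)
  then have "AE u::real in lborel. ennreal ((1 - cos u) / u\<^sup>2) = 0"
    by (subst (asm) nn_integral_0_iff_AE) auto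
  then have "AE u::real in lborel. u \<notin> {1..2}"
  proof eventually_elim
    case (elim u)
    show ?case
    proof
      assume u: "u \<in> {1..2}"
      have "cos u < cos 0" by (rule cos_monotone_0_pi) (use u pi_gt3 in auto)
      then have "(1 - cos u) / u\<^sup>2 > 0" using u by auto
      then show False using elim by (simp add: ennreal_eq_0_iff)
    qed
  qed
  then have "{1..2::real} \<in> null_sets lborel" by (subst AE_iff_null_sets) auto
  then show False by (auto simp: null_sets_def)
qed

lemma cos_const_scale: "(\<integral>\<^sup>+u. ennreal ((1 - cos (u * x)) / u\<^sup>2) \<partial>lborel) = cos_const * ennreal \<bar>x\<bar>"
proof (cases "x = 0")
  case False
  have "cos_const = \<bar>x\<bar> * (\<integral>\<^sup>+u. ennreal ((1 - cos (0 + x * u)) / (0 + x * u)\<^sup>2) \<partial>lborel)"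
    unfolding cos_const_def using False by (intro nn_integral_real_affine) auto
  also have "\<dots> = \<bar>x\<bar> * (\<integral>\<^sup>+u. ennreal (1 / x\<^sup>2) * ennreal ((1 - cos (u * x)) / u\<^sup>2) \<partial>lborel)"
    by (simp add: power_mult_distrib mult.commute flip: ennreal_mult)
  also have "\<dots> = \<bar>x\<bar> * (ennreal (1 / x\<^sup>2) * (\<integral>\<^sup>+u. ennreal ((1 - cos (u * x)) / u\<^sup>2) \<partial>lborel))"
    by (subst nn_integral_cmult) auto
  finally have "cos_const * ennreal \<bar>x\<bar> =
      (ennreal \<bar>x\<bar> * ennreal (1 / x\<^sup>2) * ennreal \<bar>x\<bar>) * (\<integral>\<^sup>+u. ennreal ((1 - cos (u * x)) / u\<^sup>2) \<partial>lborel)"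
    by (simp add: mult_ac)
  also have "ennreal \<bar>x\<bar> * ennreal (1 / x\<^sup>2) * ennreal \<bar>x\<bar> = 1"
    using False by (simp add: power2_eq_square flip: ennreal_mult)
  finally show ?thesis by simp
qed simp

text \<open>
  Tonelli's theorem in \<open>cos_const * \<bar>x\<bar> = \<integral> (1 - cos (u * x)) / u\<^sup>2\<close>. Both sides may be infinite.
\<close>
lemma (in prob_space) first_moment_chf:
  assumes [measurable]: "X \<in> borel_measurable M"
  shows "cos_const * (\<integral>\<^sup>+\<omega>. ennreal \<bar>X \<omega>\<bar> \<partial>M) = (\<integral>\<^sup>+u. ennreal ((1 - Re (chf M X u)) / u\<^sup>2) \<partial>lborel)"
proof -
  interpret p: pair_sigma_finite M lborel by (intro pair_sigma_finite.intro sigma_finite_measure_axioms sigma_finite_lborel)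
  have "cos_const * (\<integral>\<^sup>+\<omega>. ennreal \<bar>X \<omega>\<bar> \<partial>M) = (\<integral>\<^sup>+\<omega>. cos_const * ennreal \<bar>X \<omega>\<bar> \<partial>M)"
    by (rule nn_integral_cmult[symmetric]) auto
  also have "\<dots> = (\<integral>\<^sup>+\<omega>. (\<integral>\<^sup>+u. ennreal ((1 - cos (u * X \<omega>)) / u\<^sup>2) \<partial>lborel) \<partial>M)"
    by (simp add: cos_const_scale)
  also have "\<dots> = (\<integral>\<^sup>+u. (\<integral>\<^sup>+\<omega>. ennreal ((1 - cos (u * X \<omega>)) / u\<^sup>2) \<partial>M) \<partial>lborel)"
    by (rule p.Fubini'[symmetric]) measurable
  also have "\<dots> = (\<integral>\<^sup>+u. ennreal ((1 - Re (chf M X u)) / u\<^sup>2) \<partial>lborel)"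
  proof (rule nn_integral_cong)
    fix u :: real
    have "(\<integral>\<^sup>+\<omega>. ennreal ((1 - cos (u * X \<omega>)) / u\<^sup>2) \<partial>M) = ennreal (LINT \<omega>|M. (1 - cos (u * X \<omega>)) / u\<^sup>2)"
      using one_minus_Re_chf(2)[of X u] by (intro nn_integral_eq_integral) auto
    also have "(LINT \<omega>|M. (1 - cos (u * X \<omega>)) / u\<^sup>2) = (1 - Re (chf M X u)) / u\<^sup>2"
      using one_minus_Re_chf(1)[of X u] by simp
    finally show "(\<integral>\<^sup>+\<omega>. ennreal ((1 - cos (u * X \<omega>)) / u\<^sup>2) \<partial>M) = ennreal ((1 - Re (chf M X u)) / u\<^sup>2)" .
  qed
  finally show ?thesis .
qed

section \<open>From continuous to Borel test functions\<close>

text \<open>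
  Independence survives limits in the form of product formulas with continuous test functions, and is
  needed for Borel ones. After adding a constant to \<open>G\<close> the two sides are finite measures, evaluated
  at \<open>F\<close>; they agree on closed sets, whose indicators are decreasing limits of continuous functions, and hence
  on all Borel sets.
\<close>
lemma (in prob_space) product_formula_Borel:
  fixes W :: "'a \<Rightarrow> 'b::metric_space" and F :: "'b \<Rightarrow> real"
  assumes [measurable]: "W \<in> borel_measurable M" "G \<in> borel_measurable M" "F \<in> borel_measurable borel"
    and bG: "\<And>\<omega>. \<bar>G \<omega>\<bar> \<le> B" and bF: "\<And>x. \<bar>F x\<bar> \<le> C"
    and prod: "\<And>f. continuous_on UNIV f \<Longrightarrow> (\<And>x. f x \<in> {0..1}) \<Longrightarrow>
       (LINT \<omega>|M. f (W \<omega>) * G \<omega>) = (LINT \<omega>|M. f (W \<omega>)) * (LINT \<omega>|M. G \<omega>)"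
  shows "(LINT \<omega>|M. F (W \<omega>) * G \<omega>) = (LINT \<omega>|M. F (W \<omega>)) * (LINT \<omega>|M. G \<omega>)"
proof -
  define H where "H \<omega> = G \<omega> + B" for \<omega>
  have [measurable]: "H \<in> borel_measurable M" unfolding H_def by measurable
  have H0: "0 \<le> H \<omega>" "H \<omega> \<le> 2 * B" for \<omega> using bG[of \<omega>] by (auto simp: H_def abs_le_iff)
  have iH: "integrable M H" by (rule integrable_const_bound[of _ "2 * B"]) (auto simp: H0)
  have iG: "integrable M G" by (rule integrable_const_bound[of _ B]) (auto simp: bG)
  have H_prod: "(LINT \<omega>|M. f \<omega> * H \<omega>) = (LINT \<omega>|M. f \<omega>) * (LINT \<omega>|M. H \<omega>) \<longleftrightarrow>
      (LINT \<omega>|M. f \<omega> * G \<omega>) = (LINT \<omega>|M. f \<omega>) * (LINT \<omega>|M. G \<omega>)"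
    if [measurable]: "f \<in> borel_measurable M" and bf: "\<And>\<omega>. \<bar>f \<omega>\<bar> \<le> D" for f D
  proof -
    have D: "0 \<le> D" using bf by (meson abs_ge_zero order_trans)
    have i: "integrable M f" by (rule integrable_const_bound[of _ D]) (auto simp: bf)
    have i2: "integrable M (\<lambda>\<omega>. f \<omega> * G \<omega>)"
      by (rule integrable_const_bound[of _ "D * B"]) (auto simp: abs_mult intro!: mult_mono bf bG D)
    have "(LINT \<omega>|M. f \<omega> * H \<omega>) = (LINT \<omega>|M. f \<omega> * G \<omega>) + (LINT \<omega>|M. f \<omega>) * B"
      unfolding H_def distrib_left using i i2 by (subst Bochner_Integration.integral_add) auto
    moreover have "(LINT \<omega>|M. H \<omega>) = (LINT \<omega>|M. G \<omega>) + B"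
      unfolding H_def using iG by (subst Bochner_Integration.integral_add) (auto simp: prob_space)
    ultimately show ?thesis by (simp add: algebra_simps)
  qed
  define N1 where "N1 = distr (density M (\<lambda>\<omega>. ennreal (H \<omega>))) borel W"
  define N2 where "N2 = distr (density M (\<lambda>\<omega>. ennreal (LINT \<omega>|M. H \<omega>))) borel W"
  have EH: "0 \<le> (LINT \<omega>|M. H \<omega>)" using H0 by (intro integral_nonneg_AE) auto
  have int1: "(LINT x|N1. f x) = (LINT \<omega>|M. f (W \<omega>) * H \<omega>)" if [measurable]: "f \<in> borel_measurable borel" for f :: "'b \<Rightarrow> real"
    unfolding N1_def using H0 by (simp add: integral_distr integral_density mult.commute)
  have int2: "(LINT x|N2. f x) = (LINT \<omega>|M. f (W \<omega>)) * (LINT \<omega>|M. H \<omega>)" if [measurable]: "f \<in> borel_measurable borel" for f :: "'b \<Rightarrow> real"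
    unfolding N2_def using EH by (simp add: integral_distr integral_density mult.commute)
  have fin1: "finite_measure N1"
    unfolding N1_def
    by (intro finite_measureI) (use iH H0 in \<open>simp add: emeasure_distr emeasure_density nn_integral_eq_integral\<close>)
  have fin2: "finite_measure N2"
    unfolding N2_def
    by (intro finite_measureI) (use EH in \<open>simp add: emeasure_distr emeasure_density emeasure_space_1\<close>)
  have closed: "measure N1 K = measure N2 K" if K: "closed K" for K :: "'b set"
  proof (cases "K = {}")
    case False
    define g where "g n x = max 0 (1 - real n * infdist x K)" for n :: nat and x :: 'b
    have gc: "continuous_on UNIV (g n)" for n unfolding g_def by (intro continuous_intros)
    have [measurable]: "g n \<in> borel_measurable borel" for n using gc by (rule borel_measurable_continuous_onI)
    have g01: "g n x \<in> {0..1}" for n x by (auto simp: g_def infdist_nonneg)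
    have g01': "0 \<le> g n x" "g n x \<le> 1" for n x using g01[of n x] by auto
    have [measurable]: "K \<in> sets borel" using K by simp
    have glim: "(\<lambda>n. g n x) \<longlonglongrightarrow> indicator K x" for x
    proof (cases "x \<in> K")
      case True
      then show ?thesis by (simp add: g_def)
    next
      case False
      then have d: "infdist x K > 0" using K \<open>K \<noteq> {}\<close> in_closed_iff_infdist_zero[of K x] infdist_nonneg[of x K] by force
      have "\<forall>\<^sub>F n in sequentially. g n x = 0"
      proof -
        obtain N :: nat where N: "1 / infdist x K < real N" using reals_Archimedean2 by blast
        have "1 \<le> real n * infdist x K" if "n \<ge> N" for n
          using that N d by (simp add: field_simps) (smt (verit) of_nat_mono mult_right_mono)
        then show ?thesis by (auto simp: eventually_sequentially g_def intro!: exI[of _ N] max_absorb1)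
      qed
      then show ?thesis using False by (simp add: tendsto_eventually)
    qed
    have eqg: "(LINT x|N1. g n x) = (LINT x|N2. g n x)" for n
      using H_prod[of "\<lambda>\<omega>. g n (W \<omega>)" 1] prod[OF gc g01] g01'
      by (simp add: int1 int2)
    have l: "(\<lambda>n. LINT x|N. g n x) \<longlonglongrightarrow> measure N K"
      if "finite_measure N" and [measurable_cong]: "sets N = sets borel" for N
    proof -
      interpret N: finite_measure N by fact
      have "(\<lambda>n. LINT x|N. g n x) \<longlonglongrightarrow> (LINT x|N. indicator K x)"
        by (rule integral_dominated_convergence[where w="\<lambda>_. 1"]) (auto simp: glim g01')
      also have "(LINT x|N. indicator K x) = measure N K" using \<open>K \<in> sets borel\<close> that sets_eq_imp_space_eq[OF that(2)] by simp
      finally show ?thesis .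
    qed
    have "(\<lambda>n. LINT x|N1. g n x) \<longlonglongrightarrow> measure N1 K" using fin1 by (intro l) (auto simp: N1_def)
    moreover have "(\<lambda>n. LINT x|N1. g n x) \<longlonglongrightarrow> measure N2 K" unfolding eqg using fin2 by (intro l) (auto simp: N2_def)
    ultimately show ?thesis by (rule LIMSEQ_unique)
  qed simp
  have "N1 = N2"
  proof (rule measure_eqI_generator_eq)
    show "Int_stable {S. closed S}" by (auto simp: Int_stable_def)
    show "{S. closed S} \<subseteq> Pow UNIV" by simp
    show "emeasure N1 X = emeasure N2 X" if "X \<in> {S. closed S}" for X
      using closed[of X] that finite_measure.emeasure_eq_measure[OF fin1] finite_measure.emeasure_eq_measure[OF fin2] by simp
    have "sets borel = sigma_sets UNIV {S::'b set. closed S}" by (simp add: borel_eq_closed)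
    then show "sets N1 = sigma_sets UNIV {S. closed S}" "sets N2 = sigma_sets UNIV {S. closed S}"
      by (simp_all add: N1_def N2_def)
    show "range (\<lambda>_::nat. UNIV) \<subseteq> {S::'b set. closed S}" "(\<Union>i::nat. UNIV) = (UNIV::'b set)" by auto
    show "emeasure N1 UNIV \<noteq> \<infinity>" for i :: nat using finite_measure.emeasure_finite[OF fin1] by simp
  qed
  then have "(LINT \<omega>|M. F (W \<omega>) * H \<omega>) = (LINT \<omega>|M. F (W \<omega>)) * (LINT \<omega>|M. H \<omega>)"
    using int1[of F] int2[of F] by simp
  then show ?thesis using H_prod[of "\<lambda>\<omega>. F (W \<omega>)" C] bF by simp
qed

section \<open>Levy exponents\<close>

locale levy_triplet =
  fixes \<gamma> S :: real and \<nu> :: "real measure"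
  assumes S_nonneg: "0 \<le> S" and sets_nu: "sets \<nu> = sets borel" and nu_0: "emeasure \<nu> {0} = 0"
    and square_integrable: "integrable \<nu> (\<lambda>x. x\<^sup>2)"
begin

abbreviation \<Phi> :: "real \<Rightarrow> complex" where "\<Phi> \<equiv> levy_exponent \<gamma> S \<nu>"

lemma measurable_nu[simp, measurable_cong]: "sets \<nu> = sets borel" by (rule sets_nu)

lemma space_nu[simp]: "space \<nu> = UNIV" using sets_eq_imp_space_eq[OF sets_nu] by simp

definition levy_integrand :: "real \<Rightarrow> real \<Rightarrow> complex" where
  "levy_integrand u x = iexp (u * x) - 1 - \<i> * of_real (u * x * indicator {0..1} \<bar>x\<bar>)"

lemma levy_integrand_measurable[measurable]: "levy_integrand u \<in> borel_measurable borel"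
  unfolding levy_integrand_def by measurable

lemma norm_levy_integrand_le: "norm (levy_integrand u x) \<le> (\<bar>u\<bar> + u\<^sup>2) * x\<^sup>2"
proof (cases "\<bar>x\<bar> \<le> 1")
  case True
  have "norm (levy_integrand u x) \<le> \<bar>u * x\<bar>\<^sup>2 / 2"
    using iexp_approx1[of "u * x" 1] True by (simp add: levy_integrand_def power2_eq_square algebra_simps)
  also have "\<dots> \<le> (\<bar>u\<bar> + u\<^sup>2) * x\<^sup>2"
    by (simp add: power_mult_distrib distrib_right)
  finally show ?thesis .
next
  case False
  have "norm (levy_integrand u x) = norm (iexp (u * x) - 1)"
    using False by (simp add: levy_integrand_def)
  also have "\<dots> \<le> \<bar>u\<bar> * \<bar>x\<bar>" using norm_iexp_minus_1_le[of "u * x"] by (simp add: abs_mult)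
  also have "\<dots> \<le> \<bar>u\<bar> * x\<^sup>2"
    using False mult_left_mono[of 1 "\<bar>x\<bar>" "\<bar>x\<bar>"] by (intro mult_left_mono) (auto simp: power2_eq_square)
  also have "\<dots> \<le> (\<bar>u\<bar> + u\<^sup>2) * x\<^sup>2" by (intro mult_right_mono) auto
  finally show ?thesis .
qed

lemma integrable_levy_integrand: "integrable \<nu> (levy_integrand u)"
  by (rule Bochner_Integration.integrable_bound[of _ "\<lambda>x. (\<bar>u\<bar> + u\<^sup>2) * x\<^sup>2"])
     (use norm_levy_integrand_le square_integrable in \<open>auto intro!: integrable_mult_right\<close>)

lemma levy_exponent_eq: "\<Phi> u = \<i> * of_real (\<gamma> * u) - of_real (S * u\<^sup>2 / 2) + (CLINT x|\<nu>. levy_integrand u x)"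
  by (simp add: levy_exponent_def levy_integrand_def)

lemma levy_exponent_0[simp]: "\<Phi> 0 = 0"
  by (simp add: levy_exponent_eq levy_integrand_def)

text \<open>
  A bound for the modulus of the exponent on \<open>[-K, K]\<close>.
\<close>
definition exponent_bound :: "real \<Rightarrow> real" where
  "exponent_bound K = \<bar>\<gamma>\<bar> * K + S * K\<^sup>2 / 2 + (K + K\<^sup>2) * (LINT x|\<nu>. x\<^sup>2)"

lemma norm_levy_exponent_le: "\<bar>u\<bar> \<le> K \<Longrightarrow> norm (\<Phi> u) \<le> exponent_bound K"
proof -
  assume u: "\<bar>u\<bar> \<le> K"
  then have u2: "u\<^sup>2 \<le> K\<^sup>2" by (simp add: abs_le_square_iff[symmetric])
  have "norm (CLINT x|\<nu>. levy_integrand u x) \<le> (LINT x|\<nu>. (\<bar>u\<bar> + u\<^sup>2) * x\<^sup>2)"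
    using norm_levy_integrand_le square_integrable by (intro norm_integral_le) auto
  also have "\<dots> = (\<bar>u\<bar> + u\<^sup>2) * (LINT x|\<nu>. x\<^sup>2)" by simp
  also have "\<dots> \<le> (K + K\<^sup>2) * (LINT x|\<nu>. x\<^sup>2)"
    using u u2 by (intro mult_right_mono add_mono) auto
  finally have 1: "norm (CLINT x|\<nu>. levy_integrand u x) \<le> (K + K\<^sup>2) * (LINT x|\<nu>. x\<^sup>2)" .
  have 2: "norm (\<i> * of_real (\<gamma> * u)) \<le> \<bar>\<gamma>\<bar> * K"
    using u by (simp add: norm_mult mult_left_mono)
  have 3: "norm (complex_of_real (S * u\<^sup>2 / 2)) \<le> S * K\<^sup>2 / 2"
    using S_nonneg u2 by (simp only: norm_of_real) (simp add: mult_left_mono)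
  show ?thesis unfolding levy_exponent_eq exponent_bound_def
    using norm_triangle_ineq[of "\<i> * of_real (\<gamma> * u) - complex_of_real (S * u\<^sup>2 / 2)" "CLINT x|\<nu>. levy_integrand u x"]
      norm_triangle_ineq4[of "\<i> * of_real (\<gamma> * u)" "complex_of_real (S * u\<^sup>2 / 2)"] 1 2 3 by linarith
qed

lemma isCont_levy_exponent: "isCont \<Phi> u"
  unfolding continuous_at_sequentially
proof safe
  fix U assume U: "U \<longlonglongrightarrow> u"
  then obtain B where B: "\<And>n. \<bar>U n\<bar> \<le> B" using convergent_imp_Bseq[of U]
    by (auto simp: convergent_def Bseq_def)
  have B2: "(U n)\<^sup>2 \<le> B\<^sup>2" for n using B[of n] by (simp add: abs_le_square_iff[symmetric])
  have "(\<lambda>n. CLINT x|\<nu>. levy_integrand (U n) x) \<longlonglongrightarrow> (CLINT x|\<nu>. levy_integrand u x)"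
  proof (rule integral_dominated_convergence[where w="\<lambda>x. (B + B\<^sup>2) * x\<^sup>2"])
    show "integrable \<nu> (\<lambda>x. (B + B\<^sup>2) * x\<^sup>2)" using square_integrable by simp
    show "AE x in \<nu>. norm (levy_integrand (U n) x) \<le> (B + B\<^sup>2) * x\<^sup>2" for n
    proof (rule AE_I2)
      fix x
      have "(\<bar>U n\<bar> + (U n)\<^sup>2) * x\<^sup>2 \<le> (B + B\<^sup>2) * x\<^sup>2" using B[of n] B2[of n] by (intro mult_right_mono add_mono) auto
      with norm_levy_integrand_le show "norm (levy_integrand (U n) x) \<le> (B + B\<^sup>2) * x\<^sup>2" by (rule order_trans)
    qed
    show "AE x in \<nu>. (\<lambda>n. levy_integrand (U n) x) \<longlonglongrightarrow> levy_integrand u x"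
      unfolding levy_integrand_def by (intro AE_I2 tendsto_intros U)
  qed auto
  then show "(\<Phi> \<circ> U) \<longlonglongrightarrow> \<Phi> u"
    unfolding comp_def levy_exponent_eq by (intro tendsto_intros U) auto
qed

lemma levy_exponent_measurable[measurable]: "\<Phi> \<in> borel_measurable borel"
  by (auto intro!: borel_measurable_continuous_onI continuous_at_imp_continuous_on isCont_levy_exponent)

lemma Re_levy_exponent: "Re (\<Phi> u) = - (S * u\<^sup>2 / 2) - (LINT x|\<nu>. 1 - cos (u * x))"
  and integrable_one_minus_cos: "integrable \<nu> (\<lambda>x. 1 - cos (u * x))"
proof -
  have Re: "Re (levy_integrand u x) = - (1 - cos (u * x))" for x
    by (simp add: levy_integrand_def Re_exp)
  have "integrable \<nu> (\<lambda>x. Re (levy_integrand u x))" by (intro integrable_Re integrable_levy_integrand)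
  then have "integrable \<nu> (\<lambda>x. - (- (1 - cos (u * x))))" unfolding Re by (rule Bochner_Integration.integrable_minus)
  then show i: "integrable \<nu> (\<lambda>x. 1 - cos (u * x))" by simp
  have "Re (CLINT x|\<nu>. levy_integrand u x) = (LINT x|\<nu>. - (1 - cos (u * x)))"
    unfolding Re[symmetric] by (rule integral_Re[OF integrable_levy_integrand, symmetric])
  also have "\<dots> = - (LINT x|\<nu>. 1 - cos (u * x))" by (rule Bochner_Integration.integral_minus)
  finally show "Re (\<Phi> u) = - (S * u\<^sup>2 / 2) - (LINT x|\<nu>. 1 - cos (u * x))"
    by (simp add: levy_exponent_eq)
qed

lemma Re_levy_exponent_nonpos: "Re (\<Phi> u) \<le> 0"
proof -
  have "0 \<le> (LINT x|\<nu>. 1 - cos (u * x))" by (intro integral_nonneg_AE) auto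
  moreover have "0 \<le> S * u\<^sup>2 / 2" using S_nonneg by simp
  ultimately show ?thesis unfolding Re_levy_exponent by linarith
qed

text \<open>
  Follows from \<open>1 - cos (2 * a) \<le> 4 * (1 - cos a)\<close>. Iterated halving of the argument then shows that limits of the
  characteristic functions have no zeros.
\<close>
lemma Re_levy_exponent_double: "- Re (\<Phi> (2 * u)) \<le> - (4 * Re (\<Phi> u))"
proof -
  have "(LINT x|\<nu>. 1 - cos (2 * u * x)) \<le> (LINT x|\<nu>. 4 * (1 - cos (u * x)))"
  proof (rule integral_mono)
    fix x
    have "cos (2 * (u * x)) = 2 * (cos (u * x))\<^sup>2 - 1" by (rule cos_double_cos)
    then have "4 * (1 - cos (u * x)) - (1 - cos (2 * u * x)) = 2 * (1 - cos (u * x))\<^sup>2"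
      by (simp add: power2_eq_square algebra_simps)
    then show "1 - cos (2 * u * x) \<le> 4 * (1 - cos (u * x))"
      using zero_le_power2[of "1 - cos (u * x)"] by linarith
  qed (intro integrable_mult_right integrable_one_minus_cos)+
  also have "\<dots> = 4 * (LINT x|\<nu>. 1 - cos (u * x))" by (rule integral_mult_right_zero)
  finally show ?thesis unfolding Re_levy_exponent by (simp add: power_mult_distrib)
qed

lemma integrable_tail: "integrable \<nu> (\<lambda>x. x * indicator {x. 1 < \<bar>x\<bar>} x)"
proof (rule Bochner_Integration.integrable_bound[OF square_integrable])
  show "AE x in \<nu>. norm (x * indicator {x. 1 < \<bar>x\<bar>} x) \<le> norm (x\<^sup>2)"
  proof (rule AE_I2)
    fix x :: real
    show "norm (x * indicator {x. 1 < \<bar>x\<bar>} x) \<le> norm (x\<^sup>2)"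
      using mult_left_mono[of 1 "\<bar>x\<bar>" "\<bar>x\<bar>"] by (auto simp: indicator_def power2_eq_square abs_mult)
  qed
qed measurable

text \<open>
  Centring turns the truncated compensator \<open>x * indicator {0..1} \<bar>x\<bar>\<close> into the full one, and
  \<open>\<bar>exp (\<i> * y) - 1 - \<i> * y\<bar> \<le> y\<^sup>2 / 2\<close>.
\<close>
lemma norm_levy_exponent_le_centred:
  assumes centred: "\<gamma> + (LINT x:{x. 1 < \<bar>x\<bar>}|\<nu>. x) = 0"
  shows "norm (\<Phi> u) \<le> Sigma_L S \<nu> * u\<^sup>2 / 2"
proof -
  define g where "g x = iexp (u * x) - 1 - \<i> * of_real (u * x)" for x
  have g: "g x = levy_integrand u x - (\<i> * of_real u) * of_real (x * indicator {x. 1 < \<bar>x\<bar>} x)" for x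
    by (simp add: g_def levy_integrand_def indicator_def)
  have it: "integrable \<nu> (\<lambda>x. (\<i> * of_real u) * complex_of_real (x * indicator {x. 1 < \<bar>x\<bar>} x))"
    by (intro integrable_mult_right integrable_of_real integrable_tail)
  have "(CLINT x|\<nu>. g x) = (CLINT x|\<nu>. levy_integrand u x) - (\<i> * of_real u) * of_real (LINT x|\<nu>. x * indicator {x. 1 < \<bar>x\<bar>} x)"
    unfolding g by (subst Bochner_Integration.integral_diff[OF integrable_levy_integrand it])
      (simp only: integral_mult_right_zero integral_complex_of_real)
  also have "(LINT x|\<nu>. x * indicator {x. 1 < \<bar>x\<bar>} x) = - \<gamma>"
    using centred by (simp add: set_lebesgue_integral_def mult.commute)
  finally have "\<Phi> u = - of_real (S * u\<^sup>2 / 2) + (CLINT x|\<nu>. g x)"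
    unfolding levy_exponent_eq by simp
  also have "norm \<dots> \<le> S * u\<^sup>2 / 2 + norm (CLINT x|\<nu>. g x)"
    using S_nonneg norm_triangle_ineq[of "- complex_of_real (S * u\<^sup>2 / 2)" "CLINT x|\<nu>. g x"]
    by (simp only: norm_minus_cancel norm_of_real) (simp add: abs_mult)
  also have "norm (CLINT x|\<nu>. g x) \<le> (LINT x|\<nu>. u\<^sup>2 / 2 * x\<^sup>2)"
  proof (rule norm_integral_le)
    show "AE x in \<nu>. norm (g x) \<le> u\<^sup>2 / 2 * x\<^sup>2"
    proof (rule AE_I2)
      fix x
      show "norm (g x) \<le> u\<^sup>2 / 2 * x\<^sup>2"
        using iexp_approx1[of "u * x" 1] by (simp add: g_def power2_eq_square algebra_simps)
    qed
  qed (use square_integrable in auto)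
  also have "(LINT x|\<nu>. u\<^sup>2 / 2 * x\<^sup>2) = u\<^sup>2 / 2 * (LINT x|\<nu>. x\<^sup>2)" by simp
  finally show ?thesis by (simp add: Sigma_L_def algebra_simps)
qed

lemma sigma_finite_nu: "sigma_finite_measure \<nu>"
proof
  have fin: "emeasure \<nu> {x. 1 / real (Suc n) \<le> \<bar>x\<bar>} < \<infinity>" for n
  proof -
    have "emeasure \<nu> {x. 1 / real (Suc n) \<le> \<bar>x\<bar>} = (\<integral>\<^sup>+x. indicator {x. 1 / real (Suc n) \<le> \<bar>x\<bar>} x \<partial>\<nu>)"
      by (rule nn_integral_indicator[symmetric]) simp
    also have "\<dots> \<le> (\<integral>\<^sup>+x. ennreal ((real (Suc n))\<^sup>2 * x\<^sup>2) \<partial>\<nu>)"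
    proof (rule nn_integral_mono)
      fix x :: real
      have "1 \<le> (real (Suc n))\<^sup>2 * x\<^sup>2" if "1 / real (Suc n) \<le> \<bar>x\<bar>"
      proof -
        have "1 \<le> real (Suc n) * \<bar>x\<bar>" using that by (simp add: pos_divide_le_eq mult.commute)
        then have "1\<^sup>2 \<le> (real (Suc n) * \<bar>x\<bar>)\<^sup>2" by (intro power_mono) auto
        then show ?thesis by (simp add: power_mult_distrib)
      qed
      then show "indicator {x. 1 / real (Suc n) \<le> \<bar>x\<bar>} x \<le> ennreal ((real (Suc n))\<^sup>2 * x\<^sup>2)"
        by (auto simp: indicator_def simp del: of_nat_Suc)
    qed
    also have "\<dots> < \<infinity>"
    proof -
      have "integrable \<nu> (\<lambda>x. (real (Suc n))\<^sup>2 * x\<^sup>2)" using square_integrable by (rule integrable_mult_right)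
      then show ?thesis by (subst nn_integral_eq_integral) auto
    qed
    finally show ?thesis .
  qed
  let ?A = "insert {0} (range (\<lambda>n. {x. 1 / real (Suc n) \<le> \<bar>x\<bar>}))"
  have "\<Union>?A = UNIV"
  proof -
    have "\<exists>n. 1 / real (Suc n) \<le> \<bar>x\<bar>" if "x \<noteq> 0" for x :: real
      using that nat_approx_posE[of "\<bar>x\<bar>"] by (metis less_imp_le zero_less_abs_iff)
    then show ?thesis by fastforce
  qed
  then show "\<exists>A. countable A \<and> A \<subseteq> sets \<nu> \<and> \<Union>A = space \<nu> \<and> (\<forall>a\<in>A. emeasure \<nu> a \<noteq> \<infinity>)"
    using fin nu_0 by (intro exI[of _ ?A]) (auto simp: less_top)
qed

end

section \<open>Levy exponents of finite variation\<close>

locale finite_variation_triplet = levy_triplet +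
  assumes abs_integrable: "integrable \<nu> (\<lambda>x. \<bar>x\<bar>)" and S_0: "S = 0"
begin

text \<open>
  The exponent without its drift. The drift has to be split off because it contributes to
  first moments at first order in time but to \<open>1 - Re chf\<close> only at second order.
\<close>
definition jump_exponent :: "real \<Rightarrow> complex" where
  "jump_exponent u = (CLINT x|\<nu>. iexp (u * x) - 1)"

abbreviation mean_jump :: real where "mean_jump \<equiv> (LINT x|\<nu>. \<bar>x\<bar>)"

lemma mean_jump_nonneg: "0 \<le> mean_jump" by (intro integral_nonneg_AE) auto

lemma integrable_iexp_minus_1: "integrable \<nu> (\<lambda>x. iexp (u * x) - 1)"
proof (rule Bochner_Integration.integrable_bound[of _ "\<lambda>x. \<bar>u\<bar> * \<bar>x\<bar>"])
  show "AE x in \<nu>. norm (iexp (u * x) - 1) \<le> norm (\<bar>u\<bar> * \<bar>x\<bar>)"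
    using norm_iexp_minus_1_le[of "u * x" for x] by (auto simp: abs_mult simp del: of_real_mult)
qed (use abs_integrable in auto)

lemma levy_exponent_eq_jump_exponent: "\<Phi> u = \<i> * of_real (gamma_zero \<gamma> \<nu> * u) + jump_exponent u"
proof -
  have ie: "integrable \<nu> (\<lambda>x. x * indicator {x. \<bar>x\<bar> \<le> 1} x)"
    by (rule Bochner_Integration.integrable_bound[OF abs_integrable]) (auto simp: indicator_def)
  have it: "integrable \<nu> (\<lambda>x. (\<i> * of_real u) * complex_of_real (x * indicator {x. \<bar>x\<bar> \<le> 1} x))"
    by (intro integrable_mult_right integrable_of_real ie)
  have "levy_integrand u x = (iexp (u * x) - 1) - (\<i> * of_real u) * of_real (x * indicator {x. \<bar>x\<bar> \<le> 1} x)" for x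
    by (simp add: levy_integrand_def indicator_def)
  then have "(CLINT x|\<nu>. levy_integrand u x) =
      (CLINT x|\<nu>. (iexp (u * x) - 1) - (\<i> * of_real u) * of_real (x * indicator {x. \<bar>x\<bar> \<le> 1} x))" by simp
  also have "\<dots> = jump_exponent u - (\<i> * of_real u) * of_real (LINT x|\<nu>. x * indicator {x. \<bar>x\<bar> \<le> 1} x)"
    unfolding jump_exponent_def by (subst Bochner_Integration.integral_diff[OF integrable_iexp_minus_1 it])
      (simp only: integral_mult_right_zero integral_complex_of_real)
  finally show ?thesis
    unfolding levy_exponent_eq gamma_zero_def set_lebesgue_integral_def
    by (simp add: S_0 mult.commute algebra_simps)
qed

lemma norm_jump_exponent_le: "norm (jump_exponent u) \<le> mean_jump * \<bar>u\<bar>"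
proof -
  have "norm (jump_exponent u) \<le> (LINT x|\<nu>. \<bar>u\<bar> * \<bar>x\<bar>)" unfolding jump_exponent_def
    using norm_iexp_minus_1_le[of "u * x" for x] abs_integrable
    by (intro norm_integral_le) (auto simp: abs_mult simp del: of_real_mult)
  then show ?thesis by (simp add: mult.commute)
qed

lemma norm_levy_exponent_le_linear: "norm (\<Phi> u) \<le> gamma_abs \<gamma> \<nu> * \<bar>u\<bar>"
  unfolding levy_exponent_eq_jump_exponent gamma_abs_def
  using norm_triangle_ineq[of "\<i> * of_real (gamma_zero \<gamma> \<nu> * u)" "jump_exponent u"] norm_jump_exponent_le[of u]
  by (simp add: norm_mult abs_mult algebra_simps)

lemma Re_jump_exponent: "Re (jump_exponent u) = - (LINT x|\<nu>. 1 - cos (u * x))"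
  and Im_jump_exponent: "Im (jump_exponent u) = (LINT x|\<nu>. sin (u * x))"
proof -
  have "Re (jump_exponent u) = (LINT x|\<nu>. Re (iexp (u * x) - 1))"
    unfolding jump_exponent_def by (rule integral_Re[OF integrable_iexp_minus_1, symmetric])
  also have "\<dots> = (LINT x|\<nu>. - (1 - cos (u * x)))" by (simp add: Re_exp)
  also have "\<dots> = - (LINT x|\<nu>. 1 - cos (u * x))" by (rule Bochner_Integration.integral_minus)
  finally show "Re (jump_exponent u) = - (LINT x|\<nu>. 1 - cos (u * x))" .
  have "Im (jump_exponent u) = (LINT x|\<nu>. Im (iexp (u * x) - 1))"
    unfolding jump_exponent_def by (rule integral_Im[OF integrable_iexp_minus_1, symmetric])
  then show "Im (jump_exponent u) = (LINT x|\<nu>. sin (u * x))" by (simp add: Im_exp)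
qed

lemma jump_exponent_measurable[measurable]: "jump_exponent \<in> borel_measurable borel"
proof -
  have "jump_exponent u = \<Phi> u - \<i> * of_real (gamma_zero \<gamma> \<nu> * u)" for u
    by (simp add: levy_exponent_eq_jump_exponent)
  then show ?thesis by (subst measurable_cong[where g="\<lambda>u. \<Phi> u - \<i> * of_real (gamma_zero \<gamma> \<nu> * u)"]) auto
qed

text \<open>
  This is the formula for the first moment with \<open>\<nu>\<close> in place of a law, and gives the order of \<open>E \<bar>X\<bar>\<close> for
  the jumps in small time.
\<close>
lemma nn_integral_Re_jump_exponent:
  "(\<integral>\<^sup>+u. ennreal (- Re (jump_exponent u) / u\<^sup>2) \<partial>lborel) = cos_const * ennreal mean_jump"
proof -
  interpret sigma_finite_measure \<nu> by (rule sigma_finite_nu)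
  interpret p: pair_sigma_finite \<nu> lborel by (intro pair_sigma_finite.intro sigma_finite_measure_axioms sigma_finite_lborel)
  have "(\<integral>\<^sup>+u. ennreal (- Re (jump_exponent u) / u\<^sup>2) \<partial>lborel) = (\<integral>\<^sup>+u. (\<integral>\<^sup>+x. ennreal ((1 - cos (u * x)) / u\<^sup>2) \<partial>\<nu>) \<partial>lborel)"
  proof (rule nn_integral_cong)
    fix u :: real
    have "(\<integral>\<^sup>+x. ennreal ((1 - cos (u * x)) / u\<^sup>2) \<partial>\<nu>) = ennreal (LINT x|\<nu>. (1 - cos (u * x)) / u\<^sup>2)"
      using integrable_one_minus_cos by (intro nn_integral_eq_integral) auto
    then show "ennreal (- Re (jump_exponent u) / u\<^sup>2) = (\<integral>\<^sup>+x. ennreal ((1 - cos (u * x)) / u\<^sup>2) \<partial>\<nu>)"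
      by (simp add: Re_jump_exponent)
  qed
  also have "\<dots> = (\<integral>\<^sup>+x. (\<integral>\<^sup>+u. ennreal ((1 - cos (u * x)) / u\<^sup>2) \<partial>lborel) \<partial>\<nu>)"
    by (rule p.Fubini') measurable
  also have "\<dots> = cos_const * (\<integral>\<^sup>+x. ennreal \<bar>x\<bar> \<partial>\<nu>)"
    unfolding cos_const_scale by (rule nn_integral_cmult) measurable
  also have "(\<integral>\<^sup>+x. ennreal \<bar>x\<bar> \<partial>\<nu>) = ennreal mean_jump"
    using abs_integrable by (intro nn_integral_eq_integral) auto
  finally show ?thesis .
qed

text \<open>
  The phase of \<open>exp (t * jump_exponent u)\<close> contributes at most \<open>t * phase_error t\<close> to the first moment, by the substitution
  \<open>u = v / t\<close>.
\<close>
definition phase_error :: "real \<Rightarrow> ennreal" where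
  "phase_error t = (\<integral>\<^sup>+v. ennreal (min 2 ((t * Im (jump_exponent (v / t)))\<^sup>2 / 2) / v\<^sup>2) \<partial>lborel)"

text \<open>
  Since \<open>\<bar>Im (jump_exponent u)\<bar> \<le> mean_jump * \<bar>u\<bar>\<close>, the integrand is dominated. It tends to zero because
  \<open>Im (jump_exponent u)\<close> is even \<open>o(u)\<close>: in \<open>t * Im (jump_exponent (v / t)) = \<integral> t * sin (v * x / t)\<close> the integrand is at most \<open>t\<close>.
\<close>
lemma phase_error_seq_tendsto_0:
  assumes t: "\<And>n. 0 < t n" "t \<longlonglongrightarrow> 0"
  shows "(\<lambda>n. phase_error (t n)) \<longlonglongrightarrow> 0"
proof -
  let ?f = "\<lambda>n v. ennreal (min 2 ((t n * Im (jump_exponent (v / t n)))\<^sup>2 / 2) / v\<^sup>2)"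
  have "(\<lambda>n. \<integral>\<^sup>+v. ?f n v \<partial>lborel) \<longlonglongrightarrow> (\<integral>\<^sup>+v. 0 \<partial>(lborel :: real measure))"
  proof (rule nn_integral_dominated_convergence[where w="\<lambda>v. ennreal (min 2 ((mean_jump\<^sup>2 / 2) * v\<^sup>2) / v\<^sup>2)"])
    show "(\<integral>\<^sup>+v. ennreal (min 2 ((mean_jump\<^sup>2 / 2) * v\<^sup>2) / v\<^sup>2) \<partial>lborel) < \<infinity>"
      by (rule nn_integral_min_2_square_finite) simp
    show "AE v in lborel. ?f n v \<le> ennreal (min 2 ((mean_jump\<^sup>2 / 2) * v\<^sup>2) / v\<^sup>2)" for n
    proof (intro AE_I2 ennreal_leI divide_right_mono)
      fix v :: real
      have "\<bar>Im (jump_exponent (v / t n))\<bar> \<le> mean_jump * \<bar>v / t n\<bar>"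
        using abs_Im_le_cmod[of "jump_exponent (v / t n)"] norm_jump_exponent_le[of "v / t n"] by linarith
      then have "\<bar>t n * Im (jump_exponent (v / t n))\<bar> \<le> \<bar>mean_jump * v\<bar>"
        using t(1)[of n] mean_jump_nonneg by (simp add: abs_mult field_simps)
      then have "(t n * Im (jump_exponent (v / t n)))\<^sup>2 \<le> (mean_jump * v)\<^sup>2" by (simp only: abs_le_square_iff)
      then show "min 2 ((t n * Im (jump_exponent (v / t n)))\<^sup>2 / 2) \<le> min 2 ((mean_jump\<^sup>2 / 2) * v\<^sup>2)"
        by (simp add: power_mult_distrib min_le_iff_disj)
    qed simp
    show "AE v in lborel. (\<lambda>n. ?f n v) \<longlonglongrightarrow> 0"
    proof (rule AE_I2)
      fix v :: real
      have "(\<lambda>n. LINT x|\<nu>. t n * sin (v / t n * x)) \<longlonglongrightarrow> (LINT x|\<nu>. 0)"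
      proof (rule integral_dominated_convergence[where w="\<lambda>x. \<bar>v\<bar> * \<bar>x\<bar>"])
        show "integrable \<nu> (\<lambda>x. \<bar>v\<bar> * \<bar>x\<bar>)" using abs_integrable by simp
        show "AE x in \<nu>. (\<lambda>n. t n * sin (v / t n * x)) \<longlonglongrightarrow> 0"
        proof (rule AE_I2, rule Lim_null_comparison[OF _ t(2)], rule always_eventually, rule allI)
          fix x n
          show "norm (t n * sin (v / t n * x)) \<le> t n"
            using t(1)[of n] abs_sin_le_one[of "v / t n * x"] by (simp add: abs_mult mult_left_le)
        qed
        show "AE x in \<nu>. norm (t n * sin (v / t n * x)) \<le> \<bar>v\<bar> * \<bar>x\<bar>" for n
        proof (rule AE_I2)
          fix x
          have "norm (t n * sin (v / t n * x)) \<le> t n * \<bar>v / t n * x\<bar>"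
            using mult_left_mono[OF abs_sin_x_le_abs_x[of "v / t n * x"], of "t n"] t(1)[of n] by (simp only: real_norm_def abs_mult) simp
          also have "\<dots> = \<bar>v\<bar> * \<bar>x\<bar>" using t(1)[of n] by (simp add: abs_mult)
          finally show "norm (t n * sin (v / t n * x)) \<le> \<bar>v\<bar> * \<bar>x\<bar>" .
        qed
      qed auto
      then have 0: "(\<lambda>n. t n * Im (jump_exponent (v / t n))) \<longlonglongrightarrow> 0"
        by (simp add: Im_jump_exponent)
      have "(\<lambda>n. min 2 ((t n * Im (jump_exponent (v / t n)))\<^sup>2 / 2) / v\<^sup>2) \<longlonglongrightarrow> min 2 (0\<^sup>2 / 2) / v\<^sup>2"
      proof (cases "v = 0")
        case False
        then show ?thesis by (intro tendsto_divide tendsto_min tendsto_const tendsto_power 0) auto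
      qed simp
      then have "(\<lambda>n. ?f n v) \<longlonglongrightarrow> ennreal (min 2 (0\<^sup>2 / 2) / v\<^sup>2)" by (rule tendsto_ennrealI)
      then show "(\<lambda>n. ?f n v) \<longlonglongrightarrow> 0" by simp
    qed
  qed measurable
  then show ?thesis by (simp add: phase_error_def)
qed

lemma phase_error_small:
  assumes "0 < \<eta>"
  shows "\<exists>\<delta>>0. \<forall>t. 0 < t \<and> t \<le> \<delta> \<longrightarrow> phase_error t \<le> \<eta>"
proof (rule ccontr)
  assume "\<not> ?thesis"
  then have "\<forall>n. \<exists>t. 0 < t \<and> t \<le> 1 / real (Suc n) \<and> \<not> phase_error t \<le> \<eta>" by (metis of_nat_0_less_iff zero_less_Suc zero_less_divide_1_iff)
  then obtain t where t: "\<And>n. 0 < t n" "\<And>n. t n \<le> 1 / real (Suc n)" "\<And>n. \<not> phase_error (t n) \<le> \<eta>" by metis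
  have "t \<longlonglongrightarrow> 0"
    by (rule real_tendsto_sandwich[OF _ _ tendsto_const LIMSEQ_inverse_real_of_nat])
       (use t(1,2) in \<open>auto intro!: always_eventually less_imp_le simp: inverse_eq_divide\<close>)
  from order_tendstoD(2)[OF phase_error_seq_tendsto_0[OF t(1) this] assms]
  show False using t(3) by (auto simp: eventually_sequentially intro: less_imp_le)
qed

lemma (in -) one_minus_Re_exp_le:
  assumes "Re z \<le> 0" shows "1 - Re (exp z) \<le> - Re z + min 2 ((Im z)\<^sup>2 / 2)"
proof -
  have "1 - Re (exp z) = (1 - exp (Re z)) + exp (Re z) * (1 - cos (Im z))"
    by (simp add: Re_exp algebra_simps)
  also have "1 - exp (Re z) \<le> - Re z" using exp_ge_add_one_self[of "Re z"] by linarith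
  also have "exp (Re z) * (1 - cos (Im z)) \<le> 1 * (1 - cos (Im z))"
    using assms by (intro mult_right_mono) auto
  also have "1 - cos (Im z) \<le> min 2 ((Im z)\<^sup>2 / 2)"
    using one_minus_cos_le[of "Im z"] cos_ge_minus_one[of "Im z"] by simp
  finally show ?thesis by simp
qed

text \<open>
  To first order in \<open>t\<close> the mean modulus of the jumps up to time \<open>t\<close> is \<open>t * mean_jump\<close>. With \<open>z = t * jump_exponent u\<close>, the
  modulus of \<open>exp z\<close> contributes at most \<open>- Re z\<close> to \<open>1 - Re (exp z)\<close>, and its phase at most \<open>min 2 ((Im z)\<^sup>2 / 2)\<close>.
\<close>
lemma first_moment_small_time:
  assumes "prob_space M" and [measurable]: "X \<in> borel_measurable M"
    and t: "0 < t" and chf: "\<And>u. chf M X u = exp (of_real t * jump_exponent u)"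
  shows "cos_const * (\<integral>\<^sup>+\<omega>. ennreal \<bar>X \<omega>\<bar> \<partial>M) \<le> ennreal t * (cos_const * ennreal mean_jump + phase_error t)"
proof -
  interpret prob_space M by fact
  have Re0: "Re (jump_exponent u) \<le> 0" for u
    unfolding Re_jump_exponent by (simp add: integral_nonneg_AE)
  have "cos_const * (\<integral>\<^sup>+\<omega>. ennreal \<bar>X \<omega>\<bar> \<partial>M) = (\<integral>\<^sup>+u. ennreal ((1 - Re (chf M X u)) / u\<^sup>2) \<partial>lborel)"
    by (rule first_moment_chf) measurable
  also have "\<dots> \<le> (\<integral>\<^sup>+u. ennreal t * ennreal (- Re (jump_exponent u) / u\<^sup>2) +
      ennreal (min 2 ((t * Im (jump_exponent u))\<^sup>2 / 2) / u\<^sup>2) \<partial>lborel)"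
  proof (rule nn_integral_mono)
    fix u :: real
    have "1 - Re (chf M X u) \<le> - (t * Re (jump_exponent u)) + min 2 ((t * Im (jump_exponent u))\<^sup>2 / 2)"
      unfolding chf using one_minus_Re_exp_le[of "of_real t * jump_exponent u"] Re0[of u] t
      by (simp add: mult_le_0_iff)
    from divide_right_mono[OF this, of "u\<^sup>2"]
    have "(1 - Re (chf M X u)) / u\<^sup>2 \<le> t * (- Re (jump_exponent u) / u\<^sup>2) + min 2 ((t * Im (jump_exponent u))\<^sup>2 / 2) / u\<^sup>2"
      by (simp add: add_divide_distrib diff_divide_distrib)
    moreover have "0 \<le> - Re (jump_exponent u) / u\<^sup>2" using Re0[of u] by (intro divide_nonneg_nonneg) auto
    moreover have "0 \<le> min 2 ((t * Im (jump_exponent u))\<^sup>2 / 2) / u\<^sup>2" by simp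
    ultimately show "ennreal ((1 - Re (chf M X u)) / u\<^sup>2) \<le> ennreal t * ennreal (- Re (jump_exponent u) / u\<^sup>2) +
      ennreal (min 2 ((t * Im (jump_exponent u))\<^sup>2 / 2) / u\<^sup>2)"
      using t by (metis ennreal_leI ennreal_mult ennreal_plus less_imp_le mult_nonneg_nonneg)
  qed
  also have "\<dots> = ennreal t * (cos_const * ennreal mean_jump) + (\<integral>\<^sup>+u. ennreal (min 2 ((t * Im (jump_exponent u))\<^sup>2 / 2) / u\<^sup>2) \<partial>lborel)"
    by (subst nn_integral_add, measurable, subst nn_integral_cmult, measurable)
       (simp only: nn_integral_Re_jump_exponent)
  also have "(\<integral>\<^sup>+u. ennreal (min 2 ((t * Im (jump_exponent u))\<^sup>2 / 2) / u\<^sup>2) \<partial>lborel) = ennreal t * phase_error t"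
  proof -
    have "(\<integral>\<^sup>+u. ennreal (min 2 ((t * Im (jump_exponent u))\<^sup>2 / 2) / u\<^sup>2) \<partial>lborel) =
        ennreal \<bar>1 / t\<bar> * (\<integral>\<^sup>+v. ennreal (min 2 ((t * Im (jump_exponent (0 + 1 / t * v)))\<^sup>2 / 2) / (0 + 1 / t * v)\<^sup>2) \<partial>lborel)"
      using t by (intro nn_integral_real_affine) auto
    also have "(\<integral>\<^sup>+v. ennreal (min 2 ((t * Im (jump_exponent (0 + 1 / t * v)))\<^sup>2 / 2) / (0 + 1 / t * v)\<^sup>2) \<partial>lborel) =
        (\<integral>\<^sup>+v. ennreal (t\<^sup>2) * ennreal (min 2 ((t * Im (jump_exponent (v / t)))\<^sup>2 / 2) / v\<^sup>2) \<partial>lborel)"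
      using t by (intro nn_integral_cong) (simp add: power_divide mult.commute flip: ennreal_mult)
    also have "\<dots> = ennreal (t\<^sup>2) * phase_error t"
      unfolding phase_error_def by (rule nn_integral_cmult) measurable
    also have "ennreal \<bar>1 / t\<bar> * (ennreal (t\<^sup>2) * phase_error t) = ennreal t * phase_error t"
      using t by (simp add: mult.assoc[symmetric] power2_eq_square flip: ennreal_mult)
    finally show ?thesis .
  qed
  finally show ?thesis by (simp add: distrib_left)
qed

end

section \<open>Levy bases\<close>

lemma (in prob_space) indep_vars_reindex:
  assumes inj: "inj_on e I" and ind: "indep_vars (\<lambda>_. N) X (e ` I)"
  shows "indep_vars (\<lambda>_. N) (\<lambda>i. X (e i)) I"
  unfolding indep_vars_def2
proof
  show "\<forall>i\<in>I. random_variable N (X (e i))" using ind by (auto simp: indep_vars_def2)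
  have sets: "indep_sets (\<lambda>j. {X j -` A \<inter> space M |A. A \<in> sets N}) (e ` I)"
    using ind by (simp add: indep_vars_def2)
  show "indep_sets (\<lambda>i. {X (e i) -` A \<inter> space M |A. A \<in> sets N}) I"
  proof (rule indep_setsI)
    fix i assume "i \<in> I" then show "{X (e i) -` A \<inter> space M |A. A \<in> sets N} \<subseteq> events"
      using sets by (auto simp: indep_sets_def)
  next
    fix A J assume J: "J \<noteq> {}" "J \<subseteq> I" "finite J"
      and A: "\<forall>j\<in>J. A j \<in> {X (e j) -` A \<inter> space M |A. A \<in> sets N}"
    have injJ: "inj_on e J" using inj J(2) by (rule inj_on_subset)
    define A' where "A' = (\<lambda>k. A (the_inv_into J e k))"
    have A': "A' (e j) = A j" if "j \<in> J" for j using the_inv_into_f_f[OF injJ that] by (simp add: A'_def)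
    have "prob (\<Inter>k\<in>e ` J. A' k) = (\<Prod>k\<in>e ` J. prob (A' k))"
      by (rule indep_setsD[OF sets]) (use J A A' in auto)
    moreover have "(\<Inter>k\<in>e ` J. A' k) = (\<Inter>j\<in>J. A j)" using A' by auto
    moreover have "(\<Prod>k\<in>e ` J. prob (A' k)) = (\<Prod>j\<in>J. prob (A j))"
      using A' by (subst prod.reindex[OF injJ]) auto
    ultimately show "prob (\<Inter>j\<in>J. A j) = (\<Prod>j\<in>J. prob (A j))" by simp
  qed
qed

text \<open>
  The derivative of \<open>exp\<close> has modulus at most one on the left half-plane.
\<close>
lemma norm_exp_minus_1_le:
  assumes "Re z \<le> 0" shows "norm (exp z - 1) \<le> norm (z::complex)"
proof -
  have "norm (exp z - exp 0) \<le> 1 * norm (z - 0)"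
  proof (rule field_differentiable_bound[where S="{w. Re w \<le> 0}"])
    show "convex {w. Re w \<le> 0}" using convex_halfspace_Re_le by simp
    show "(exp has_field_derivative exp w) (at w within {w. Re w \<le> 0})" for w
      by (rule has_field_derivative_at_within[OF DERIV_exp])
  qed (use assms in auto)
  then show ?thesis by simp
qed

locale levy_basis_space = levy_triplet \<gamma> S \<nu> for \<gamma> S \<nu> +
  fixes M :: "'w measure" and \<Lambda> :: "(real \<times> real \<times> (real ^ 'm::finite)) set \<Rightarrow> 'w \<Rightarrow> real" and \<pi> :: "real measure"
  assumes basis: "levy_basis M \<Lambda> \<gamma> S \<nu> \<pi>"

sublocale levy_basis_space \<subseteq> prob_space M using basis by (simp add: levy_basis_def)

sublocale levy_basis_space \<subseteq> Pi: prob_space \<pi> using basis by (simp add: levy_basis_def)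

context levy_basis_space
begin

abbreviation bb :: "(real \<times> real \<times> (real ^ 'm)) set set" where "bb \<equiv> bounded_borel_sets"

abbreviation \<mu> :: "(real \<times> real \<times> (real ^ 'm)) measure" where "\<mu> \<equiv> \<pi> \<Otimes>\<^sub>M lborel"

lemma sets_pi[simp, measurable_cong]: "sets \<pi> = sets borel" using basis by (simp add: levy_basis_def)

lemma sets_mu: "sets \<mu> = sets borel"
proof -
  have "sets \<mu> = sets ((borel :: real measure) \<Otimes>\<^sub>M (borel :: (real \<times> (real ^ 'm)) measure))" by (intro sets_pair_measure_cong) auto
  also have "\<dots> = sets (borel :: (real \<times> real \<times> (real ^ 'm)) measure)" by (rule arg_cong[OF borel_prod])
  finally show ?thesis .
qed

lemma measurable_mu[measurable_cong]: "sets \<mu> = sets borel" by (rule sets_mu)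

lemma space_mu[simp]: "space \<mu> = UNIV" using sets_eq_imp_space_eq[OF sets_mu] by simp

lemma emeasure_mu_Times: "X \<in> sets borel \<Longrightarrow> D \<in> sets borel \<Longrightarrow> emeasure \<mu> (X \<times> D) = emeasure \<pi> X * emeasure lborel D"
  by (rule lborel.emeasure_pair_measure_Times) auto

lemma emeasure_mu_bounded: "bounded B \<Longrightarrow> B \<in> sets borel \<Longrightarrow> emeasure \<mu> B < \<infinity>"
proof -
  assume "bounded B" "B \<in> sets borel"
  have "bounded (snd ` B)" using \<open>bounded B\<close> by (rule bounded_snd)
  then obtain R where "\<And>x. x \<in> snd ` B \<Longrightarrow> norm x \<le> R" unfolding bounded_iff by blast
  then have R: "snd ` B \<subseteq> cball 0 R" by (simp add: subset_iff)
  have "emeasure \<mu> B \<le> emeasure \<mu> (UNIV \<times> cball 0 R)"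
    proof (rule emeasure_mono)
    show "B \<subseteq> UNIV \<times> cball 0 R" using R by (auto simp del: mem_cball simp: image_subset_iff)
  qed (auto intro!: pair_measureI)
  also have "\<dots> = emeasure \<pi> UNIV * emeasure lborel (cball 0 R :: (real \<times> (real ^ 'm)) set)"
    by (rule emeasure_mu_Times) auto
  also have "\<dots> < \<infinity>"
  proof -
    have "emeasure lborel (cball 0 R :: (real \<times> (real ^ 'm)) set) < \<infinity>"
      by (intro emeasure_bounded_finite) auto
    then show ?thesis by (simp add: Pi.emeasure_eq_measure ennreal_mult_less_top)
  qed
  finally show ?thesis .
qed

lemma levy_space_borel[measurable]: "(levy_space :: (real \<times> real \<times> (real ^ 'm)) set) \<in> sets borel"
  unfolding levy_space_def by (intro borel_open open_Times) auto

lemma AE_levy_space: "AE z in \<mu>. z \<in> levy_space"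
proof (rule AE_I[where N="{..0} \<times> UNIV"])
  have "emeasure \<pi> {..0} = 0" using basis by (simp add: levy_basis_def)
  then show "emeasure \<mu> ({..0} \<times> UNIV) = 0" by (subst emeasure_mu_Times) auto
  show "{..0} \<times> UNIV \<in> sets \<mu>" by (intro pair_measureI) auto
qed (auto simp: levy_space_def)

lemma bb_borel: "B \<in> bb \<Longrightarrow> B \<in> sets borel" by (simp add: bounded_borel_sets_def)

lemma bb_subset: "B \<in> bb \<Longrightarrow> A \<in> sets borel \<Longrightarrow> A \<subseteq> B \<Longrightarrow> A \<in> bb"
  unfolding bounded_borel_sets_def using bounded_subset by blast

lemma bb_empty[simp]: "{} \<in> bb" by (simp add: bounded_borel_sets_def)

lemma bb_Un: "A \<in> bb \<Longrightarrow> B \<in> bb \<Longrightarrow> A \<union> B \<in> bb" by (auto simp: bounded_borel_sets_def)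

lemma bb_UN: "finite I \<Longrightarrow> (\<And>i. i \<in> I \<Longrightarrow> B i \<in> bb) \<Longrightarrow> (\<Union>i\<in>I. B i) \<in> bb"
  by (induction I rule: finite_induct) (auto intro: bb_Un)

lemma emeasure_bb_finite: "B \<in> bb \<Longrightarrow> emeasure \<mu> B < \<infinity>"
  by (rule emeasure_mu_bounded) (auto simp: bounded_borel_sets_def)

lemma Lambda_measurable: "B \<in> bb \<Longrightarrow> \<Lambda> B \<in> borel_measurable M"
  using basis by (simp add: levy_basis_def)

lemma Lambda_sums:
  fixes B :: "nat \<Rightarrow> (real \<times> real \<times> (real ^ 'm)) set"
  assumes "range B \<subseteq> bb" "disjoint_family B" "(\<Union>n. B n) \<in> bb"
  shows "AE \<omega> in M. (\<lambda>n. \<Lambda> (B n) \<omega>) sums \<Lambda> (\<Union>n. B n) \<omega>"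
proof -
  have "\<forall>B :: nat \<Rightarrow> _. range B \<subseteq> bb \<longrightarrow> disjoint_family B \<longrightarrow>
        (\<Union>n. B n) \<in> bb \<longrightarrow> (AE \<omega> in M. (\<lambda>n. \<Lambda> (B n) \<omega>) sums \<Lambda> (\<Union>n. B n) \<omega>)"
    using basis unfolding levy_basis_def by blast
  with assms show ?thesis by blast
qed

lemma Lambda_indep_nat:
  fixes B :: "nat \<Rightarrow> (real \<times> real \<times> (real ^ 'm)) set"
  assumes "range B \<subseteq> bb" "disjoint_family B"
  shows "indep_vars (\<lambda>_. borel) (\<lambda>n. \<Lambda> (B n)) UNIV"
proof -
  have "\<forall>B :: nat \<Rightarrow> _. range B \<subseteq> bb \<longrightarrow> disjoint_family B \<longrightarrow>
        indep_vars (\<lambda>_. borel) (\<lambda>n. \<Lambda> (B n)) UNIV"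
    using basis unfolding levy_basis_def by blast
  with assms show ?thesis by blast
qed

lemma chf_Lambda: "B \<in> bb \<Longrightarrow> chf M (\<Lambda> B) u = exp (\<Phi> u * of_real (measure \<mu> B))"
  using basis by (simp add: levy_basis_def chf_def)

text \<open>
  The series with constant terms \<open>\<Lambda> {}\<close> converges.
\<close>
lemma Lambda_empty: "AE \<omega> in M. \<Lambda> {} \<omega> = 0"
proof -
  have "AE \<omega> in M. (\<lambda>n::nat. \<Lambda> {} \<omega>) sums \<Lambda> (\<Union>n::nat. {}) \<omega>"
    by (rule Lambda_sums) (auto simp: disjoint_family_on_def)
  then show ?thesis
    by eventually_elim (auto dest!: sums_summable simp: summable_const_iff)
qed

lemma Lambda_Un:
  assumes "A \<in> bb" "B \<in> bb" "A \<inter> B = {}"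
  shows "AE \<omega> in M. \<Lambda> (A \<union> B) \<omega> = \<Lambda> A \<omega> + \<Lambda> B \<omega>"
proof -
  define D where "D n = (if n = 0 then A else if n = 1 then B else {})" for n :: nat
  have D: "(\<Union>n. D n) = A \<union> B"
  proof (intro subset_antisym subsetI)
    fix z assume "z \<in> A \<union> B"
    then have "z \<in> D 0 \<or> z \<in> D 1" by (auto simp: D_def)
    then show "z \<in> (\<Union>n. D n)" by blast
  qed (auto simp: D_def split: if_splits)
  have "AE \<omega> in M. (\<lambda>n. \<Lambda> (D n) \<omega>) sums \<Lambda> (\<Union>n. D n) \<omega>"
    by (rule Lambda_sums) (use assms in \<open>auto simp: D_def disjoint_family_on_def D[unfolded D_def] intro: bb_Un\<close>)
  with Lambda_empty show ?thesis
  proof eventually_elim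
    case (elim \<omega>)
    have "(\<lambda>n. \<Lambda> (D n) \<omega>) sums (\<Sum>n\<in>{0,1}. \<Lambda> (D n) \<omega>)"
    proof (rule sums_finite)
      fix n :: nat assume "n \<notin> {0, 1}"
      then have "D n = {}" by (simp add: D_def)
      then show "\<Lambda> (D n) \<omega> = 0" using elim(1) by simp
    qed simp
    from sums_unique2[OF this elim(2)] have "\<Lambda> (D 0) \<omega> + \<Lambda> (D 1) \<omega> = \<Lambda> (A \<union> B) \<omega>"
      unfolding D by simp
    then show ?case by (simp add: D_def)
  qed
qed

lemma Lambda_UN:
  assumes "finite I" "\<And>i. i \<in> I \<Longrightarrow> B i \<in> bb" "disjoint_family_on B I"
  shows "AE \<omega> in M. \<Lambda> (\<Union>i\<in>I. B i) \<omega> = (\<Sum>i\<in>I. \<Lambda> (B i) \<omega>)"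
  using assms
proof (induction I rule: finite_induct)
  case empty
  then show ?case using Lambda_empty by simp
next
  case (insert i I)
  have "AE \<omega> in M. \<Lambda> (B i \<union> (\<Union>i\<in>I. B i)) \<omega> = \<Lambda> (B i) \<omega> + \<Lambda> (\<Union>i\<in>I. B i) \<omega>"
    using insert by (intro Lambda_Un bb_UN) (auto simp: disjoint_family_on_def)
  moreover have "AE \<omega> in M. \<Lambda> (\<Union>i\<in>I. B i) \<omega> = (\<Sum>i\<in>I. \<Lambda> (B i) \<omega>)"
    using insert by (auto simp: disjoint_family_on_def)
  ultimately show ?case by eventually_elim (use insert in auto)
qed

text \<open>
  The finite family is embedded into a sequence of disjoint sets, padded with empty ones.
\<close>
lemma Lambda_indep:
  fixes I :: "'i set"
  assumes "finite I" and B: "\<And>i. i \<in> I \<Longrightarrow> B i \<in> bb" and disj: "disjoint_family_on B I"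
  shows "indep_vars (\<lambda>_. borel) (\<lambda>i. \<Lambda> (B i)) I"
proof -
  obtain e :: "'i \<Rightarrow> nat" where e: "inj_on e I" using finite_imp_inj_to_nat_seg[OF \<open>finite I\<close>] by blast
  define D where "D n = (if n \<in> e ` I then B (the_inv_into I e n) else {})" for n
  have De: "D (e i) = B i" if "i \<in> I" for i using that the_inv_into_f_f[OF e that] by (simp add: D_def)
  have "disjoint_family D"
    unfolding disjoint_family_on_def
  proof (intro ballI impI)
    fix k n :: nat assume "k \<noteq> n"
    show "D k \<inter> D n = {}"
    proof (cases "k \<in> e ` I \<and> n \<in> e ` I")
      case True
      then obtain i j where ij: "i \<in> I" "j \<in> I" "k = e i" "n = e j" by blast
      with \<open>k \<noteq> n\<close> have "i \<noteq> j" by blast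
      then have "B i \<inter> B j = {}" using disjoint_family_onD[OF disj ij(1,2)] by simp
      then show ?thesis unfolding ij(3,4) De[OF ij(1)] De[OF ij(2)] .
    qed (auto simp: D_def)
  qed
  moreover have "range D \<subseteq> bb" using De B by (auto simp: D_def)
  ultimately have "indep_vars (\<lambda>_. borel) (\<lambda>n. \<Lambda> (D n)) UNIV" by (intro Lambda_indep_nat)
  then have "indep_vars (\<lambda>_. borel) (\<lambda>n. \<Lambda> (D n)) (e ` I)" by (rule indep_vars_subset) auto
  then have "indep_vars (\<lambda>_. borel) (\<lambda>i. \<Lambda> (D (e i))) I" by (rule indep_vars_reindex[OF e])
  moreover have "indep_vars (\<lambda>_. borel) (\<lambda>i. \<Lambda> (B i)) I \<longleftrightarrow> indep_vars (\<lambda>_. borel) (\<lambda>i. \<Lambda> (D (e i))) I"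
    by (rule indep_vars_cong) (simp_all add: De)
  ultimately show ?thesis by blast
qed

section \<open>Integrals of simple functions\<close>

abbreviation sli :: "(real \<times> real \<times> (real ^ 'm)) set \<Rightarrow> (real \<times> real \<times> (real ^ 'm) \<Rightarrow> real) \<Rightarrow> 'w \<Rightarrow> real" where
  "sli \<equiv> simple_levy_integral \<Lambda>"

lemma level_set_bb:
  assumes "levy_simple \<phi>" "A \<in> sets borel" "y \<noteq> 0"
  shows "A \<inter> \<phi> -` {y} \<in> bb"
proof (rule bb_subset)
  show "{z. \<phi> z \<noteq> 0} \<in> bb" using assms by (simp add: levy_simple_def)
  have [measurable]: "\<phi> \<in> borel_measurable borel" using assms by (simp add: levy_simple_def)
  have "\<phi> -` {y} \<in> sets borel" using measurable_sets[of \<phi> borel borel "{y}"] by simp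
  then show "A \<inter> \<phi> -` {y} \<in> sets borel" using assms by blast
qed (use assms in auto)

lemma levy_simple_finite: "levy_simple \<phi> \<Longrightarrow> finite (range \<phi> - {0})" by (simp add: levy_simple_def)

lemma levy_simple_measurable: "levy_simple \<phi> \<Longrightarrow> \<phi> \<in> borel_measurable borel" by (simp add: levy_simple_def)

lemma sli_measurable: "levy_simple \<phi> \<Longrightarrow> A \<in> sets borel \<Longrightarrow> sli A \<phi> \<in> borel_measurable M"
  unfolding simple_levy_integral_def[abs_def]
  by (intro borel_measurable_sum borel_measurable_times borel_measurable_const Lambda_measurable level_set_bb) auto

lemma sli_Un:
  assumes \<phi>: "levy_simple \<phi>" and A: "A \<in> sets borel" "B \<in> sets borel" "A \<inter> B = {}"
  shows "AE \<omega> in M. sli (A \<union> B) \<phi> \<omega> = sli A \<phi> \<omega> + sli B \<phi> \<omega>"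
proof -
  have "AE \<omega> in M. \<forall>y\<in>range \<phi> - {0}. \<Lambda> ((A \<union> B) \<inter> \<phi> -` {y}) \<omega> = \<Lambda> (A \<inter> \<phi> -` {y}) \<omega> + \<Lambda> (B \<inter> \<phi> -` {y}) \<omega>"
  proof (rule AE_finite_allI[OF levy_simple_finite[OF \<phi>]])
    fix y assume y: "y \<in> range \<phi> - {0}"
    have "AE \<omega> in M. \<Lambda> (A \<inter> \<phi> -` {y} \<union> B \<inter> \<phi> -` {y}) \<omega> = \<Lambda> (A \<inter> \<phi> -` {y}) \<omega> + \<Lambda> (B \<inter> \<phi> -` {y}) \<omega>"
      by (rule Lambda_Un) (use y assms level_set_bb in auto)
    then show "AE \<omega> in M. \<Lambda> ((A \<union> B) \<inter> \<phi> -` {y}) \<omega> = \<Lambda> (A \<inter> \<phi> -` {y}) \<omega> + \<Lambda> (B \<inter> \<phi> -` {y}) \<omega>"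
      by (simp add: Int_Un_distrib2)
  qed
  then show ?thesis
    by eventually_elim (simp add: simple_levy_integral_def distrib_left sum.distrib)
qed

lemma sli_levy_space: "levy_simple \<phi> \<Longrightarrow> sli (A \<inter> levy_space) \<phi> = sli A \<phi>"
  unfolding simple_levy_integral_def
proof (intro ext sum.cong refl)
  fix \<omega> y assume "levy_simple \<phi>" "y \<in> range \<phi> - {0}"
  then have "A \<inter> levy_space \<inter> \<phi> -` {y} = A \<inter> \<phi> -` {y}"
    by (auto simp: levy_simple_def bounded_borel_sets_def)
  then show "y * \<Lambda> (A \<inter> levy_space \<inter> \<phi> -` {y}) \<omega> = y * \<Lambda> (A \<inter> \<phi> -` {y}) \<omega>" by simp
qed

text \<open>
  The level set of the value zero is unbounded; \<open>h 0 = 0\<close> removes it from the sum.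
\<close>
lemma levy_simple_comp_eq_sum:
  assumes \<phi>: "levy_simple \<phi>" and h: "h 0 = 0"
  shows "indicator A z *\<^sub>R h (\<phi> z) = (\<Sum>y\<in>range \<phi> - {0}. indicator (A \<inter> \<phi> -` {y}) z *\<^sub>R (h y :: 'b::real_vector))"
proof -
  have "(\<Sum>y\<in>range \<phi> - {0}. indicator (A \<inter> \<phi> -` {y}) z *\<^sub>R h y) =
      (\<Sum>y\<in>range \<phi> - {0}. if y = \<phi> z then indicator A z *\<^sub>R h y else 0)"
    by (intro sum.cong) (auto simp: indicator_def)
  also have "\<dots> = indicator A z *\<^sub>R h (\<phi> z)"
    using levy_simple_finite[OF \<phi>] h by (simp only: sum.delta) (auto)
  finally show ?thesis by simp
qed

lemma levy_simple_comp_integral: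
  fixes h :: "real \<Rightarrow> 'b::{banach,second_countable_topology}"
  assumes \<phi>: "levy_simple \<phi>" and A: "A \<in> sets borel" and h: "h 0 = 0"
  shows "set_integrable \<mu> A (\<lambda>z. h (\<phi> z))"
    and "(LINT z:A|\<mu>. h (\<phi> z)) = (\<Sum>y\<in>range \<phi> - {0}. measure \<mu> (A \<inter> \<phi> -` {y}) *\<^sub>R h y)"
proof -
  have i: "integrable \<mu> (\<lambda>z. indicator (A \<inter> \<phi> -` {y}) z *\<^sub>R h y)" if "y \<in> range \<phi> - {0}" for y
  proof -
    have "A \<inter> \<phi> -` {y} \<in> bb" using that \<phi> A by (intro level_set_bb) auto
    then show ?thesis using emeasure_bb_finite[of "A \<inter> \<phi> -` {y}"] bb_borel[of "A \<inter> \<phi> -` {y}"]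
      by (intro integrable_scaleR_left integrable_real_indicator) (simp_all only: sets_mu)
  qed
  show "set_integrable \<mu> A (\<lambda>z. h (\<phi> z))"
    unfolding set_integrable_def levy_simple_comp_eq_sum[of \<phi> h, OF \<phi> h] using i by (intro Bochner_Integration.integrable_sum)
  have "(LINT z:A|\<mu>. h (\<phi> z)) = (\<Sum>y\<in>range \<phi> - {0}. LINT z|\<mu>. indicator (A \<inter> \<phi> -` {y}) z *\<^sub>R h y)"
    unfolding set_lebesgue_integral_def levy_simple_comp_eq_sum[of \<phi> h, OF \<phi> h] using i by (intro Bochner_Integration.integral_sum)
  also have "\<dots> = (\<Sum>y\<in>range \<phi> - {0}. measure \<mu> (A \<inter> \<phi> -` {y}) *\<^sub>R h y)"
  proof (rule sum.cong[OF refl])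
    fix y assume y: "y \<in> range \<phi> - {0}"
    then have "A \<inter> \<phi> -` {y} \<in> bb" using \<phi> A by (intro level_set_bb) auto
    then have fin: "emeasure \<mu> (A \<inter> \<phi> -` {y}) < \<infinity>" and "A \<inter> \<phi> -` {y} \<in> sets \<mu>"
      using bb_borel unfolding sets_mu by (blast intro: emeasure_bb_finite)+
    then have "integrable \<mu> (\<lambda>z. indicator (A \<inter> \<phi> -` {y}) z :: real)" by (intro integrable_real_indicator)
    then have "(LINT z|\<mu>. indicator (A \<inter> \<phi> -` {y}) z *\<^sub>R h y) = (LINT z|\<mu>. indicator (A \<inter> \<phi> -` {y}) z) *\<^sub>R h y"
      by (intro integral_scaleR_left)
    then show "(LINT z|\<mu>. indicator (A \<inter> \<phi> -` {y}) z *\<^sub>R h y) = measure \<mu> (A \<inter> \<phi> -` {y}) *\<^sub>R h y"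
      by simp
  qed
  finally show "(LINT z:A|\<mu>. h (\<phi> z)) = (\<Sum>y\<in>range \<phi> - {0}. measure \<mu> (A \<inter> \<phi> -` {y}) *\<^sub>R h y)" .
qed

lemma chf_sli:
  assumes \<phi>: "levy_simple \<phi>" and A: "A \<in> sets borel"
  shows "chf M (sli A \<phi>) u = exp (CLINT z:A|\<mu>. \<Phi> (u * \<phi> z))"
proof -
  let ?I = "range \<phi> - {0}"
  let ?B = "\<lambda>y. A \<inter> \<phi> -` {y}"
  have fin: "finite ?I" by (rule levy_simple_finite[OF \<phi>])
  have bb: "?B y \<in> bb" if "y \<in> ?I" for y using that \<phi> A by (intro level_set_bb) auto
  have ind: "indep_vars (\<lambda>_. borel) (\<lambda>y. \<Lambda> (?B y)) ?I"
    by (rule Lambda_indep[OF fin bb]) (auto simp: disjoint_family_on_def)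
  have ind': "indep_vars (\<lambda>_. borel) (\<lambda>y \<omega>. iexp (u * y * \<Lambda> (?B y) \<omega>)) ?I"
    using indep_vars_compose2[OF ind, of "\<lambda>y x. iexp (u * y * x)" "\<lambda>_. borel"] by simp
  have "chf M (sli A \<phi>) u = (CLINT \<omega>|M. (\<Prod>y\<in>?I. iexp (u * y * \<Lambda> (?B y) \<omega>)))"
    unfolding chf_def simple_levy_integral_def
    by (simp only: sum_distrib_left of_real_sum exp_sum[OF fin] mult.assoc)
  also have "\<dots> = (\<Prod>y\<in>?I. CLINT \<omega>|M. iexp (u * y * \<Lambda> (?B y) \<omega>))"
    by (rule indep_vars_lebesgue_integral[OF fin ind']) (intro integrable_iexp_rv Lambda_measurable bb)
  also have "\<dots> = (\<Prod>y\<in>?I. exp (\<Phi> (u * y) * of_real (measure \<mu> (?B y))))"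
    proof (rule prod.cong[OF refl])
    fix y assume y: "y \<in> ?I"
    from chf_Lambda[OF bb[OF this], of "u * y"]
    show "(CLINT \<omega>|M. iexp (u * y * \<Lambda> (?B y) \<omega>)) = exp (\<Phi> (u * y) * of_real (measure \<mu> (?B y)))"
      by (simp only: chf_def)
  qed
  also have "\<dots> = exp (\<Sum>y\<in>?I. measure \<mu> (?B y) *\<^sub>R \<Phi> (u * y))"
    by (simp only: exp_sum[OF fin] scaleR_conv_of_real mult.commute)
  also have "(\<Sum>y\<in>?I. measure \<mu> (?B y) *\<^sub>R \<Phi> (u * y)) = (CLINT z:A|\<mu>. \<Phi> (u * \<phi> z))"
    by (rule levy_simple_comp_integral(2)[OF \<phi> A, symmetric]) simp
  finally show ?thesis .
qed

text \<open>
  The level sets of the vector \<open>(\<phi> 0, \<dots>, \<phi> (k - 1))\<close> are a common refinement of the level sets of the components. Thus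
  the integrals of all the \<open>\<phi> i\<close> are linear functions of the values of the basis on one disjoint family.
\<close>
lemma sli_level_vectors:
  fixes \<phi> :: "nat \<Rightarrow> _"
  assumes \<phi>: "\<And>i. i < k \<Longrightarrow> levy_simple (\<phi> i)" and A: "A \<in> sets borel"
  defines "v \<equiv> \<lambda>z. \<lambda>i\<in>{..<k}. \<phi> i z"
  defines "R \<equiv> range v - {\<lambda>i\<in>{..<k}. 0}"
  shows "finite R" "\<And>w. w \<in> R \<Longrightarrow> A \<inter> v -` {w} \<in> bb"
    "\<And>i. i < k \<Longrightarrow> AE \<omega> in M. sli A (\<phi> i) \<omega> = (\<Sum>w\<in>R. w i * \<Lambda> (A \<inter> v -` {w}) \<omega>)"
proof -
  have "range v \<subseteq> PiE {..<k} (\<lambda>i. range (\<phi> i))" unfolding v_def by (intro image_subsetI) (simp only: restrict_PiE_iff, blast)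
  moreover have "finite (PiE {..<k} (\<lambda>i. range (\<phi> i)))"
    using \<phi> by (intro finite_PiE) (auto simp: levy_simple_def)
  ultimately show R: "finite R" unfolding R_def by (meson finite_Diff finite_subset)
  have vb: "A \<inter> v -` {w} \<in> sets borel" for w
  proof (cases "w \<in> extensional {..<k}")
    case True
    have eq: "v z = w \<longleftrightarrow> (\<forall>i<k. \<phi> i z = w i)" for z
    proof
      assume "\<forall>i<k. \<phi> i z = w i"
      then show "v z = w" using True unfolding v_def by (intro extensionalityI[of _ "{..<k}"]) auto
    qed (auto simp: v_def)
    have "A \<inter> v -` {w} = A \<inter> (\<Inter>i\<in>{..<k}. \<phi> i -` {w i})"
      using eq by blast
    moreover have "\<phi> i -` {w i} \<in> sets borel" if "i < k" for i
      using measurable_sets[OF levy_simple_measurable[OF \<phi>[OF that]], of "{w i}"] by simp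
    ultimately show ?thesis using A
      by (cases "k = 0") (auto intro!: sets.Int sets.finite_INT)
  next
    case False
    moreover have "v z \<in> extensional {..<k}" for z unfolding v_def by (rule restrict_extensional)
    ultimately have "A \<inter> v -` {w} = {}" by blast
    then show ?thesis by simp
  qed
  show bb: "A \<inter> v -` {w} \<in> bb" if "w \<in> R" for w
  proof (rule bb_subset[OF bb_UN vb])
    show "finite {..<k}" by simp
    show "{z. \<phi> i z \<noteq> 0} \<in> bb" if "i \<in> {..<k}" for i using \<phi> that by (simp add: levy_simple_def)
    show "A \<inter> v -` {w} \<subseteq> (\<Union>i\<in>{..<k}. {z. \<phi> i z \<noteq> 0})"
    proof
      fix z assume "z \<in> A \<inter> v -` {w}"
      with that have "v z \<noteq> (\<lambda>i\<in>{..<k}. 0)" by (auto simp: R_def)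
      then show "z \<in> (\<Union>i\<in>{..<k}. {z. \<phi> i z \<noteq> 0})" by (auto simp: v_def restrict_def fun_eq_iff split: if_splits)
    qed
  qed
  fix i assume i: "i < k"
  let ?Y = "range (\<phi> i) - {0}"
  have fY: "finite ?Y" by (rule levy_simple_finite[OF \<phi>[OF i]])
  have "AE \<omega> in M. \<forall>y\<in>?Y. \<Lambda> (A \<inter> \<phi> i -` {y}) \<omega> = (\<Sum>w | w \<in> R \<and> w i = y. \<Lambda> (A \<inter> v -` {w}) \<omega>)"
  proof (rule AE_finite_allI[OF fY])
    fix y assume y: "y \<in> ?Y"
    have "A \<inter> \<phi> i -` {y} = (\<Union>w\<in>{w. w \<in> R \<and> w i = y}. A \<inter> v -` {w})"
    proof safe
      fix z assume z: "z \<in> A" "y = \<phi> i z"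
      then have "v z i = y" "v z \<noteq> (\<lambda>i\<in>{..<k}. 0)" using i y by (auto simp: v_def fun_eq_iff restrict_def)
      then have "v z \<in> R" "v z i = y" by (auto simp: R_def)
      then show "z \<in> (\<Union>w\<in>{w \<in> R. w i = \<phi> i z}. A \<inter> v -` {w})" using z by blast
    qed (use i in \<open>auto simp: v_def\<close>)
    moreover have "AE \<omega> in M. \<Lambda> (\<Union>w\<in>{w. w \<in> R \<and> w i = y}. A \<inter> v -` {w}) \<omega> = (\<Sum>w | w \<in> R \<and> w i = y. \<Lambda> (A \<inter> v -` {w}) \<omega>)"
      using R bb by (intro Lambda_UN) (auto simp: disjoint_family_on_def)
    ultimately show "AE \<omega> in M. \<Lambda> (A \<inter> \<phi> i -` {y}) \<omega> = (\<Sum>w | w \<in> R \<and> w i = y. \<Lambda> (A \<inter> v -` {w}) \<omega>)" by simp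
  qed
  then show "AE \<omega> in M. sli A (\<phi> i) \<omega> = (\<Sum>w\<in>R. w i * \<Lambda> (A \<inter> v -` {w}) \<omega>)"
  proof eventually_elim
    case (elim \<omega>)
    have "sli A (\<phi> i) \<omega> = (\<Sum>y\<in>?Y. \<Sum>w | w \<in> R \<and> w i = y. w i * \<Lambda> (A \<inter> v -` {w}) \<omega>)"
      unfolding simple_levy_integral_def using elim by (intro sum.cong) (auto simp: sum_distrib_left)
    also have "\<dots> = (\<Sum>y\<in>?Y. \<Sum>w | w \<in> {w \<in> R. w i \<noteq> 0} \<and> w i = y. w i * \<Lambda> (A \<inter> v -` {w}) \<omega>)"
      by (intro sum.cong) auto
    also have "\<dots> = (\<Sum>w\<in>{w \<in> R. w i \<noteq> 0}. w i * \<Lambda> (A \<inter> v -` {w}) \<omega>)"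
      by (rule sum.group) (use R fY i in \<open>auto simp: R_def v_def\<close>)
    also have "\<dots> = (\<Sum>w\<in>R. w i * \<Lambda> (A \<inter> v -` {w}) \<omega>)"
      using R by (intro sum.mono_neutral_left) auto
    finally show ?case .
  qed
qed

text \<open>
  The first factor depends on the basis on subsets of \<open>A\<close> and the second on subsets of \<open>A'\<close>; together they are
  finitely many disjoint sets.
\<close>
lemma sli_vector_indep:
  fixes \<phi> :: "nat \<Rightarrow> _" and f :: "(nat \<Rightarrow> real) \<Rightarrow> real" and g :: "real \<Rightarrow> real"
  assumes \<phi>: "\<And>i. i < k \<Longrightarrow> levy_simple (\<phi> i)" and \<phi>': "levy_simple \<phi>'"
    and A: "A \<in> sets borel" "A' \<in> sets borel" "A \<inter> A' = {}"
    and f[measurable]: "f \<in> borel_measurable borel" and bf: "\<And>x. \<bar>f x\<bar> \<le> C"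
    and g[measurable]: "g \<in> borel_measurable borel" and bg: "\<And>x. \<bar>g x\<bar> \<le> C'"
  shows "(LINT \<omega>|M. f (\<lambda>i. if i < k then sli A (\<phi> i) \<omega> else 0) * g (sli A' \<phi>' \<omega>)) =
    (LINT \<omega>|M. f (\<lambda>i. if i < k then sli A (\<phi> i) \<omega> else 0)) * (LINT \<omega>|M. g (sli A' \<phi>' \<omega>))"
proof -
  define v where "v = (\<lambda>z. \<lambda>i\<in>{..<k}. \<phi> i z)"
  define R where "R = range v - {\<lambda>i\<in>{..<k}. 0}"
  note lv = sli_level_vectors[of k \<phi> A, OF \<phi> A(1), folded v_def R_def]
  have R: "finite R" "\<And>w. w \<in> R \<Longrightarrow> A \<inter> v -` {w} \<in> bb"
    "\<And>i. i < k \<Longrightarrow> AE \<omega> in M. sli A (\<phi> i) \<omega> = (\<Sum>w\<in>R. w i * \<Lambda> (A \<inter> v -` {w}) \<omega>)"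
    using lv by blast+
  let ?Y = "range \<phi>' - {0}"
  have fY: "finite ?Y" by (rule levy_simple_finite[OF \<phi>'])
  define D where "D s = (case s of Inl w \<Rightarrow> A \<inter> v -` {w} | Inr y \<Rightarrow> A' \<inter> \<phi>' -` {y})" for s :: "(nat \<Rightarrow> real) + real"
  have Dbb: "D s \<in> bb" if "s \<in> Inl ` R \<union> Inr ` ?Y" for s
  proof (cases s)
    case (Inl w)
    then show ?thesis using that R(2) by (auto simp: D_def)
  next
    case (Inr y)
    then have "y \<noteq> 0" using that by blast
    then show ?thesis using Inr level_set_bb[OF \<phi>' A(2)] by (simp add: D_def)
  qed
  have ind: "indep_vars (\<lambda>_. borel) (\<lambda>s. \<Lambda> (D s)) (Inl ` R \<union> Inr ` ?Y)"
  proof (rule Lambda_indep)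
    show "disjoint_family_on D (Inl ` R \<union> Inr ` ?Y)"
      unfolding disjoint_family_on_def
    proof (intro ballI impI)
      fix s s' :: "(nat \<Rightarrow> real) + real" assume "s \<noteq> s'"
      then show "D s \<inter> D s' = {}" using A(3) by (cases s; cases s') (auto simp: D_def)
    qed
  qed (use R(1) fY Dbb in auto)
  let ?X1 = "\<lambda>\<omega>. restrict (\<lambda>s. \<Lambda> (D s) \<omega>) (Inl ` R)"
  let ?X2 = "\<lambda>\<omega>. restrict (\<lambda>s. \<Lambda> (D s) \<omega>) (Inr ` ?Y)"
  have ind2: "indep_var (PiM (Inl ` R) (\<lambda>_. borel)) ?X1 (PiM (Inr ` ?Y) (\<lambda>_. borel)) ?X2"
    by (rule indep_var_restrict[OF ind]) auto
  define W where "W = (\<lambda>x::(nat \<Rightarrow> real) + real \<Rightarrow> real. \<lambda>i. if i < k then (\<Sum>w\<in>R. w i * x (Inl w)) else 0)"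
  define V where "V = (\<lambda>x::(nat \<Rightarrow> real) + real \<Rightarrow> real. (\<Sum>y\<in>?Y. y * x (Inr y)))"
  have W: "W \<in> borel_measurable (PiM (Inl ` R) (\<lambda>_. borel))"
  proof (rule measurable_coordinatewise_then_product)
    fix i show "(\<lambda>x. W x i) \<in> borel_measurable (PiM (Inl ` R) (\<lambda>_. borel))"
      unfolding W_def by (cases "i < k") (auto intro!: borel_measurable_sum borel_measurable_times measurable_component_singleton)
  qed
  have V: "V \<in> borel_measurable (PiM (Inr ` ?Y) (\<lambda>_. borel))"
    unfolding V_def by (auto intro!: borel_measurable_sum borel_measurable_times measurable_component_singleton)
  have "indep_var borel ((f \<circ> W) \<circ> ?X1) borel ((g \<circ> V) \<circ> ?X2)"
    by (rule indep_var_compose[OF ind2]) (auto intro!: measurable_comp[OF W f] measurable_comp[OF V g])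
  then have "(LINT \<omega>|M. ((f \<circ> W) \<circ> ?X1) \<omega> * ((g \<circ> V) \<circ> ?X2) \<omega>) = (LINT \<omega>|M. ((f \<circ> W) \<circ> ?X1) \<omega>) * (LINT \<omega>|M. ((g \<circ> V) \<circ> ?X2) \<omega>)"
  proof (rule indep_var_lebesgue_integral)
    note rv = indep_var_rv1[OF ind2] indep_var_rv2[OF ind2]
    show "integrable M ((f \<circ> W) \<circ> ?X1)"
      by (rule integrable_const_bound[of _ C]) (auto simp: bf intro!: measurable_comp[OF rv(1)] measurable_comp[OF W f])
    show "integrable M ((g \<circ> V) \<circ> ?X2)"
      by (rule integrable_const_bound[of _ C']) (auto simp: bg intro!: measurable_comp[OF rv(2)] measurable_comp[OF V g])
  qed
  moreover have "AE \<omega> in M. \<forall>i\<in>{..<k}. sli A (\<phi> i) \<omega> = (\<Sum>w\<in>R. w i * \<Lambda> (A \<inter> v -` {w}) \<omega>)"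
    using R(3) by (intro AE_finite_allI) auto
  then have AEW: "AE \<omega> in M. f (\<lambda>i. if i < k then sli A (\<phi> i) \<omega> else 0) = ((f \<circ> W) \<circ> ?X1) \<omega>"
  proof eventually_elim
    case (elim \<omega>)
    then have "(\<lambda>i. if i < k then sli A (\<phi> i) \<omega> else 0) = W (?X1 \<omega>)"
      by (auto simp: W_def D_def fun_eq_iff intro!: sum.cong)
    then show ?case by simp
  qed
  moreover have V_eq: "g (sli A' \<phi>' \<omega>) = ((g \<circ> V) \<circ> ?X2) \<omega>" for \<omega>
    by (simp add: V_def D_def simple_levy_integral_def)
  have W_meas: "(\<lambda>\<omega>. f (\<lambda>i. if i < k then sli A (\<phi> i) \<omega> else 0)) \<in> borel_measurable M"
  proof (rule measurable_compose[OF _ f], rule measurable_coordinatewise_then_product)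
    fix i show "(\<lambda>\<omega>. if i < k then sli A (\<phi> i) \<omega> else 0) \<in> borel_measurable M"
      using sli_measurable[OF \<phi> A(1)] by (cases "i < k") auto
  qed
  have X_meas: "((f \<circ> W) \<circ> ?X1) \<in> borel_measurable M"
    using indep_var_rv1[OF ind2] by (auto intro!: measurable_comp[OF _ measurable_comp[OF W f]])
  have V_meas: "(\<lambda>\<omega>. g (sli A' \<phi>' \<omega>)) \<in> borel_measurable M"
    using measurable_compose[OF sli_measurable[OF \<phi>' A(2)] g] .
  have "(LINT \<omega>|M. f (\<lambda>i. if i < k then sli A (\<phi> i) \<omega> else 0) * g (sli A' \<phi>' \<omega>)) =
      (LINT \<omega>|M. ((f \<circ> W) \<circ> ?X1) \<omega> * ((g \<circ> V) \<circ> ?X2) \<omega>)"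
    unfolding V_eq[symmetric]
    using AEW by (intro integral_cong_AE borel_measurable_times W_meas V_meas X_meas) (auto elim!: eventually_mono)
  moreover have "(LINT \<omega>|M. f (\<lambda>i. if i < k then sli A (\<phi> i) \<omega> else 0)) = (LINT \<omega>|M. ((f \<circ> W) \<circ> ?X1) \<omega>)"
    by (rule integral_cong_AE[OF W_meas X_meas AEW])
  ultimately show ?thesis unfolding V_eq by simp
qed

end

context levy_basis_space
begin

section \<open>The law of a stochastic integral\<close>

lemma measurable_mu_iff: "f \<in> borel_measurable \<mu> \<longleftrightarrow> f \<in> borel_measurable borel"
  by (simp only: measurable_cong_sets[OF sets_mu refl])

text \<open>
  The sequences \<open>\<phi>\<close> that occur in the definition of the stochastic integral of \<open>g\<close>. Sets outside of \<open>levy_space\<close> do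
  no harm since simple functions vanish there.
\<close>
definition levy_approx :: "(nat \<Rightarrow> real \<times> real \<times> (real ^ 'm) \<Rightarrow> real) \<Rightarrow> (real \<times> real \<times> (real ^ 'm) \<Rightarrow> real) \<Rightarrow> bool" where
  "levy_approx \<phi> g \<longleftrightarrow> (\<forall>n. levy_simple (\<phi> n)) \<and> g \<in> borel_measurable borel \<and>
     (AE z in \<mu>. (\<lambda>n. \<phi> n z) \<longlonglongrightarrow> g z) \<and>
     (\<forall>A\<in>sets borel. \<exists>Z\<in>borel_measurable M. tendsto_in_prob M (\<lambda>n. sli A (\<phi> n)) Z)"

text \<open>
  A version of the integral over \<open>A\<close>, along the sequence \<open>\<phi>\<close>.
\<close>
definition levy_limit :: "(nat \<Rightarrow> real \<times> real \<times> (real ^ 'm) \<Rightarrow> real) \<Rightarrow> (real \<times> real \<times> (real ^ 'm)) set \<Rightarrow> 'w \<Rightarrow> real" where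
  "levy_limit \<phi> A = (SOME Z. Z \<in> borel_measurable M \<and> tendsto_in_prob M (\<lambda>n. sli A (\<phi> n)) Z)"

lemma levy_limit:
  assumes "levy_approx \<phi> g" "A \<in> sets borel"
  shows "levy_limit \<phi> A \<in> borel_measurable M" "tendsto_in_prob M (\<lambda>n. sli A (\<phi> n)) (levy_limit \<phi> A)"
proof -
  have "\<exists>Z. Z \<in> borel_measurable M \<and> tendsto_in_prob M (\<lambda>n. sli A (\<phi> n)) Z"
    using assms unfolding levy_approx_def by blast
  from someI_ex[OF this] show "levy_limit \<phi> A \<in> borel_measurable M" "tendsto_in_prob M (\<lambda>n. sli A (\<phi> n)) (levy_limit \<phi> A)"
    unfolding levy_limit_def by blast+
qed

lemma levy_approx_simple: "levy_approx \<phi> g \<Longrightarrow> levy_simple (\<phi> n)" by (simp add: levy_approx_def)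

lemma levy_approx_measurable: "levy_approx \<phi> g \<Longrightarrow> g \<in> borel_measurable borel" by (simp add: levy_approx_def)

lemma levy_approx_AE: "levy_approx \<phi> g \<Longrightarrow> AE z in \<mu>. (\<lambda>n. \<phi> n z) \<longlonglongrightarrow> g z" by (simp add: levy_approx_def)

lemma levy_limit_add:
  assumes \<phi>: "levy_approx \<phi> g" and A: "A \<in> sets borel" "B \<in> sets borel" "A \<inter> B = {}"
  shows "AE \<omega> in M. levy_limit \<phi> (A \<union> B) \<omega> = levy_limit \<phi> A \<omega> + levy_limit \<phi> B \<omega>"
  by (rule tendsto_in_prob_add_unique[of "\<lambda>n. sli (A \<union> B) (\<phi> n)" _ "\<lambda>n. sli A (\<phi> n)" _ "\<lambda>n. sli B (\<phi> n)"])
     (use A in \<open>auto intro!: sli_measurable levy_approx_simple[OF \<phi>] levy_limit[OF \<phi>] sli_Un\<close>)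

lemma chf_levy_limit_tendsto:
  assumes \<phi>: "levy_approx \<phi> g" and A: "A \<in> sets borel"
  shows "(\<lambda>n. exp (CLINT z:A|\<mu>. \<Phi> (u * \<phi> n z))) \<longlonglongrightarrow> chf M (levy_limit \<phi> A) u"
  using chf_tendsto[of "\<lambda>n. sli A (\<phi> n)" "levy_limit \<phi> A" u] levy_limit[OF \<phi> A] sli_measurable[OF levy_approx_simple[OF \<phi>] A]
  by (simp add: chf_sli[OF levy_approx_simple[OF \<phi>] A])

lemma integrable_exponent_simple:
  assumes "levy_simple \<phi>" "A \<in> sets borel"
  shows "set_integrable \<mu> A (\<lambda>z. \<Phi> (u * \<phi> z))"
  using levy_simple_comp_integral(1)[OF assms, of "\<lambda>y. \<Phi> (u * y)"] by simp

lemma Re_exponent_simple: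
  assumes "levy_simple \<phi>" "A \<in> sets borel"
  shows "Re (CLINT z:A|\<mu>. \<Phi> (u * \<phi> z)) = (LINT z:A|\<mu>. Re (\<Phi> (u * \<phi> z)))"
    "set_integrable \<mu> A (\<lambda>z. Re (\<Phi> (u * \<phi> z)))"
proof -
  have i: "integrable \<mu> (\<lambda>z. indicator A z *\<^sub>R \<Phi> (u * \<phi> z))"
    using integrable_exponent_simple[OF assms] by (simp add: set_integrable_def)
  show "Re (CLINT z:A|\<mu>. \<Phi> (u * \<phi> z)) = (LINT z:A|\<mu>. Re (\<Phi> (u * \<phi> z)))"
    unfolding set_lebesgue_integral_def by (subst integral_Re[OF i, symmetric]) simp
  show "set_integrable \<mu> A (\<lambda>z. Re (\<Phi> (u * \<phi> z)))"
    using integrable_Re[OF i] by (simp add: set_integrable_def)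
qed

lemma Re_exponent_simple_nonpos:
  assumes "levy_simple \<phi>" "A \<in> sets borel"
  shows "Re (CLINT z:A|\<mu>. \<Phi> (u * \<phi> z)) \<le> 0"
proof -
  have "0 \<le> (LINT z:A|\<mu>. - Re (\<Phi> (u * \<phi> z)))"
    unfolding set_lebesgue_integral_def using Re_levy_exponent_nonpos by (intro integral_nonneg_AE) (auto simp: indicator_def)
  also have "\<dots> = - (LINT z:A|\<mu>. Re (\<Phi> (u * \<phi> z)))"
    using Re_exponent_simple(2)[OF assms] by (rule set_integral_uminus)
  finally show ?thesis unfolding Re_exponent_simple(1)[OF assms] by simp
qed

lemma chf_levy_limit_double:
  assumes \<phi>: "levy_approx \<phi> g" and A: "A \<in> sets borel"
  shows "norm (chf M (levy_limit \<phi> A) u) ^ 4 \<le> norm (chf M (levy_limit \<phi> A) (2 * u))"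
proof (rule LIMSEQ_le)
  let ?e = "\<lambda>u n. exp (CLINT z:A|\<mu>. \<Phi> (u * \<phi> n z))"
  show "(\<lambda>n. norm (?e u n) ^ 4) \<longlonglongrightarrow> norm (chf M (levy_limit \<phi> A) u) ^ 4"
    by (intro tendsto_intros chf_levy_limit_tendsto[OF \<phi> A])
  show "(\<lambda>n. norm (?e (2 * u) n)) \<longlonglongrightarrow> norm (chf M (levy_limit \<phi> A) (2 * u))"
    by (intro tendsto_norm chf_levy_limit_tendsto[OF \<phi> A])
  have "norm (?e u n) ^ 4 \<le> norm (?e (2 * u) n)" for n
  proof -
    note s = levy_approx_simple[OF \<phi>, of n]
    have "4 * (LINT z:A|\<mu>. Re (\<Phi> (u * \<phi> n z))) = (LINT z:A|\<mu>. 4 * Re (\<Phi> (u * \<phi> n z)))"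
      by (rule set_integral_mult_right[symmetric])
    also have "\<dots> \<le> (LINT z:A|\<mu>. Re (\<Phi> (2 * u * \<phi> n z)))"
    proof (rule set_integral_mono)
      show "set_integrable \<mu> A (\<lambda>z. 4 * Re (\<Phi> (u * \<phi> n z)))"
        using Re_exponent_simple(2)[OF s A] by simp
      show "4 * Re (\<Phi> (u * \<phi> n z)) \<le> Re (\<Phi> (2 * u * \<phi> n z))" for z
        using Re_levy_exponent_double[of "u * \<phi> n z"] by (simp add: mult.assoc)
    qed (rule Re_exponent_simple(2)[OF s A])
    finally have "exp (4 * (LINT z:A|\<mu>. Re (\<Phi> (u * \<phi> n z)))) \<le> exp (LINT z:A|\<mu>. Re (\<Phi> (2 * u * \<phi> n z)))"
      by simp
    moreover have "exp (4 * x) = exp x ^ 4" for x :: real using exp_of_nat_mult[of 4 x] by simp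
    ultimately show ?thesis by (simp only: norm_exp_eq_Re Re_exponent_simple(1)[OF s A])
  qed
  then show "\<exists>N. \<forall>n\<ge>N. norm (?e u n) ^ 4 \<le> norm (?e (2 * u) n)" by blast
qed

text \<open>
  By continuity at zero the characteristic function does not vanish at \<open>u / 2 ^ k\<close> for large \<open>k\<close>, and the doubling
  inequality carries this back to \<open>u\<close>.
\<close>
lemma chf_levy_limit_nonzero:
  assumes \<phi>: "levy_approx \<phi> g" and A: "A \<in> sets borel"
  shows "chf M (levy_limit \<phi> A) u \<noteq> 0"
proof -
  let ?c = "chf M (levy_limit \<phi> A)"
  have "(\<lambda>k. ?c (u * (1/2) ^ k)) \<longlonglongrightarrow> ?c 0"
    by (rule isCont_tendsto_compose[OF isCont_chf[OF levy_limit(1)[OF \<phi> A]]])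
       (use tendsto_mult_right_zero[OF LIMSEQ_power_zero[of "1/2::real"], of u] in simp)
  then have "\<forall>\<^sub>F k in sequentially. ?c (u * (1/2) ^ k) \<noteq> 0"
    by (rule tendsto_imp_eventually_ne) (simp add: chf_0)
  then obtain k where k: "?c (u * (1/2) ^ k) \<noteq> 0" by (auto simp: eventually_sequentially)
  have "?c (u * (1/2) ^ j) \<noteq> 0 \<Longrightarrow> ?c u \<noteq> 0" for j
  proof (induction j)
    case (Suc j)
    have "0 < norm (?c (u * (1/2) ^ Suc j)) ^ 4" using Suc.prems by simp
    also have "\<dots> \<le> norm (?c (2 * (u * (1/2) ^ Suc j)))" by (rule chf_levy_limit_double[OF \<phi> A])
    finally show ?case by (intro Suc.IH) simp
  qed simp
  with k show ?thesis by blast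
qed

lemma AE_seq_finite_tail:
  fixes C :: "(real \<times> real \<times> (real ^ 'm)) set"
  assumes C: "C \<in> sets borel" "emeasure \<mu> C < \<infinity>" and T: "\<And>k. T k \<in> sets borel" "decseq T"
    and AE: "AE z in \<mu>. \<exists>k. z \<notin> T k"
  shows "(\<lambda>k. measure \<mu> (C \<inter> T k)) \<longlonglongrightarrow> 0"
proof -
  have "(\<lambda>k. emeasure \<mu> (C \<inter> T k)) \<longlonglongrightarrow> emeasure \<mu> (\<Inter>k. C \<inter> T k)"
  proof (rule Lim_emeasure_decseq)
    show "range (\<lambda>k. C \<inter> T k) \<subseteq> sets \<mu>" using C T unfolding sets_mu by blast
    show "decseq (\<lambda>k. C \<inter> T k)" using T(2) unfolding decseq_def by blast
    show "emeasure \<mu> (C \<inter> T k) \<noteq> \<infinity>" for k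
    proof -
      have "emeasure \<mu> (C \<inter> T k) \<le> emeasure \<mu> C" by (rule emeasure_mono) (use C in \<open>unfold sets_mu, blast+\<close>)
      then show ?thesis using C(2) by (auto simp: top_unique)
    qed
  qed
  moreover have "emeasure \<mu> (\<Inter>k. C \<inter> T k) = 0"
  proof -
    have "AE z in \<mu>. \<not> (z \<in> (\<Inter>k. C \<inter> T k))" using AE by eventually_elim blast
    then have "emeasure \<mu> {z \<in> space \<mu>. z \<in> (\<Inter>k. C \<inter> T k)} = 0" by (rule emeasure_eq_0_AE)
    then show ?thesis by (simp only: space_mu UNIV_I True_implies_equals simp_thms Collect_mem_eq)
  qed
  ultimately have "(\<lambda>k. emeasure \<mu> (C \<inter> T k)) \<longlonglongrightarrow> ennreal 0" by simp
  then have "(\<lambda>k. enn2real (emeasure \<mu> (C \<inter> T k))) \<longlonglongrightarrow> 0" by (intro tendsto_enn2real) auto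
  then show ?thesis by (simp add: measure_def)
qed

text \<open>
  The set functions \<open>A \<mapsto> exp (\<integral>\<^sub>A \<Phi> (u * \<phi> n))\<close> are multiplicative, and each one is uniformly close to one on the subsets of
  \<open>T k\<close> for large \<open>k\<close>, because \<open>\<phi> n\<close> is bounded with support of finite measure.
\<close>
lemma chf_levy_limit_tail:
  assumes \<phi>: "levy_approx \<phi> g" and T: "\<And>k. T k \<in> sets borel" "decseq T"
    and AE: "AE z in \<mu>. \<exists>k. z \<notin> T k"
  shows "(\<lambda>k. chf M (levy_limit \<phi> (T k)) u) \<longlonglongrightarrow> 1"
proof (rule gliding_hump[where N="borel :: (real \<times> real \<times> (real ^ 'm)) measure" and
      e="\<lambda>n A. exp (CLINT z:A|\<mu>. \<Phi> (u * \<phi> n z))" and l="\<lambda>A. chf M (levy_limit \<phi> A) u" and T=T])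
  fix n and A B :: "(real \<times> real \<times> (real ^ 'm)) set"
  assume AB: "A \<in> sets borel" "B \<in> sets borel" "A \<inter> B = {}"
  have "(CLINT z:A \<union> B|\<mu>. \<Phi> (u * \<phi> n z)) = (CLINT z:A|\<mu>. \<Phi> (u * \<phi> n z)) + (CLINT z:B|\<mu>. \<Phi> (u * \<phi> n z))"
    by (rule set_integral_Un) (use AB integrable_exponent_simple[OF levy_approx_simple[OF \<phi>]] in auto)
  then show "exp (CLINT z:A \<union> B|\<mu>. \<Phi> (u * \<phi> n z)) = exp (CLINT z:A|\<mu>. \<Phi> (u * \<phi> n z)) * exp (CLINT z:B|\<mu>. \<Phi> (u * \<phi> n z))"
    by (simp add: exp_add)
next
  fix n and A :: "(real \<times> real \<times> (real ^ 'm)) set"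
  assume "A \<in> sets borel"
  then show "norm (exp (CLINT z:A|\<mu>. \<Phi> (u * \<phi> n z))) \<le> 1"
    using Re_exponent_simple_nonpos[OF levy_approx_simple[OF \<phi>]] by (simp add: norm_exp_eq_Re)
next
  fix n and \<epsilon> :: real assume \<epsilon>: "0 < \<epsilon>"
  note s = levy_approx_simple[OF \<phi>, of n]
  let ?C = "{z. \<phi> n z \<noteq> 0}"
  have C: "?C \<in> sets borel" "emeasure \<mu> ?C < \<infinity>"
  proof -
    have "?C \<in> bb" using s by (simp add: levy_simple_def)
    then show "?C \<in> sets borel" "emeasure \<mu> ?C < \<infinity>" by (rule bb_borel, rule emeasure_bb_finite)
  qed
  obtain K where K: "\<And>z. \<bar>u * \<phi> n z\<bar> \<le> K"
  proof -
    have "finite ((\<lambda>z. \<bar>u * z\<bar>) ` range (\<phi> n))" using s by (simp add: levy_simple_def)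
    then have "\<bar>u * \<phi> n z\<bar> \<le> Max ((\<lambda>z. \<bar>u * z\<bar>) ` range (\<phi> n))" for z by (intro Max_ge) auto
    then show ?thesis using that by blast
  qed
  define B where "B = exponent_bound K"
  have B: "norm (\<Phi> (u * \<phi> n z)) \<le> B" for z unfolding B_def by (rule norm_levy_exponent_le[OF K])
  then have B0: "0 \<le> B" using norm_ge_zero order_trans by blast
  have "(\<lambda>k. B * measure \<mu> (?C \<inter> T k)) \<longlonglongrightarrow> B * 0"
    by (intro tendsto_mult tendsto_const AE_seq_finite_tail[OF C T AE])
  then have "\<forall>\<^sub>F k in sequentially. B * measure \<mu> (?C \<inter> T k) < \<epsilon>"
    using \<epsilon> by (intro order_tendstoD(2)) auto
  then obtain k where k: "B * measure \<mu> (?C \<inter> T k) < \<epsilon>" by (auto simp: eventually_sequentially)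
  show "\<exists>K. \<forall>A\<in>sets borel. A \<subseteq> T K \<longrightarrow> norm (exp (CLINT z:A|\<mu>. \<Phi> (u * \<phi> n z)) - 1) < \<epsilon>"
  proof (intro exI[of _ k] ballI impI)
    fix A :: "(real \<times> real \<times> (real ^ 'm)) set" assume A: "A \<in> sets borel" "A \<subseteq> T k"
    have CT: "?C \<inter> T k \<in> sets \<mu>" using C T unfolding sets_mu by blast
    have fin: "emeasure \<mu> (?C \<inter> T k) < \<infinity>"
    proof -
      have "emeasure \<mu> (?C \<inter> T k) \<le> emeasure \<mu> ?C" by (rule emeasure_mono) (use C in \<open>unfold sets_mu, blast+\<close>)
      then show ?thesis using C(2) by (rule order_le_less_trans)
    qed
    have "norm (exp (CLINT z:A|\<mu>. \<Phi> (u * \<phi> n z)) - 1) \<le> norm (CLINT z:A|\<mu>. \<Phi> (u * \<phi> n z))"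
      by (rule norm_exp_minus_1_le[OF Re_exponent_simple_nonpos[OF s A(1)]])
    also have "\<dots> \<le> (LINT z|\<mu>. B * indicator (?C \<inter> T k) z)"
      unfolding set_lebesgue_integral_def
    proof (rule norm_integral_le)
      show "integrable \<mu> (\<lambda>z. B * indicator (?C \<inter> T k) z)"
        by (intro integrable_mult_right integrable_real_indicator CT fin)
      show "AE z in \<mu>. norm (indicator A z *\<^sub>R \<Phi> (u * \<phi> n z)) \<le> B * indicator (?C \<inter> T k) z"
      proof (rule AE_I2)
        fix z
        show "norm (indicator A z *\<^sub>R \<Phi> (u * \<phi> n z)) \<le> B * indicator (?C \<inter> T k) z"
          using A(2) B[of z] B0 by (cases "z \<in> A"; cases "\<phi> n z = 0") auto
      qed
    qed
    also have "\<dots> = B * measure \<mu> (?C \<inter> T k)" by simp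
    finally show "norm (exp (CLINT z:A|\<mu>. \<Phi> (u * \<phi> n z)) - 1) < \<epsilon>" using k by simp
  qed
qed (use T chf_levy_limit_tendsto[OF \<phi>] chf_levy_limit_nonzero[OF \<phi>] in auto)

text \<open>
  An exhausting sequence of bounded sets on each of which the functions \<open>\<phi> n\<close> are uniformly bounded. It exhausts almost
  everything because a convergent sequence is bounded.
\<close>
definition levy_domain :: "(nat \<Rightarrow> real \<times> real \<times> (real ^ 'm) \<Rightarrow> real) \<Rightarrow> nat \<Rightarrow> (real \<times> real \<times> (real ^ 'm)) set" where
  "levy_domain \<phi> k = {z \<in> levy_space \<inter> cball 0 (real k). \<forall>n. \<bar>\<phi> n z\<bar> \<le> real k}"

lemma levy_approx_domain:
  assumes \<phi>: "levy_approx \<phi> g"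
  defines "D \<equiv> levy_domain \<phi>"
  shows "D k \<in> sets borel" "emeasure \<mu> (D k) < \<infinity>" "incseq D" "AE z in \<mu>. \<exists>k. z \<in> D k"
proof -
  have [measurable]: "\<phi> n \<in> borel_measurable borel" for n by (rule levy_simple_measurable[OF levy_approx_simple[OF \<phi>]])
  have "D k = levy_space \<inter> cball 0 (real k) \<inter> (\<Inter>n. {z. \<bar>\<phi> n z\<bar> \<le> real k})" for k by (auto simp: D_def levy_domain_def)
  moreover have "{z. \<bar>\<phi> n z\<bar> \<le> real k} \<in> sets borel" for n k
  proof -
    have "{z \<in> space borel. \<bar>\<phi> n z\<bar> \<le> real k} \<in> sets borel" by measurable
    then show ?thesis by simp
  qed
  ultimately show D: "D k \<in> sets borel" for k by auto
  have "bounded (D k)" by (rule bounded_subset[OF bounded_cball[of 0 "real k"]]) (auto simp: D_def levy_domain_def)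
  then show "emeasure \<mu> (D k) < \<infinity>" using D by (rule emeasure_mu_bounded)
  show "incseq D"
  proof (rule incseq_SucI, rule subsetI)
    fix k z assume "z \<in> D k"
    then have "z \<in> levy_space" "norm z \<le> real k" "\<And>n. \<bar>\<phi> n z\<bar> \<le> real k"
      by (simp_all add: D_def levy_domain_def)
    moreover from this(3) have "\<bar>\<phi> n z\<bar> \<le> real (Suc k)" for n by (rule order_trans) simp
    ultimately have "z \<in> levy_space" "norm z \<le> real (Suc k)" "\<And>n. \<bar>\<phi> n z\<bar> \<le> real (Suc k)"
      by auto
    then show "z \<in> D (Suc k)" by (simp add: D_def levy_domain_def)
  qed
  show "AE z in \<mu>. \<exists>k. z \<in> D k"
    using AE_levy_space levy_approx_AE[OF \<phi>]
  proof eventually_elim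
    case (elim z)
    then obtain K where K: "\<And>n. \<bar>\<phi> n z\<bar> \<le> K" using convergent_imp_Bseq[of "\<lambda>n. \<phi> n z"]
      by (auto simp: convergent_def Bseq_def)
    obtain k where k: "max K (norm z) \<le> real k" using real_arch_simple by blast
    have "\<bar>\<phi> n z\<bar> \<le> real k" for n using K[of n] k by linarith
    then show ?case using elim k by (intro exI[of _ k]) (simp add: D_def levy_domain_def)
  qed
qed

text \<open>
  On \<open>A \<inter> levy_domain \<phi> k\<close> the formula holds by dominated convergence in \<open>n\<close>, and the factor from the rest of \<open>A\<close>
  tends to one as \<open>k\<close> grows.
\<close>
lemma chf_levy_limit:
  assumes \<phi>: "levy_approx \<phi> g" and A: "A \<in> sets borel" and int: "set_integrable \<mu> A (\<lambda>z. \<Phi> (u * g z))"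
  shows "chf M (levy_limit \<phi> A) u = exp (CLINT z:A|\<mu>. \<Phi> (u * g z))"
proof -
  define D where "D = levy_domain \<phi>"
  note D = levy_approx_domain[OF \<phi>, folded D_def]
  have [measurable]: "\<phi> n \<in> borel_measurable borel" for n by (rule levy_simple_measurable[OF levy_approx_simple[OF \<phi>]])
  have [measurable]: "g \<in> borel_measurable borel" by (rule levy_approx_measurable[OF \<phi>])
  have AD: "A \<inter> D k \<in> sets borel" "A - D k \<in> sets borel" for k using A D(1)[of k] by blast+
  have tail: "(\<lambda>k. chf M (levy_limit \<phi> (A - D k)) u) \<longlonglongrightarrow> 1"
  proof (rule chf_levy_limit_tail[OF \<phi> AD(2)])
    show "decseq (\<lambda>k. A - D k)" using D(3) unfolding decseq_def incseq_def by blast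
    show "AE z in \<mu>. \<exists>k. z \<notin> A - D k" using D(4) by eventually_elim blast
  qed
  have chfD: "chf M (levy_limit \<phi> (A \<inter> D k)) u = exp (CLINT z:A \<inter> D k|\<mu>. \<Phi> (u * g z))" for k
  proof (rule LIMSEQ_unique[OF chf_levy_limit_tendsto[OF \<phi> AD(1)]])
    have "(\<lambda>n. CLINT z:A \<inter> D k|\<mu>. \<Phi> (u * \<phi> n z)) \<longlonglongrightarrow> (CLINT z:A \<inter> D k|\<mu>. \<Phi> (u * g z))"
      unfolding set_lebesgue_integral_def
    proof (rule integral_dominated_convergence[where w="\<lambda>z. exponent_bound (\<bar>u\<bar> * real k) * indicator (D k) z"])
      show "integrable \<mu> (\<lambda>z. exponent_bound (\<bar>u\<bar> * real k) * indicator (D k) z)"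
        using D(1,2)[of k] by (intro integrable_mult_right integrable_real_indicator) (simp_all only: sets_mu)
      show "AE z in \<mu>. norm (indicator (A \<inter> D k) z *\<^sub>R \<Phi> (u * \<phi> n z)) \<le> exponent_bound (\<bar>u\<bar> * real k) * indicator (D k) z" for n
      proof (rule AE_I2)
        fix z
        show "norm (indicator (A \<inter> D k) z *\<^sub>R \<Phi> (u * \<phi> n z)) \<le> exponent_bound (\<bar>u\<bar> * real k) * indicator (D k) z"
        proof (cases "z \<in> D k")
          case True
          then have "\<bar>u * \<phi> n z\<bar> \<le> \<bar>u\<bar> * real k" by (auto simp: D_def levy_domain_def abs_mult intro!: mult_left_mono)
          from norm_levy_exponent_le[OF this] show ?thesis using True order_trans[OF norm_ge_zero]
            by (auto simp: indicator_def)
        qed auto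
      qed
      show "AE z in \<mu>. (\<lambda>n. indicator (A \<inter> D k) z *\<^sub>R \<Phi> (u * \<phi> n z)) \<longlonglongrightarrow> indicator (A \<inter> D k) z *\<^sub>R \<Phi> (u * g z)"
        using levy_approx_AE[OF \<phi>]
        by eventually_elim (intro tendsto_intros isCont_tendsto_compose[OF isCont_levy_exponent])
      show "(\<lambda>z. indicator (A \<inter> D k) z *\<^sub>R \<Phi> (u * g z)) \<in> borel_measurable \<mu>"
        "(\<lambda>z. indicator (A \<inter> D k) z *\<^sub>R \<Phi> (u * \<phi> n z)) \<in> borel_measurable \<mu>" for n
        using AD(1)[of k, measurable] unfolding measurable_mu_iff by measurable
    qed
    then show "(\<lambda>n. exp (CLINT z:A \<inter> D k|\<mu>. \<Phi> (u * \<phi> n z))) \<longlonglongrightarrow> exp (CLINT z:A \<inter> D k|\<mu>. \<Phi> (u * g z))"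
      by (rule tendsto_exp)
  qed
  have split: "chf M (levy_limit \<phi> A) u = chf M (levy_limit \<phi> (A \<inter> D k)) u * chf M (levy_limit \<phi> (A - D k)) u" for k
  proof (rule LIMSEQ_unique[OF chf_levy_limit_tendsto[OF \<phi> A]])
    have "(CLINT z:A|\<mu>. \<Phi> (u * \<phi> n z)) = (CLINT z:A \<inter> D k|\<mu>. \<Phi> (u * \<phi> n z)) + (CLINT z:A - D k|\<mu>. \<Phi> (u * \<phi> n z))" for n
    proof -
      have "A = (A \<inter> D k) \<union> (A - D k)" by blast
      then have "(CLINT z:A|\<mu>. \<Phi> (u * \<phi> n z)) = (CLINT z:(A \<inter> D k) \<union> (A - D k)|\<mu>. \<Phi> (u * \<phi> n z))" by simp
      also have "\<dots> = (CLINT z:A \<inter> D k|\<mu>. \<Phi> (u * \<phi> n z)) + (CLINT z:A - D k|\<mu>. \<Phi> (u * \<phi> n z))"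
        by (rule set_integral_Un) (use AD integrable_exponent_simple[OF levy_approx_simple[OF \<phi>]] in auto)
      finally show ?thesis .
    qed
    then show "(\<lambda>n. exp (CLINT z:A|\<mu>. \<Phi> (u * \<phi> n z))) \<longlonglongrightarrow>
        chf M (levy_limit \<phi> (A \<inter> D k)) u * chf M (levy_limit \<phi> (A - D k)) u"
      by (simp only: exp_add) (intro tendsto_mult chf_levy_limit_tendsto[OF \<phi>] AD)
  qed
  have "(\<lambda>k. CLINT z:A \<inter> D k|\<mu>. \<Phi> (u * g z)) \<longlonglongrightarrow> (CLINT z:A|\<mu>. \<Phi> (u * g z))"
    unfolding set_lebesgue_integral_def
  proof (rule integral_dominated_convergence[where w="\<lambda>z. norm (indicator A z *\<^sub>R \<Phi> (u * g z))"])
    show "integrable \<mu> (\<lambda>z. norm (indicator A z *\<^sub>R \<Phi> (u * g z)))"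
      using int unfolding set_integrable_def by (rule integrable_norm)
    show "AE z in \<mu>. norm (indicator (A \<inter> D k) z *\<^sub>R \<Phi> (u * g z)) \<le> norm (indicator A z *\<^sub>R \<Phi> (u * g z))" for k
      by (rule AE_I2) (simp add: indicator_def)
    show "AE z in \<mu>. (\<lambda>k. indicator (A \<inter> D k) z *\<^sub>R \<Phi> (u * g z)) \<longlonglongrightarrow> indicator A z *\<^sub>R \<Phi> (u * g z)"
      using D(4)
    proof eventually_elim
      case (elim z)
      then obtain k where "z \<in> D k" by blast
      then have "z \<in> D j" if "j \<ge> k" for j using D(3) that unfolding incseq_def by blast
      then have "\<forall>\<^sub>F j in sequentially. indicator (A \<inter> D j) z *\<^sub>R \<Phi> (u * g z) = indicator A z *\<^sub>R \<Phi> (u * g z)"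
        unfolding eventually_sequentially by (intro exI[of _ k]) (simp add: indicator_def)
      then show ?case by (rule tendsto_eventually)
    qed
    show "(\<lambda>z. indicator A z *\<^sub>R \<Phi> (u * g z)) \<in> borel_measurable \<mu>"
      "(\<lambda>z. indicator (A \<inter> D k) z *\<^sub>R \<Phi> (u * g z)) \<in> borel_measurable \<mu>" for k
      using A[measurable] AD(1)[of k, measurable] unfolding measurable_mu_iff by measurable
  qed
  then have "(\<lambda>k. chf M (levy_limit \<phi> (A \<inter> D k)) u * chf M (levy_limit \<phi> (A - D k)) u) \<longlonglongrightarrow>
      exp (CLINT z:A|\<mu>. \<Phi> (u * g z)) * 1"
    unfolding chfD by (intro tendsto_mult tendsto_exp tail)
  then have "(\<lambda>k::nat. chf M (levy_limit \<phi> A) u) \<longlonglongrightarrow> exp (CLINT z:A|\<mu>. \<Phi> (u * g z))"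
    by (simp only: split[symmetric] mult_1_right)
  then show ?thesis by (rule LIMSEQ_unique[OF tendsto_const])
qed

lemma levy_limit_AE_0:
  assumes \<phi>: "levy_approx \<phi> g" and A: "A \<in> sets borel" and 0: "\<And>z. z \<in> A \<Longrightarrow> g z = 0"
  shows "AE \<omega> in M. levy_limit \<phi> A \<omega> = 0"
proof (rule chf_eq_1_imp_AE_0[OF levy_limit(1)[OF \<phi> A]])
  fix u
  have z: "indicator A z *\<^sub>R \<Phi> (u * g z) = 0" for z using 0 by (cases "z \<in> A") auto
  have "set_integrable \<mu> A (\<lambda>z. \<Phi> (u * g z))" unfolding set_integrable_def z by simp
  from chf_levy_limit[OF \<phi> A this] show "chf M (levy_limit \<phi> A) u = 1"
    unfolding set_lebesgue_integral_def z by simp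
qed

text \<open>
  \<open>1 - Re (exp \<kappa>) \<le> \<bar>\<kappa>\<bar>\<close> for the exponent \<open>\<kappa> = \<integral> \<Phi> (u * g)\<close>, which is of order \<open>u\<^sup>2\<close>.
\<close>
lemma first_moment_levy_limit_centred:
  assumes \<phi>: "levy_approx \<phi> g" and A: "A \<in> sets borel"
    and centred: "\<gamma> + (LINT x:{x. 1 < \<bar>x\<bar>}|\<nu>. x) = 0"
    and int: "set_integrable \<mu> A (\<lambda>z. (g z)\<^sup>2)"
  shows "integrable M (levy_limit \<phi> A)"
    "(LINT \<omega>|M. \<bar>levy_limit \<phi> A \<omega>\<bar>) \<le> sqrt (Sigma_L S \<nu> * (LINT z:A|\<mu>. (g z)\<^sup>2))"
proof -
  have [measurable]: "g \<in> borel_measurable borel" by (rule levy_approx_measurable[OF \<phi>])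
  define C where "C = Sigma_L S \<nu> * (LINT z:A|\<mu>. (g z)\<^sup>2)"
  have Sig: "0 \<le> Sigma_L S \<nu>" unfolding Sigma_L_def using S_nonneg by (intro add_nonneg_nonneg integral_nonneg_AE) auto
  have C: "0 \<le> C" unfolding C_def set_lebesgue_integral_def using Sig by (intro mult_nonneg_nonneg integral_nonneg_AE) auto
  have "1 - Re (chf M (levy_limit \<phi> A) u) \<le> C * u\<^sup>2 / 2" for u
  proof -
    let ?w = "\<lambda>z. Sigma_L S \<nu> * u\<^sup>2 / 2 * (indicator A z *\<^sub>R (g z)\<^sup>2)"
    have le: "norm (indicator A z *\<^sub>R \<Phi> (u * g z)) \<le> ?w z" for z
      using norm_levy_exponent_le_centred[OF centred, of "u * g z"] by (auto simp: indicator_def power_mult_distrib)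
    have iw: "integrable \<mu> ?w" using int unfolding set_integrable_def by (rule integrable_mult_right)
    have ii: "set_integrable \<mu> A (\<lambda>z. \<Phi> (u * g z))"
      unfolding set_integrable_def
    proof (rule Bochner_Integration.integrable_bound[OF iw])
      show "(\<lambda>z. indicator A z *\<^sub>R \<Phi> (u * g z)) \<in> borel_measurable \<mu>"
        using A[measurable] unfolding measurable_mu_iff by measurable
      show "AE z in \<mu>. norm (indicator A z *\<^sub>R \<Phi> (u * g z)) \<le> norm (?w z)"
        by (rule AE_I2, rule order_trans[OF le]) simp
    qed
    have chf: "chf M (levy_limit \<phi> A) u = exp (CLINT z:A|\<mu>. \<Phi> (u * g z))" by (rule chf_levy_limit[OF \<phi> A ii])
    have neg: "Re (CLINT z:A|\<mu>. \<Phi> (u * g z)) \<le> 0"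
      using norm_chf_le_1[of "levy_limit \<phi> A" u] unfolding chf norm_exp_eq_Re by simp
    have "1 - Re (chf M (levy_limit \<phi> A) u) \<le> norm (exp (CLINT z:A|\<mu>. \<Phi> (u * g z)) - 1)"
      unfolding chf using abs_Re_le_cmod[of "exp (CLINT z:A|\<mu>. \<Phi> (u * g z)) - 1"] by simp
    also have "\<dots> \<le> norm (CLINT z:A|\<mu>. \<Phi> (u * g z))" by (rule norm_exp_minus_1_le[OF neg])
    also have "\<dots> \<le> (LINT z|\<mu>. ?w z)"
      unfolding set_lebesgue_integral_def using le by (intro norm_integral_le iw) auto
    also have "\<dots> = Sigma_L S \<nu> * u\<^sup>2 / 2 * (LINT z:A|\<mu>. (g z)\<^sup>2)"
      unfolding set_lebesgue_integral_def by (rule integral_mult_right_zero)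
    finally show ?thesis by (simp add: C_def mult_ac)
  qed
  then have "(\<integral>\<^sup>+\<omega>. ennreal ((levy_limit \<phi> A \<omega>)\<^sup>2) \<partial>M) \<le> ennreal C"
    by (rule second_moment_le[OF levy_limit(1)[OF \<phi> A]])
  from first_moment_le_sqrt_second_moment[OF levy_limit(1)[OF \<phi> A] this C]
  show "integrable M (levy_limit \<phi> A)" "(LINT \<omega>|M. \<bar>levy_limit \<phi> A \<omega>\<bar>) \<le> sqrt (Sigma_L S \<nu> * (LINT z:A|\<mu>. (g z)\<^sup>2))"
    by (auto simp: C_def)
qed

end

section \<open>First moments in the finite variation case\<close>

locale finite_variation_basis = levy_basis_space \<gamma> S \<nu> M \<Lambda> \<pi> + finite_variation_triplet \<gamma> S \<nu>
  for \<gamma> S \<nu> and M :: "'w measure" and \<Lambda> :: "(real \<times> real \<times> (real ^ 'm::finite)) set \<Rightarrow> 'w \<Rightarrow> real" and \<pi>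
begin

abbreviation compensated :: "(real \<times> real \<times> (real ^ 'm)) set \<Rightarrow> 'w \<Rightarrow> real" where
  "compensated B \<omega> \<equiv> \<Lambda> B \<omega> - gamma_zero \<gamma> \<nu> * measure \<mu> B"

lemma compensated_measurable: "B \<in> bb \<Longrightarrow> compensated B \<in> borel_measurable M"
  by (intro borel_measurable_diff Lambda_measurable borel_measurable_const)

lemma chf_compensated:
  assumes "B \<in> bb"
  shows "chf M (compensated B) u = exp (of_real (measure \<mu> B) * jump_exponent u)"
proof -
  let ?c = "gamma_zero \<gamma> \<nu> * measure \<mu> B"
  have "chf M (compensated B) u = (CLINT \<omega>|M. iexp (- u * ?c) * iexp (u * \<Lambda> B \<omega>))"
    unfolding chf_def by (simp add: algebra_simps flip: exp_add)
  also have "\<dots> = iexp (- u * ?c) * chf M (\<Lambda> B) u" unfolding chf_def by (rule integral_mult_right_zero)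
  also have "\<dots> = exp (of_real (measure \<mu> B) * jump_exponent u)"
    unfolding chf_Lambda[OF assms] exp_add[symmetric] levy_exponent_eq_jump_exponent by (simp add: algebra_simps)
  finally show ?thesis .
qed

lemma first_moment_compensated_small:
  assumes B: "B \<in> bb" and small: "\<And>t. 0 < t \<Longrightarrow> t \<le> \<delta> \<Longrightarrow> phase_error t \<le> \<eta>" and le: "measure \<mu> B \<le> \<delta>"
  shows "cos_const * (\<integral>\<^sup>+\<omega>. ennreal \<bar>compensated B \<omega>\<bar> \<partial>M) \<le> ennreal (measure \<mu> B) * (cos_const * ennreal mean_jump + \<eta>)"
proof (cases "measure \<mu> B = 0")
  case True
  have "AE \<omega> in M. compensated B \<omega> = 0"
  proof (rule chf_eq_1_imp_AE_0[OF compensated_measurable[OF B]])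
    show "chf M (compensated B) u = 1" for u by (subst chf_compensated[OF B]) (simp add: True)
  qed
  then have "(\<integral>\<^sup>+\<omega>. ennreal \<bar>compensated B \<omega>\<bar> \<partial>M) = (\<integral>\<^sup>+\<omega>. 0 \<partial>M)"
    by (intro nn_integral_cong_AE) (auto elim!: eventually_mono)
  then show ?thesis by simp
next
  case False
  then have t: "0 < measure \<mu> B" by (simp add: zero_less_measure_iff)
  have "cos_const * (\<integral>\<^sup>+\<omega>. ennreal \<bar>compensated B \<omega>\<bar> \<partial>M) \<le> ennreal (measure \<mu> B) * (cos_const * ennreal mean_jump + phase_error (measure \<mu> B))"
    by (rule first_moment_small_time[OF prob_space_axioms compensated_measurable[OF B] t chf_compensated[OF B]])
  also have "\<dots> \<le> ennreal (measure \<mu> B) * (cos_const * ennreal mean_jump + \<eta>)"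
    by (intro mult_left_mono add_left_mono small t le) simp
  finally show ?thesis .
qed

lemma first_moment_compensated_Un:
  assumes B: "A \<in> bb" "B \<in> bb" "A \<inter> B = {}"
    and le: "cos_const * (\<integral>\<^sup>+\<omega>. ennreal \<bar>compensated A \<omega>\<bar> \<partial>M) \<le> ennreal (measure \<mu> A) * K"
      "cos_const * (\<integral>\<^sup>+\<omega>. ennreal \<bar>compensated B \<omega>\<bar> \<partial>M) \<le> ennreal (measure \<mu> B) * K"
  shows "cos_const * (\<integral>\<^sup>+\<omega>. ennreal \<bar>compensated (A \<union> B) \<omega>\<bar> \<partial>M) \<le> ennreal (measure \<mu> (A \<union> B)) * K"
proof -
  have m: "measure \<mu> (A \<union> B) = measure \<mu> A + measure \<mu> B"
    using B emeasure_bb_finite[OF B(1)] emeasure_bb_finite[OF B(2)] bb_borel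
    by (intro measure_Union) (simp_all only: sets_mu infinity_ennreal_def less_top)
  have [measurable]: "compensated A \<in> borel_measurable M" "compensated B \<in> borel_measurable M"
    using B compensated_measurable by blast+
  have "(\<integral>\<^sup>+\<omega>. ennreal \<bar>compensated (A \<union> B) \<omega>\<bar> \<partial>M) \<le> (\<integral>\<^sup>+\<omega>. ennreal \<bar>compensated A \<omega>\<bar> + ennreal \<bar>compensated B \<omega>\<bar> \<partial>M)"
  proof (rule nn_integral_mono_AE)
    show "AE \<omega> in M. ennreal \<bar>compensated (A \<union> B) \<omega>\<bar> \<le> ennreal \<bar>compensated A \<omega>\<bar> + ennreal \<bar>compensated B \<omega>\<bar>"
      using Lambda_Un[OF B]
    proof eventually_elim
      case (elim \<omega>)
      have "\<bar>compensated (A \<union> B) \<omega>\<bar> \<le> \<bar>compensated A \<omega>\<bar> + \<bar>compensated B \<omega>\<bar>"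
        unfolding elim m distrib_left by linarith
      from ennreal_leI[OF this] show ?case by (simp only: ennreal_plus abs_ge_zero)
    qed
  qed
  also have "\<dots> = (\<integral>\<^sup>+\<omega>. ennreal \<bar>compensated A \<omega>\<bar> \<partial>M) + (\<integral>\<^sup>+\<omega>. ennreal \<bar>compensated B \<omega>\<bar> \<partial>M)"
    by (rule nn_integral_add) measurable
  finally have "cos_const * (\<integral>\<^sup>+\<omega>. ennreal \<bar>compensated (A \<union> B) \<omega>\<bar> \<partial>M) \<le>
      cos_const * (\<integral>\<^sup>+\<omega>. ennreal \<bar>compensated A \<omega>\<bar> \<partial>M) + cos_const * (\<integral>\<^sup>+\<omega>. ennreal \<bar>compensated B \<omega>\<bar> \<partial>M)"
    unfolding distrib_left[symmetric] by (intro mult_left_mono) auto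
  also have "\<dots> \<le> ennreal (measure \<mu> A) * K + ennreal (measure \<mu> B) * K" by (intro add_mono le)
  also have "\<dots> = ennreal (measure \<mu> (A \<union> B)) * K" unfolding m by (simp add: distrib_right)
  finally show ?thesis .
qed

text \<open>
  Cut \<open>B\<close> by hyperplanes of constant time into pieces of small measure. The small time estimate holds on
  every piece, with an error proportional to the measure of the piece, and the triangle inequality adds them up.
\<close>
lemma first_moment_compensated:
  assumes B: "B \<in> bb"
  shows "(\<integral>\<^sup>+\<omega>. ennreal \<bar>compensated B \<omega>\<bar> \<partial>M) \<le> ennreal (measure \<mu> B * mean_jump)"
proof -
  have *: "cos_const * (\<integral>\<^sup>+\<omega>. ennreal \<bar>compensated B \<omega>\<bar> \<partial>M) \<le> ennreal (measure \<mu> B) * (cos_const * ennreal mean_jump + ennreal \<eta>)"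
    if \<eta>: "0 < \<eta>" for \<eta>
  proof -
    obtain \<delta> where \<delta>: "\<delta> > 0" "\<And>t. 0 < t \<Longrightarrow> t \<le> \<delta> \<Longrightarrow> phase_error t \<le> ennreal \<eta>"
      using phase_error_small[of "ennreal \<eta>"] \<eta> by auto
    have "bounded B" using B by (simp add: bounded_borel_sets_def)
    then obtain R where R: "R > 0" "\<And>z. z \<in> B \<Longrightarrow> norm z < R" by (auto simp: bounded_pos_less)
    define vol where "vol = measure lborel (cball 0 R :: (real ^ 'm) set)"
    obtain n :: nat where n: "2 * R * vol / \<delta> < real n" "0 < n"
      using reals_Archimedean2 by (metis gr0I not_less0 of_nat_0 divide_nonneg_pos mult_nonneg_nonneg R(1) \<delta>(1) less_imp_le measure_nonneg not_less vol_def zero_le_numeral)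
    define w where "w = 2 * R / real n"
    have w: "0 < w" using R n by (simp add: w_def)
    define slab where "slab a = {z :: real \<times> real \<times> (real ^ 'm). fst (snd z) \<le> a}" for a
    have slab: "slab a \<in> sets borel" for a
      unfolding slab_def by (intro borel_closed closed_Collect_le continuous_intros)
    define K where "K = cos_const * ennreal mean_jump + ennreal \<eta>"
    \<comment> \<open>The projection to the time axis makes \<open>\<mu>\<close> a product with Lebesgue measure, so thin slabs have small measure.\<close>
    have thin: "measure \<mu> (B \<inter> slab (a + w) - slab a) \<le> \<delta>" for a
    proof -
      let ?T = "(UNIV :: real set) \<times> ({a<..a + w} \<times> (cball 0 R :: (real ^ 'm) set))"
      have fin: "emeasure lborel (cball 0 R :: (real ^ 'm) set) = ennreal vol"
        unfolding vol_def by (intro emeasure_eq_ennreal_measure) (use emeasure_bounded_finite[of "cball 0 R :: (real ^ 'm) set"] in auto)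
      have "{a<..a + w} \<times> (cball 0 R :: (real ^ 'm) set) \<in> sets (borel \<Otimes>\<^sub>M borel)"
        by (intro pair_measureI) auto
      then have box: "{a<..a + w} \<times> (cball 0 R :: (real ^ 'm) set) \<in> sets borel" unfolding borel_prod .
      have "B \<inter> slab (a + w) - slab a \<subseteq> ?T"
      proof
        fix z assume z: "z \<in> B \<inter> slab (a + w) - slab a"
        have "norm (snd (snd z)) \<le> norm z"
          by (metis norm_snd_le order_trans prod.collapse)
        then have "norm (snd (snd z)) \<le> R" using R(2)[of z] z by auto
        then have "snd (snd z) \<in> cball 0 R" by simp
        moreover have "fst (snd z) \<in> {a<..a + w}" using z by (auto simp: slab_def)
        ultimately have "(fst z, fst (snd z), snd (snd z)) \<in> ?T" by blast
        then show "z \<in> ?T" by (simp only: prod.collapse)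
      qed
      then have "emeasure \<mu> (B \<inter> slab (a + w) - slab a) \<le> emeasure \<mu> ?T"
        by (rule emeasure_mono) (use box in \<open>auto intro!: pair_measureI\<close>)
      also have "\<dots> = emeasure \<pi> UNIV * emeasure lborel ({a<..a + w} \<times> (cball 0 R :: (real ^ 'm) set))"
        by (rule emeasure_mu_Times[OF _ box]) simp
      also have "emeasure \<pi> UNIV = 1" using Pi.emeasure_space_1 sets_eq_imp_space_eq[OF sets_pi] by simp
      also have "emeasure lborel ({a<..a + w} \<times> (cball 0 R :: (real ^ 'm) set)) =
          emeasure (lborel \<Otimes>\<^sub>M lborel) ({a<..a + w} \<times> (cball 0 R :: (real ^ 'm) set))"
        by (simp only: lborel_prod)
      also have "\<dots> = emeasure lborel {a<..a + w} * emeasure lborel (cball 0 R :: (real ^ 'm) set)"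
        by (rule lborel.emeasure_pair_measure_Times) auto
      also have "\<dots> = ennreal (w * vol)" using w unfolding fin by (simp add: ennreal_mult' vol_def)
      finally have "emeasure \<mu> (B \<inter> slab (a + w) - slab a) \<le> ennreal (w * vol)" by simp
      then have "measure \<mu> (B \<inter> slab (a + w) - slab a) \<le> w * vol"
        unfolding measure_def using w by (intro enn2real_leI) (auto simp: vol_def)
      also have "\<dots> \<le> \<delta>" using n \<delta>(1) by (simp add: w_def field_simps)
      finally show ?thesis .
    qed
    have "cos_const * (\<integral>\<^sup>+\<omega>. ennreal \<bar>compensated (B \<inter> slab (- R + real i * w)) \<omega>\<bar> \<partial>M) \<le>
        ennreal (measure \<mu> (B \<inter> slab (- R + real i * w))) * K" for i
    proof (induction i)
      case 0
      have "z \<notin> slab (- R)" if "z \<in> B" for z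
      proof -
        have "\<bar>fst (snd z)\<bar> \<le> norm z"
          by (metis norm_fst_le norm_snd_le order_trans prod.collapse real_norm_def)
        then show ?thesis using R(2)[OF that] by (auto simp: slab_def)
      qed
      then have e: "B \<inter> slab (- R + real 0 * w) = {}" by auto
      show ?case unfolding e
        by (rule first_moment_compensated_small[OF bb_empty \<delta>(2), folded K_def]) (use \<delta>(1) in auto)
    next
      case (Suc i)
      let ?a = "- R + real i * w"
      have Suc_eq: "- R + real (Suc i) * w = ?a + w" by (simp add: algebra_simps)
      have bb1: "B \<inter> slab ?a \<in> bb" by (rule bb_subset[OF B]) (use bb_borel[OF B] slab in blast)+
      have bb2: "B \<inter> slab (?a + w) - slab ?a \<in> bb" by (rule bb_subset[OF B]) (use bb_borel[OF B] slab in blast)+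
      have "slab ?a \<subseteq> slab (?a + w)" using w by (auto simp: slab_def)
      then have U: "B \<inter> slab (?a + w) = B \<inter> slab ?a \<union> (B \<inter> slab (?a + w) - slab ?a)" by blast
      have "cos_const * (\<integral>\<^sup>+\<omega>. ennreal \<bar>compensated (B \<inter> slab ?a \<union> (B \<inter> slab (?a + w) - slab ?a)) \<omega>\<bar> \<partial>M) \<le>
          ennreal (measure \<mu> (B \<inter> slab ?a \<union> (B \<inter> slab (?a + w) - slab ?a))) * K"
        using first_moment_compensated_small[OF bb2 \<delta>(2) thin, folded K_def]
        by (intro first_moment_compensated_Un bb1 bb2 Suc.IH) auto
      then show ?case unfolding Suc_eq U[symmetric] .
    qed
    note this[of n]
    moreover have "B \<inter> slab (- R + real n * w) = B"
    proof -
      have "- R + real n * w = R" using n by (simp add: w_def)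
      moreover have "z \<in> slab R" if "z \<in> B" for z
      proof -
        have "\<bar>fst (snd z)\<bar> \<le> norm z"
          by (metis norm_fst_le norm_snd_le order_trans prod.collapse real_norm_def)
        then show ?thesis using R(2)[OF that] by (auto simp: slab_def)
      qed
      ultimately show ?thesis by auto
    qed
    ultimately show ?thesis by (simp add: K_def)
  qed
  have "cos_const * (\<integral>\<^sup>+\<omega>. ennreal \<bar>compensated B \<omega>\<bar> \<partial>M) \<le> cos_const * ennreal (measure \<mu> B * mean_jump)"
  proof (rule ennreal_le_epsilon)
    fix e :: real assume e: "0 < e"
    define \<eta> where "\<eta> = e / (measure \<mu> B + 1)"
    have m: "0 < measure \<mu> B + 1" by (simp add: add_nonneg_pos)
    have \<eta>: "0 < \<eta>" "measure \<mu> B * \<eta> \<le> e" using e m by (auto simp: \<eta>_def field_simps)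
    have "cos_const * (\<integral>\<^sup>+\<omega>. ennreal \<bar>compensated B \<omega>\<bar> \<partial>M) \<le> ennreal (measure \<mu> B) * (cos_const * ennreal mean_jump + ennreal \<eta>)"
      by (rule *[OF \<eta>(1)])
    also have "\<dots> = cos_const * ennreal (measure \<mu> B * mean_jump) + ennreal (measure \<mu> B * \<eta>)"
      using mean_jump_nonneg \<eta>(1) by (simp add: distrib_left ennreal_mult mult_ac)
    also have "\<dots> \<le> cos_const * ennreal (measure \<mu> B * mean_jump) + ennreal e"
      using \<eta>(2) by (intro add_left_mono ennreal_leI)
    finally show "cos_const * (\<integral>\<^sup>+\<omega>. ennreal \<bar>compensated B \<omega>\<bar> \<partial>M) \<le> cos_const * ennreal (measure \<mu> B * mean_jump) + ennreal e" .
  qed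
  then show ?thesis using cos_const_pos cos_const_finite by (subst (asm) ennreal_mult_le_mult_iff) auto
qed

lemma first_moment_Lambda:
  assumes B: "B \<in> bb"
  shows "(\<integral>\<^sup>+\<omega>. ennreal \<bar>\<Lambda> B \<omega>\<bar> \<partial>M) \<le> ennreal (gamma_abs \<gamma> \<nu> * measure \<mu> B)"
proof -
  note [measurable] = compensated_measurable[OF B]
  let ?c = "gamma_zero \<gamma> \<nu> * measure \<mu> B"
  have "(\<integral>\<^sup>+\<omega>. ennreal \<bar>\<Lambda> B \<omega>\<bar> \<partial>M) \<le> (\<integral>\<^sup>+\<omega>. ennreal \<bar>compensated B \<omega>\<bar> + ennreal \<bar>?c\<bar> \<partial>M)"
  proof (rule nn_integral_mono)
    fix \<omega>
    have "\<bar>\<Lambda> B \<omega>\<bar> \<le> \<bar>compensated B \<omega>\<bar> + \<bar>?c\<bar>" by linarith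
    from ennreal_leI[OF this] show "ennreal \<bar>\<Lambda> B \<omega>\<bar> \<le> ennreal \<bar>compensated B \<omega>\<bar> + ennreal \<bar>?c\<bar>"
      by (simp only: ennreal_plus abs_ge_zero)
  qed
  also have "\<dots> = (\<integral>\<^sup>+\<omega>. ennreal \<bar>compensated B \<omega>\<bar> \<partial>M) + ennreal \<bar>?c\<bar>"
    by (subst nn_integral_add) (auto simp: emeasure_space_1)
  also have "\<dots> \<le> ennreal (measure \<mu> B * mean_jump) + ennreal \<bar>?c\<bar>"
    by (intro add_right_mono first_moment_compensated B)
  also have "\<dots> = ennreal (measure \<mu> B * mean_jump + \<bar>?c\<bar>)"
    using mean_jump_nonneg by (subst ennreal_plus) auto
  also have "measure \<mu> B * mean_jump + \<bar>?c\<bar> = gamma_abs \<gamma> \<nu> * measure \<mu> B"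
    by (simp add: gamma_abs_def abs_mult algebra_simps)
  finally show ?thesis .
qed

lemma gamma_abs_nonneg: "0 \<le> gamma_abs \<gamma> \<nu>"
  unfolding gamma_abs_def using mean_jump_nonneg by simp

lemma first_moment_sli:
  assumes \<phi>: "levy_simple \<phi>" and A: "A \<in> sets borel"
  shows "(\<integral>\<^sup>+\<omega>. ennreal \<bar>sli A \<phi> \<omega>\<bar> \<partial>M) \<le> ennreal (gamma_abs \<gamma> \<nu> * (LINT z:A|\<mu>. \<bar>\<phi> z\<bar>))"
proof -
  let ?I = "range \<phi> - {0}"
  let ?B = "\<lambda>y. A \<inter> \<phi> -` {y}"
  have bb: "?B y \<in> bb" if "y \<in> ?I" for y using that by (intro level_set_bb[OF \<phi> A]) blast
  have "(\<integral>\<^sup>+\<omega>. ennreal \<bar>sli A \<phi> \<omega>\<bar> \<partial>M) \<le> (\<integral>\<^sup>+\<omega>. (\<Sum>y\<in>?I. ennreal \<bar>y\<bar> * ennreal \<bar>\<Lambda> (?B y) \<omega>\<bar>) \<partial>M)"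
  proof (rule nn_integral_mono)
    fix \<omega>
    have "\<bar>sli A \<phi> \<omega>\<bar> \<le> (\<Sum>y\<in>?I. \<bar>y * \<Lambda> (?B y) \<omega>\<bar>)" unfolding simple_levy_integral_def by (rule sum_abs)
    then have "ennreal \<bar>sli A \<phi> \<omega>\<bar> \<le> ennreal (\<Sum>y\<in>?I. \<bar>y\<bar> * \<bar>\<Lambda> (?B y) \<omega>\<bar>)" by (simp add: abs_mult ennreal_leI)
    also have "\<dots> = (\<Sum>y\<in>?I. ennreal \<bar>y\<bar> * ennreal \<bar>\<Lambda> (?B y) \<omega>\<bar>)"
      by (subst sum_ennreal[symmetric]) (auto simp: ennreal_mult)
    finally show "ennreal \<bar>sli A \<phi> \<omega>\<bar> \<le> (\<Sum>y\<in>?I. ennreal \<bar>y\<bar> * ennreal \<bar>\<Lambda> (?B y) \<omega>\<bar>)" .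
  qed
  also have "\<dots> = (\<Sum>y\<in>?I. \<integral>\<^sup>+\<omega>. ennreal \<bar>y\<bar> * ennreal \<bar>\<Lambda> (?B y) \<omega>\<bar> \<partial>M)"
    using Lambda_measurable[OF bb] by (intro nn_integral_sum) (measurable, simp)
  also have "\<dots> = (\<Sum>y\<in>?I. ennreal \<bar>y\<bar> * (\<integral>\<^sup>+\<omega>. ennreal \<bar>\<Lambda> (?B y) \<omega>\<bar> \<partial>M))"
  proof (intro sum.cong refl)
    fix y assume "y \<in> ?I"
    note [measurable] = Lambda_measurable[OF bb[OF this]]
    show "(\<integral>\<^sup>+\<omega>. ennreal \<bar>y\<bar> * ennreal \<bar>\<Lambda> (?B y) \<omega>\<bar> \<partial>M) = ennreal \<bar>y\<bar> * (\<integral>\<^sup>+\<omega>. ennreal \<bar>\<Lambda> (?B y) \<omega>\<bar> \<partial>M)"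
      by (rule nn_integral_cmult) measurable
  qed
  also have "\<dots> \<le> (\<Sum>y\<in>?I. ennreal \<bar>y\<bar> * ennreal (gamma_abs \<gamma> \<nu> * measure \<mu> (?B y)))"
    by (intro sum_mono mult_left_mono first_moment_Lambda bb) auto
  also have "\<dots> = ennreal (\<Sum>y\<in>?I. \<bar>y\<bar> * (gamma_abs \<gamma> \<nu> * measure \<mu> (?B y)))"
    using gamma_abs_nonneg by (subst sum_ennreal[symmetric]) (auto simp: ennreal_mult)
  also have "(\<Sum>y\<in>?I. \<bar>y\<bar> * (gamma_abs \<gamma> \<nu> * measure \<mu> (?B y))) = gamma_abs \<gamma> \<nu> * (LINT z:A|\<mu>. \<bar>\<phi> z\<bar>)"
    unfolding levy_simple_comp_integral(2)[of \<phi> A abs, OF \<phi> A abs_zero]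
    by (simp add: sum_distrib_left mult_ac)
  finally show ?thesis .
qed

text \<open>
  Unlike the given sequence, this one is dominated by a multiple of \<open>g\<close>, with factor two.
\<close>
lemma (in levy_basis_space) levy_simple_approximation:
  fixes g :: "real \<times> real \<times> (real ^ 'm) \<Rightarrow> real"
  assumes [measurable]: "g \<in> borel_measurable borel"
  obtains s where "\<And>k::nat. levy_simple (s k)" "\<And>k z. \<bar>s k z\<bar> \<le> 2 * \<bar>g z\<bar>"
    "\<And>z. z \<in> levy_space \<Longrightarrow> (\<lambda>k. s k z) \<longlonglongrightarrow> g z"
proof -
  obtain F where F: "\<And>i. simple_function borel (F i)" "\<And>z. (\<lambda>i. F i z) \<longlonglongrightarrow> g z" "\<And>i z. dist (F i z) 0 \<le> 2 * dist (g z) 0"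
    using borel_measurable_implies_sequence_metric[OF assms, of 0] by auto
  define D where "D k = levy_space \<inter> (cball 0 (real k) :: (real \<times> real \<times> (real ^ 'm)) set)" for k :: nat
  have D: "D k \<in> sets borel" for k unfolding D_def by (intro sets.Int levy_space_borel borel_closed closed_cball)
  define s where "s k z = indicator (D k) z * F k z" for k z
  show ?thesis
  proof (rule that)
    fix k
    have [measurable]: "F k \<in> borel_measurable borel" using F(1) by (rule borel_measurable_simple_function)
    note [measurable] = D
    have m: "s k \<in> borel_measurable borel" unfolding s_def by measurable
    have "range (s k) \<subseteq> insert 0 (range (F k))" by (auto simp: s_def indicator_def)
    moreover have "finite (range (F k))" using F(1)[of k] by (simp add: simple_function_def)
    ultimately have fin: "finite (range (s k))" by (meson finite_insert finite_subset)
    have "{z \<in> space borel. s k z \<noteq> 0} \<in> sets borel" using m by measurable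
    then have b: "{z. s k z \<noteq> 0} \<in> sets borel" by simp
    have "{z. s k z \<noteq> 0} \<subseteq> D k" by (auto simp: s_def indicator_def)
    then have "{z. s k z \<noteq> 0} \<subseteq> levy_space" "bounded {z. s k z \<noteq> 0}"
      unfolding D_def by (blast, meson Int_lower2 bounded_cball bounded_subset)
    then show "levy_simple (s k)" using m fin b unfolding levy_simple_def bounded_borel_sets_def by blast
  next
    fix k z
    show "\<bar>s k z\<bar> \<le> 2 * \<bar>g z\<bar>" using F(3)[of k z] by (auto simp: s_def indicator_def)
  next
    fix z :: "real \<times> real \<times> (real ^ 'm)" assume z: "z \<in> levy_space"
    obtain n where n: "norm z \<le> real n" using real_arch_simple by blast
    have "s k z = F k z" if "k \<ge> n" for k
    proof -
      have "norm z \<le> real k" using n that by (meson of_nat_mono order_trans)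
      then show ?thesis using z by (simp add: s_def D_def)
    qed
    then have "\<forall>\<^sub>F k in sequentially. F k z = s k z" unfolding eventually_sequentially by (intro exI[of _ n]) simp
    with F(2)[of z] show "(\<lambda>k. s k z) \<longlonglongrightarrow> g z" by (rule Lim_transform_eventually)
  qed
qed

text \<open>
  Along the dominated sequence the integrals of simple functions converge in law to \<open>levy_limit \<phi> A\<close>. Fatou's lemma in the variable
  \<open>u\<close> of \<open>first_moment_chf\<close> shows that the first moment is lower semicontinuous.
\<close>
lemma first_moment_levy_limit:
  assumes \<phi>: "levy_approx \<phi> g" and A: "A \<in> sets borel" and int: "set_integrable \<mu> A g"
  shows "integrable M (levy_limit \<phi> A)"
    "(LINT \<omega>|M. \<bar>levy_limit \<phi> A \<omega>\<bar>) \<le> gamma_abs \<gamma> \<nu> * (LINT z:A|\<mu>. \<bar>g z\<bar>)"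
proof -
  have [measurable]: "g \<in> borel_measurable borel" by (rule levy_approx_measurable[OF \<phi>])
  obtain s where s: "\<And>k. levy_simple (s k)" "\<And>k z. \<bar>s k z\<bar> \<le> 2 * \<bar>g z\<bar>"
    "\<And>z. z \<in> levy_space \<Longrightarrow> (\<lambda>k. s k z) \<longlonglongrightarrow> g z" using levy_simple_approximation[of g] by (metis \<open>g \<in> borel_measurable borel\<close>)
  note [measurable] = levy_simple_measurable[OF s(1)] A
  let ?L = "levy_limit \<phi> A"
  note L[measurable] = levy_limit(1)[OF \<phi> A]
  have iabs: "integrable \<mu> (\<lambda>z. c * (indicator A z * \<bar>g z\<bar>))" for c
    using integrable_abs[OF int[unfolded set_integrable_def]] by (intro integrable_mult_right) (simp add: abs_mult)
  have le: "norm (indicator A z *\<^sub>R \<Phi> (u * h)) \<le> gamma_abs \<gamma> \<nu> * \<bar>u\<bar> * 2 * (indicator A z * \<bar>g z\<bar>)"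
    if "\<bar>h\<bar> \<le> 2 * \<bar>g z\<bar>" for u z h
  proof (cases "z \<in> A")
    case True
    have "norm (\<Phi> (u * h)) \<le> gamma_abs \<gamma> \<nu> * \<bar>u * h\<bar>" by (rule norm_levy_exponent_le_linear)
    also have "\<dots> \<le> gamma_abs \<gamma> \<nu> * (\<bar>u\<bar> * (2 * \<bar>g z\<bar>))"
      unfolding abs_mult using that gamma_abs_nonneg by (intro mult_left_mono) auto
    finally show ?thesis using True by (simp add: mult_ac)
  qed simp
  have ii: "set_integrable \<mu> A (\<lambda>z. \<Phi> (u * g z))" for u
    unfolding set_integrable_def
  proof (rule Bochner_Integration.integrable_bound[OF iabs])
    show "(\<lambda>z. indicator A z *\<^sub>R \<Phi> (u * g z)) \<in> borel_measurable \<mu>" unfolding measurable_mu_iff by measurable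
    show "AE z in \<mu>. norm (indicator A z *\<^sub>R \<Phi> (u * g z)) \<le> norm (gamma_abs \<gamma> \<nu> * \<bar>u\<bar> * 2 * (indicator A z * \<bar>g z\<bar>))"
      by (rule AE_I2, rule order_trans[OF le]) auto
  qed
  have chf: "(\<lambda>k. chf M (sli A (s k)) u) \<longlonglongrightarrow> chf M ?L u" for u
  proof -
    have "(\<lambda>k. CLINT z:A|\<mu>. \<Phi> (u * s k z)) \<longlonglongrightarrow> (CLINT z:A|\<mu>. \<Phi> (u * g z))"
      unfolding set_lebesgue_integral_def
    proof (rule integral_dominated_convergence[where w="\<lambda>z. gamma_abs \<gamma> \<nu> * \<bar>u\<bar> * 2 * (indicator A z * \<bar>g z\<bar>)"])
      show "AE z in \<mu>. norm (indicator A z *\<^sub>R \<Phi> (u * s k z)) \<le> gamma_abs \<gamma> \<nu> * \<bar>u\<bar> * 2 * (indicator A z * \<bar>g z\<bar>)" for k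
        by (rule AE_I2, rule le, rule s(2))
      show "AE z in \<mu>. (\<lambda>k. indicator A z *\<^sub>R \<Phi> (u * s k z)) \<longlonglongrightarrow> indicator A z *\<^sub>R \<Phi> (u * g z)"
        using AE_levy_space by eventually_elim (intro tendsto_intros isCont_tendsto_compose[OF isCont_levy_exponent] s(3))
      show "(\<lambda>z. indicator A z *\<^sub>R \<Phi> (u * g z)) \<in> borel_measurable \<mu>"
        "(\<lambda>z. indicator A z *\<^sub>R \<Phi> (u * s k z)) \<in> borel_measurable \<mu>" for k
        unfolding measurable_mu_iff by measurable
    qed (rule iabs)
    then show ?thesis unfolding chf_sli[OF s(1) A] chf_levy_limit[OF \<phi> A ii] by (rule tendsto_exp)
  qed
  define J where "J = (LINT z:A|\<mu>. \<bar>g z\<bar>)"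
  have J0: "0 \<le> J" unfolding J_def set_lebesgue_integral_def by (intro integral_nonneg_AE) auto
  have Jk: "(\<lambda>k. LINT z:A|\<mu>. \<bar>s k z\<bar>) \<longlonglongrightarrow> J"
    unfolding set_lebesgue_integral_def J_def
  proof (rule integral_dominated_convergence[where w="\<lambda>z. 2 * (indicator A z * \<bar>g z\<bar>)"])
    show "AE z in \<mu>. (\<lambda>k. indicator A z *\<^sub>R \<bar>s k z\<bar>) \<longlonglongrightarrow> indicator A z *\<^sub>R \<bar>g z\<bar>"
      using AE_levy_space by eventually_elim (intro tendsto_intros s(3))
    show "AE z in \<mu>. norm (indicator A z *\<^sub>R \<bar>s k z\<bar>) \<le> 2 * (indicator A z * \<bar>g z\<bar>)" for k
    proof (rule AE_I2)
      fix z show "norm (indicator A z *\<^sub>R \<bar>s k z\<bar>) \<le> 2 * (indicator A z * \<bar>g z\<bar>)"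
        using s(2)[of k z] by (cases "z \<in> A") auto
    qed
    show "(\<lambda>z. indicator A z *\<^sub>R \<bar>g z\<bar>) \<in> borel_measurable \<mu>"
      "(\<lambda>z. indicator A z *\<^sub>R \<bar>s k z\<bar>) \<in> borel_measurable \<mu>" for k
      unfolding measurable_mu_iff by measurable
  qed (rule iabs)
  have [measurable]: "chf M X \<in> borel_measurable borel" if "X \<in> borel_measurable M" for X
    using isCont_chf[OF that] by (intro borel_measurable_continuous_onI continuous_at_imp_continuous_on) auto
  note sm[measurable] = sli_measurable[OF s(1) A]
  have "cos_const * (\<integral>\<^sup>+\<omega>. ennreal \<bar>?L \<omega>\<bar> \<partial>M) = (\<integral>\<^sup>+u. ennreal ((1 - Re (chf M ?L u)) / u\<^sup>2) \<partial>lborel)"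
    by (rule first_moment_chf[OF L])
  also have "\<dots> = (\<integral>\<^sup>+u. liminf (\<lambda>k. ennreal ((1 - Re (chf M (sli A (s k)) u)) / u\<^sup>2)) \<partial>lborel)"
  proof (rule nn_integral_cong)
    fix u :: real
    have "(\<lambda>k. (1 - Re (chf M (sli A (s k)) u)) / u\<^sup>2) \<longlonglongrightarrow> (1 - Re (chf M ?L u)) / u\<^sup>2"
      unfolding divide_inverse by (intro tendsto_intros chf)
    then have "(\<lambda>k. ennreal ((1 - Re (chf M (sli A (s k)) u)) / u\<^sup>2)) \<longlonglongrightarrow> ennreal ((1 - Re (chf M ?L u)) / u\<^sup>2)"
      by (rule tendsto_ennrealI)
    then show "ennreal ((1 - Re (chf M ?L u)) / u\<^sup>2) = liminf (\<lambda>k. ennreal ((1 - Re (chf M (sli A (s k)) u)) / u\<^sup>2))"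
      by (rule lim_imp_Liminf[OF sequentially_bot, symmetric])
  qed
  also have "\<dots> \<le> liminf (\<lambda>k. \<integral>\<^sup>+u. ennreal ((1 - Re (chf M (sli A (s k)) u)) / u\<^sup>2) \<partial>lborel)"
    by (rule nn_integral_liminf) measurable
  also have "\<dots> \<le> liminf (\<lambda>k. cos_const * ennreal (gamma_abs \<gamma> \<nu> * (LINT z:A|\<mu>. \<bar>s k z\<bar>)))"
    unfolding first_moment_chf[OF sm, symmetric]
    by (intro Liminf_mono always_eventually allI mult_left_mono first_moment_sli s(1) A) auto
  also have "\<dots> = cos_const * ennreal (gamma_abs \<gamma> \<nu> * J)"
  proof (rule lim_imp_Liminf[OF sequentially_bot])
    have "(\<lambda>k. ennreal (gamma_abs \<gamma> \<nu> * (LINT z:A|\<mu>. \<bar>s k z\<bar>))) \<longlonglongrightarrow> ennreal (gamma_abs \<gamma> \<nu> * J)"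
      by (intro tendsto_ennrealI tendsto_mult tendsto_const Jk)
    then show "(\<lambda>k. cos_const * ennreal (gamma_abs \<gamma> \<nu> * (LINT z:A|\<mu>. \<bar>s k z\<bar>))) \<longlonglongrightarrow> cos_const * ennreal (gamma_abs \<gamma> \<nu> * J)"
      by (rule ennreal_tendsto_cmult[OF cos_const_finite[unfolded infinity_ennreal_def]])
  qed
  finally have *: "(\<integral>\<^sup>+\<omega>. ennreal \<bar>?L \<omega>\<bar> \<partial>M) \<le> ennreal (gamma_abs \<gamma> \<nu> * J)"
    using cos_const_pos cos_const_finite by (subst (asm) ennreal_mult_le_mult_iff) auto
  then have fin: "(\<integral>\<^sup>+\<omega>. ennreal \<bar>?L \<omega>\<bar> \<partial>M) < \<infinity>" by (rule order_le_less_trans) simp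
  show i: "integrable M ?L" by (rule integrableI_bounded) (use fin in auto)
  have "ennreal (LINT \<omega>|M. \<bar>?L \<omega>\<bar>) \<le> ennreal (gamma_abs \<gamma> \<nu> * J)"
    using * i by (subst nn_integral_eq_integral[symmetric]) auto
  then show "(LINT \<omega>|M. \<bar>?L \<omega>\<bar>) \<le> gamma_abs \<gamma> \<nu> * (LINT z:A|\<mu>. \<bar>g z\<bar>)"
    using J0 gamma_abs_nonneg by (simp add: J_def[symmetric] ennreal_le_iff)
qed

end

section \<open>Independence of integrals over disjoint sets\<close>

lemma tendsto_funI:
  fixes x :: "'b \<Rightarrow> 'i \<Rightarrow> 'a::topological_space"
  assumes "\<And>i. ((\<lambda>n. x n i) \<longlongrightarrow> l i) F" shows "(x \<longlongrightarrow> l) F"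
proof -
  have "limitin (product_topology (\<lambda>i. euclidean) UNIV) x l F"
    unfolding limitin_componentwise using assms by simp
  then show ?thesis by (simp add: euclidean_product_topology)
qed

context levy_basis_space
begin

text \<open>
  Independence holds for the approximating simple integrals. A common almost surely convergent subsequence passes it on to the
  limits for continuous test functions. Vectors are extended by zero to elements of \<open>nat \<Rightarrow> real\<close>, a metric space whose Borel
  sets are those of the product space.
\<close>
lemma levy_limit_indep:
  fixes \<phi> :: "nat \<Rightarrow> nat \<Rightarrow> real \<times> real \<times> (real ^ 'm) \<Rightarrow> real" and F :: "(nat \<Rightarrow> real) \<Rightarrow> real" and G :: "real \<Rightarrow> real"
  assumes \<phi>: "\<And>i. i < k \<Longrightarrow> levy_approx (\<phi> i) (gs i)" and \<phi>': "levy_approx \<phi>' g'"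
    and A: "A \<in> sets borel" "A' \<in> sets borel" "A \<inter> A' = {}"
    and F: "F \<in> borel_measurable (borel_pow k)" and bF: "\<And>v. v \<in> space (borel_pow k) \<Longrightarrow> \<bar>F v\<bar> \<le> C"
    and G: "continuous_on UNIV G" and bG: "\<And>x. \<bar>G x\<bar> \<le> C'"
  shows "(LINT \<omega>|M. F (\<lambda>i\<in>{..<k}. levy_limit (\<phi> i) A \<omega>) * G (levy_limit \<phi>' A' \<omega>)) =
    (LINT \<omega>|M. F (\<lambda>i\<in>{..<k}. levy_limit (\<phi> i) A \<omega>)) * (LINT \<omega>|M. G (levy_limit \<phi>' A' \<omega>))"
proof -
  define X where "X i n = (if i < k then sli A (\<phi> i n) else sli A' (\<phi>' n))" for i n
  define Z where "Z i = (if i < k then levy_limit (\<phi> i) A else levy_limit \<phi>' A')" for i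
  have X: "X i n \<in> borel_measurable M" for i n
    unfolding X_def using levy_approx_simple[OF \<phi>] levy_approx_simple[OF \<phi>'] A by (auto intro!: sli_measurable)
  have Z: "Z i \<in> borel_measurable M" for i
    unfolding Z_def using levy_limit(1)[OF \<phi>] levy_limit(1)[OF \<phi>'] A by auto
  have XZ: "tendsto_in_prob M (X i) (Z i)" for i
    unfolding X_def[abs_def] Z_def using levy_limit(2)[OF \<phi>] levy_limit(2)[OF \<phi>'] A by auto
  obtain r :: "nat \<Rightarrow> nat" where r: "AE \<omega> in M. \<forall>i\<in>{..k}. (\<lambda>n. X i (r n) \<omega>) \<longlonglongrightarrow> Z i \<omega>"
    using tendsto_in_prob_AE_subseq[of "{..k}" X Z] X Z XZ by auto
  define Xv where "Xv n \<omega> = (\<lambda>i. if i < k then X i (r n) \<omega> else 0)" for n \<omega>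
  define Zv where "Zv \<omega> = (\<lambda>i. if i < k then Z i \<omega> else 0)" for \<omega>
  have Xv[measurable]: "Xv n \<in> borel_measurable M" for n
  proof (rule measurable_coordinatewise_then_product)
    fix i show "(\<lambda>\<omega>. Xv n \<omega> i) \<in> borel_measurable M" unfolding Xv_def using X by (cases "i < k") auto
  qed
  have Zv[measurable]: "Zv \<in> borel_measurable M"
  proof (rule measurable_coordinatewise_then_product)
    fix i show "(\<lambda>\<omega>. Zv \<omega> i) \<in> borel_measurable M" unfolding Zv_def using Z by (cases "i < k") auto
  qed
  note [measurable] = X Z
  have Gm[measurable]: "G \<in> borel_measurable borel" using G by (rule borel_measurable_continuous_onI)
  have C': "0 \<le> C'" using bG[of 0] by simp
  have prod: "(LINT \<omega>|M. f (Zv \<omega>) * G (Z k \<omega>)) = (LINT \<omega>|M. f (Zv \<omega>)) * (LINT \<omega>|M. G (Z k \<omega>))"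
    if f: "continuous_on UNIV f" and f01: "\<And>x. f x \<in> {0..1}" for f
  proof -
    have fm[measurable]: "f \<in> borel_measurable borel" using f by (rule borel_measurable_continuous_onI)
    have bf: "\<bar>f x\<bar> \<le> 1" for x using f01[of x] by auto
    have conv: "AE \<omega> in M. (\<lambda>n. f (Xv n \<omega>)) \<longlonglongrightarrow> f (Zv \<omega>) \<and> (\<lambda>n. G (X k (r n) \<omega>)) \<longlonglongrightarrow> G (Z k \<omega>)"
      using r
    proof eventually_elim
      case (elim \<omega>)
      have "(\<lambda>n. Xv n \<omega>) \<longlonglongrightarrow> Zv \<omega>"
      proof (rule tendsto_funI)
        fix i show "(\<lambda>n. Xv n \<omega> i) \<longlonglongrightarrow> Zv \<omega> i" unfolding Xv_def Zv_def using elim by (cases "i < k") auto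
      qed
      then have "(\<lambda>n. f (Xv n \<omega>)) \<longlonglongrightarrow> f (Zv \<omega>)"
        by (intro continuous_on_tendsto_compose[OF f]) auto
      moreover have "(\<lambda>n. G (X k (r n) \<omega>)) \<longlonglongrightarrow> G (Z k \<omega>)"
        using elim by (intro continuous_on_tendsto_compose[OF G]) auto
      ultimately show ?case ..
    qed
    have 1: "(\<lambda>n. LINT \<omega>|M. f (Xv n \<omega>) * G (X k (r n) \<omega>)) \<longlonglongrightarrow> (LINT \<omega>|M. f (Zv \<omega>) * G (Z k \<omega>))"
    proof (rule integral_dominated_convergence[where w="\<lambda>_. 1 * C'"])
      show "AE \<omega> in M. (\<lambda>n. f (Xv n \<omega>) * G (X k (r n) \<omega>)) \<longlonglongrightarrow> f (Zv \<omega>) * G (Z k \<omega>)"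
        using conv by eventually_elim (intro tendsto_mult; blast)
      show "AE \<omega> in M. norm (f (Xv n \<omega>) * G (X k (r n) \<omega>)) \<le> 1 * C'" for n
        unfolding real_norm_def abs_mult by (intro AE_I2 mult_mono bf bG) auto
    qed auto
    have 2: "(\<lambda>n. LINT \<omega>|M. f (Xv n \<omega>)) \<longlonglongrightarrow> (LINT \<omega>|M. f (Zv \<omega>))"
      by (rule integral_dominated_convergence[where w="\<lambda>_. 1"]) (use conv bf in \<open>auto elim!: eventually_mono\<close>)
    have 3: "(\<lambda>n. LINT \<omega>|M. G (X k (r n) \<omega>)) \<longlonglongrightarrow> (LINT \<omega>|M. G (Z k \<omega>))"
      by (rule integral_dominated_convergence[where w="\<lambda>_. C'"]) (use conv bG in \<open>auto elim!: eventually_mono\<close>)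
    have "(LINT \<omega>|M. f (Xv n \<omega>) * G (X k (r n) \<omega>)) = (LINT \<omega>|M. f (Xv n \<omega>)) * (LINT \<omega>|M. G (X k (r n) \<omega>))" for n
    proof -
      have eq: "Xv n = (\<lambda>\<omega> i. if i < k then sli A (\<phi> i (r n)) \<omega> else 0)" "X k (r n) = sli A' (\<phi>' (r n))"
        by (auto simp: Xv_def X_def fun_eq_iff)
      show ?thesis unfolding eq
        by (rule sli_vector_indep[OF levy_approx_simple[OF \<phi>] levy_approx_simple[OF \<phi>'] A fm bf Gm bG])
    qed
    with 1 have "(\<lambda>n. (LINT \<omega>|M. f (Xv n \<omega>)) * (LINT \<omega>|M. G (X k (r n) \<omega>))) \<longlonglongrightarrow> (LINT \<omega>|M. f (Zv \<omega>) * G (Z k \<omega>))" by simp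
    from LIMSEQ_unique[OF this tendsto_mult[OF 2 3]] show ?thesis .
  qed
  define F' where "F' w = F (restrict w {..<k})" for w
  have res: "restrict w {..<k} \<in> space (borel_pow k)" for w :: "nat \<Rightarrow> real" by (simp add: space_PiM)
  have F'm: "F' \<in> borel_measurable borel"
  proof -
    have "(\<lambda>w. restrict w {..<k}) \<in> measurable (Pi\<^sub>M UNIV (\<lambda>_. borel)) (borel_pow k)"
      by (rule measurable_restrict_subset) simp
    then have "(\<lambda>w. F (restrict w {..<k})) \<in> borel_measurable (Pi\<^sub>M UNIV (\<lambda>_. borel))"
      using F by (rule measurable_compose)
    then show ?thesis
      unfolding F'_def[abs_def] by (simp only: measurable_cong_sets[OF sets_PiM_equal_borel refl])
  qed
  have "(LINT \<omega>|M. F' (Zv \<omega>) * G (Z k \<omega>)) = (LINT \<omega>|M. F' (Zv \<omega>)) * (LINT \<omega>|M. G (Z k \<omega>))"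
    by (rule product_formula_Borel[OF Zv _ F'm, of "\<lambda>\<omega>. G (Z k \<omega>)" C' C])
       (use bG bF[OF res] prod in \<open>auto simp: F'_def\<close>)
  moreover have "F' (Zv \<omega>) = F (\<lambda>i\<in>{..<k}. levy_limit (\<phi> i) A \<omega>)" for \<omega>
    unfolding F'_def Zv_def Z_def by (intro arg_cong[of _ _ F]) (auto simp: restrict_def)
  moreover have "Z k = levy_limit \<phi>' A'" by (simp add: Z_def)
  ultimately show ?thesis by simp
qed

lemma has_levy_integral_imp_levy_limit:
  assumes "has_levy_integral M \<Lambda> \<mu> g X"
  obtains \<phi> where "levy_approx \<phi> g" "AE \<omega> in M. X \<omega> = levy_limit \<phi> UNIV \<omega>"
proof -
  obtain \<phi> where \<phi>: "\<And>n. levy_simple (\<phi> n)" "AE z in \<mu>. (\<lambda>n. \<phi> n z) \<longlonglongrightarrow> g z"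
    and conv: "\<And>A. A \<in> sets borel \<Longrightarrow> A \<subseteq> levy_space \<Longrightarrow> \<exists>Z\<in>borel_measurable M. tendsto_in_prob M (\<lambda>n. sli A (\<phi> n)) Z"
    and X: "tendsto_in_prob M (\<lambda>n. sli levy_space (\<phi> n)) X" and g: "g \<in> borel_measurable borel" and Xm: "X \<in> borel_measurable M"
    using assms unfolding has_levy_integral_def by blast
  have app: "levy_approx \<phi> g"
    unfolding levy_approx_def
  proof (intro conjI allI ballI \<phi> g)
    fix A :: "(real \<times> real \<times> (real ^ 'm)) set" assume "A \<in> sets borel"
    then have "A \<inter> levy_space \<in> sets borel" by (intro sets.Int levy_space_borel)
    from conv[OF this] show "\<exists>Z\<in>borel_measurable M. tendsto_in_prob M (\<lambda>n. sli A (\<phi> n)) Z"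
      by (simp add: sli_levy_space[OF \<phi>(1)])
  qed
  have "AE \<omega> in M. X \<omega> = levy_limit \<phi> UNIV \<omega> + 0"
  proof (rule tendsto_in_prob_add_unique[where X="\<lambda>n. sli levy_space (\<phi> n)" and ?X1.0="\<lambda>n. sli UNIV (\<phi> n)" and ?X2.0="\<lambda>n \<omega>. 0"])
    show "tendsto_in_prob M (\<lambda>n \<omega>. 0) (\<lambda>\<omega>. 0)" by (simp add: tendsto_in_prob_def)
    show "AE \<omega> in M. sli levy_space (\<phi> n) \<omega> = sli UNIV (\<phi> n) \<omega> + 0" for n
      using sli_levy_space[OF \<phi>(1), of UNIV n] by simp
  qed (use X Xm in \<open>auto intro!: sli_measurable \<phi> levy_limit[OF app]\<close>)
  then show ?thesis using app by (intro that) auto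
qed

end

section \<open>Covariances\<close>

text \<open>
  \<open>Cov X Z = Cov X (Z - Z')\<close> as \<open>X\<close> and \<open>Z'\<close> are uncorrelated.
\<close>
lemma (in prob_space) covariance_approx_indep_le:
  assumes [measurable]: "X \<in> borel_measurable M" "Z \<in> borel_measurable M" "Z' \<in> borel_measurable M"
    and bX: "\<And>\<omega>. \<omega> \<in> space M \<Longrightarrow> \<bar>X \<omega>\<bar> \<le> C" and bZ: "\<And>\<omega>. \<bar>Z \<omega>\<bar> \<le> C'" and bZ': "\<And>\<omega>. \<bar>Z' \<omega>\<bar> \<le> C'"
    and ind: "(LINT \<omega>|M. X \<omega> * Z' \<omega>) = (LINT \<omega>|M. X \<omega>) * (LINT \<omega>|M. Z' \<omega>)"
    and R: "integrable M R" and le: "AE \<omega> in M. \<bar>Z \<omega> - Z' \<omega>\<bar> \<le> R \<omega>"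
  shows "\<bar>covariance M X Z\<bar> \<le> 2 * C * (LINT \<omega>|M. R \<omega>)"
proof -
  have C: "0 \<le> C" using bX not_empty by (meson abs_ge_zero all_not_in_conv order_trans)
  have C': "0 \<le> C'" using bZ by (meson abs_ge_zero order_trans)
  have iX: "integrable M X" by (rule integrable_const_bound[of _ C]) (auto intro: bX)
  have iZ: "integrable M Z" by (rule integrable_const_bound[of _ C']) (auto intro: bZ)
  have iZ': "integrable M Z'" by (rule integrable_const_bound[of _ C']) (auto intro: bZ')
  have iXZ: "integrable M (\<lambda>\<omega>. X \<omega> * Z \<omega>)"
    by (rule integrable_const_bound[of _ "C * C'"]) (auto simp: abs_mult intro!: mult_mono bX bZ C)
  have iXZ': "integrable M (\<lambda>\<omega>. X \<omega> * Z' \<omega>)"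
    by (rule integrable_const_bound[of _ "C * C'"]) (auto simp: abs_mult intro!: mult_mono bX bZ' C)
  let ?E = "\<lambda>X. LINT \<omega>|M. X \<omega>"
  have "covariance M X Z = (LINT \<omega>|M. X \<omega> * Z \<omega> - ?E X * Z \<omega> - X \<omega> * ?E Z + ?E X * ?E Z)"
    unfolding covariance_def by (simp add: algebra_simps)
  also have "\<dots> = ?E (\<lambda>\<omega>. X \<omega> * Z \<omega>) - ?E X * ?E Z"
    using iX iZ iXZ by (simp add: prob_space)
  also have "\<dots> = (?E (\<lambda>\<omega>. X \<omega> * Z \<omega>) - ?E (\<lambda>\<omega>. X \<omega> * Z' \<omega>)) - ?E X * (?E Z - ?E Z')"
    unfolding ind by (simp add: algebra_simps)
  also have "?E (\<lambda>\<omega>. X \<omega> * Z \<omega>) - ?E (\<lambda>\<omega>. X \<omega> * Z' \<omega>) = ?E (\<lambda>\<omega>. X \<omega> * (Z \<omega> - Z' \<omega>))"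
    using iXZ iXZ' by (simp add: right_diff_distrib)
  also have "?E Z - ?E Z' = ?E (\<lambda>\<omega>. Z \<omega> - Z' \<omega>)" using iZ iZ' by simp
  finally have cov: "covariance M X Z = ?E (\<lambda>\<omega>. X \<omega> * (Z \<omega> - Z' \<omega>)) - ?E X * ?E (\<lambda>\<omega>. Z \<omega> - Z' \<omega>)" .
  have "norm (?E (\<lambda>\<omega>. X \<omega> * (Z \<omega> - Z' \<omega>))) \<le> ?E (\<lambda>\<omega>. C * R \<omega>)"
  proof (rule norm_integral_le)
    show "AE \<omega> in M. norm (X \<omega> * (Z \<omega> - Z' \<omega>)) \<le> C * R \<omega>"
      using le AE_space by eventually_elim (auto simp: abs_mult intro!: mult_mono bX C)
  qed (use R in simp)
  then have 1: "\<bar>?E (\<lambda>\<omega>. X \<omega> * (Z \<omega> - Z' \<omega>))\<bar> \<le> C * ?E R" by simp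
  have "norm (?E (\<lambda>\<omega>. Z \<omega> - Z' \<omega>)) \<le> ?E R"
    by (rule norm_integral_le[OF R]) (use le in auto)
  moreover have "norm (?E X) \<le> ?E (\<lambda>_. C)" by (rule norm_integral_le) (auto intro: bX)
  ultimately have "\<bar>?E X\<bar> * \<bar>?E (\<lambda>\<omega>. Z \<omega> - Z' \<omega>)\<bar> \<le> C * ?E R"
    using C by (intro mult_mono) (auto simp: prob_space)
  then have "\<bar>?E X * ?E (\<lambda>\<omega>. Z \<omega> - Z' \<omega>)\<bar> \<le> C * ?E R" by (simp add: abs_mult)
  with 1 show ?thesis unfolding cov by linarith
qed

lemma Lip_bound:
  assumes "L-lipschitz_on UNIV G"
  shows "\<bar>G x - G y\<bar> \<le> Lip G * \<bar>x - y\<bar>" and "0 \<le> Lip G"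
proof -
  let ?S = "(\<lambda>(x, y). \<bar>G x - G y\<bar> / \<bar>x - y\<bar>) ` {(x, y). x \<noteq> y}"
  have "bdd_above ?S"
  proof (rule bdd_aboveI)
    fix s assume "s \<in> ?S"
    then obtain x y where "x \<noteq> y" "s = \<bar>G x - G y\<bar> / \<bar>x - y\<bar>" by auto
    then show "s \<le> L" using lipschitz_onD[OF assms, of x y] by (simp add: dist_real_def pos_divide_le_eq)
  qed
  then have le: "\<bar>G x - G y\<bar> / \<bar>x - y\<bar> \<le> Lip G" if "x \<noteq> y" for x y

  proof -
    have "\<bar>G x - G y\<bar> / \<bar>x - y\<bar> \<in> ?S" using that by (intro image_eqI[of _ _ "(x, y)"]) auto
    then show ?thesis unfolding Lip_def by (rule cSup_upper) fact
  qed
  show "\<bar>G x - G y\<bar> \<le> Lip G * \<bar>x - y\<bar>"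
    using le[of x y] by (cases "x = y") (auto simp: pos_divide_le_eq)
  show "0 \<le> Lip G" using le[of 0 1] by (simp add: order_trans[OF abs_ge_zero])
qed

lemma sup_norm_on_bound:
  assumes "bounded (F ` A)" "v \<in> A" shows "\<bar>F v\<bar> \<le> sup_norm_on A F"
proof -
  obtain B where "\<And>v. v \<in> A \<Longrightarrow> \<bar>F v\<bar> \<le> B" using assms(1) by (auto simp: bounded_iff)
  then show ?thesis unfolding sup_norm_on_def using assms(2) by (intro cSUP_upper bdd_aboveI2) auto
qed

section \<open>Dependence coefficients of linear random fields\<close>

locale linear_field = levy_basis_space \<gamma> S \<nu> M \<Lambda> \<pi>
  for \<gamma> S \<nu> and M :: "'w measure" and \<Lambda> :: "(real \<times> real \<times> (real ^ 'd::finite)) set \<Rightarrow> 'w \<Rightarrow> real" and \<pi> +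
  fixes ker :: "real \<times> (real ^ 'd) \<Rightarrow> real \<times> real \<times> (real ^ 'd) \<Rightarrow> real" and Y :: "real \<times> (real ^ 'd) \<Rightarrow> 'w \<Rightarrow> real"
  assumes Y: "\<And>p. has_levy_integral M \<Lambda> (\<pi> \<Otimes>\<^sub>M lborel) (ker p) (Y p)"
begin

lemma Y_measurable: "Y p \<in> borel_measurable M" using Y by (simp add: has_levy_integral_def)

text \<open>
  The integrals \<open>Y (q i)\<close> are almost surely integrals over \<open>- N\<close>, and hence independent of the part of \<open>Y p\<close> that comes from \<open>N\<close>.
\<close>
lemma covariance_le_tail:
  assumes N: "N \<in> sets borel" and q: "\<And>i z. i < k \<Longrightarrow> z \<in> N \<Longrightarrow> ker (q i) z = 0"
    and tail: "\<And>\<phi>. levy_approx \<phi> (ker p) \<Longrightarrow> integrable M (levy_limit \<phi> (- N)) \<and> (LINT \<omega>|M. \<bar>levy_limit \<phi> (- N) \<omega>\<bar>) \<le> K"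
    and F: "F \<in> borel_measurable (borel_pow k)" "bounded (F ` space (borel_pow k))"
    and G: "bounded (range G)" "L-lipschitz_on UNIV G"
  shows "\<bar>covariance M (\<lambda>\<omega>. F (\<lambda>i\<in>{..<k}. Y (q i) \<omega>)) (\<lambda>\<omega>. G (Y p \<omega>))\<bar> \<le> 2 * sup_norm_on (space (borel_pow k)) F * Lip G * K"
proof -
  obtain \<phi>' where \<phi>': "levy_approx \<phi>' (ker p)" "AE \<omega> in M. Y p \<omega> = levy_limit \<phi>' UNIV \<omega>"
    using has_levy_integral_imp_levy_limit[OF Y[of p]] by blast
  have "\<exists>\<phi>. levy_approx \<phi> (ker (q i)) \<and> (AE \<omega> in M. Y (q i) \<omega> = levy_limit \<phi> UNIV \<omega>)" for i
    using has_levy_integral_imp_levy_limit[OF Y[of "q i"]] by blast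
  then obtain \<phi> where \<phi>: "\<And>i. levy_approx (\<phi> i) (ker (q i))" "\<And>i. AE \<omega> in M. Y (q i) \<omega> = levy_limit (\<phi> i) UNIV \<omega>"
    by metis
  have N': "- N \<in> sets borel" using N by (metis Compl_eq_Diff_UNIV sets.compl_sets space_borel)
  have split: "AE \<omega> in M. levy_limit \<psi> UNIV \<omega> = levy_limit \<psi> N \<omega> + levy_limit \<psi> (- N) \<omega>" if "levy_approx \<psi> g" for \<psi> g
    using levy_limit_add[OF that N N'] by simp
  have Yp: "AE \<omega> in M. Y p \<omega> = levy_limit \<phi>' N \<omega> + levy_limit \<phi>' (- N) \<omega>"
    using \<phi>'(2) split[OF \<phi>'(1)] by eventually_elim simp
  have Yq: "AE \<omega> in M. Y (q i) \<omega> = levy_limit (\<phi> i) (- N) \<omega>" if i: "i < k" for i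
  proof -
    have "AE \<omega> in M. levy_limit (\<phi> i) N \<omega> = 0" by (rule levy_limit_AE_0[OF \<phi>(1) N q[OF i]])
    with \<phi>(2)[of i] split[OF \<phi>(1)[of i]] show ?thesis by eventually_elim simp
  qed
  have Gc: "continuous_on UNIV G" using G(2) by (rule lipschitz_on_continuous_on)
  have Gm[measurable]: "G \<in> borel_measurable borel" using Gc by (rule borel_measurable_continuous_onI)
  obtain B where B: "\<And>x. \<bar>G x\<bar> \<le> B" using G(1) by (auto simp: bounded_iff)
  define C where "C = sup_norm_on (space (borel_pow k)) F"
  have FC: "\<bar>F v\<bar> \<le> C" if "v \<in> space (borel_pow k)" for v unfolding C_def by (rule sup_norm_on_bound[OF F(2) that])
  have sp: "(\<lambda>i\<in>{..<k}. x i) \<in> space (borel_pow k)" for x :: "nat \<Rightarrow> real" by (simp add: space_PiM)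
  let ?W = "\<lambda>\<omega>. F (\<lambda>i\<in>{..<k}. Y (q i) \<omega>)"
  let ?V = "\<lambda>\<omega>. F (\<lambda>i\<in>{..<k}. levy_limit (\<phi> i) (- N) \<omega>)"
  have W[measurable]: "?W \<in> borel_measurable M"
    by (rule measurable_compose[OF _ F(1)]) (intro measurable_restrict Y_measurable)
  have V[measurable]: "?V \<in> borel_measurable M"
    by (rule measurable_compose[OF _ F(1)]) (intro measurable_restrict levy_limit(1)[OF \<phi>(1) N'])
  note [measurable] = Y_measurable levy_limit(1)[OF \<phi>'(1) N] levy_limit(1)[OF \<phi>'(1) N']
  have "AE \<omega> in M. \<forall>i\<in>{..<k}. Y (q i) \<omega> = levy_limit (\<phi> i) (- N) \<omega>"
    using Yq by (intro AE_finite_allI) auto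
  then have WV: "AE \<omega> in M. ?W \<omega> = ?V \<omega>"
  proof eventually_elim
    case (elim \<omega>)
    then have "(\<lambda>i\<in>{..<k}. Y (q i) \<omega>) = (\<lambda>i\<in>{..<k}. levy_limit (\<phi> i) (- N) \<omega>)" by (auto simp: restrict_def)
    then show ?case by simp
  qed
  have tp: "integrable M (levy_limit \<phi>' (- N))" "(LINT \<omega>|M. \<bar>levy_limit \<phi>' (- N) \<omega>\<bar>) \<le> K"
    using tail[OF \<phi>'(1)] by auto
  have "\<bar>covariance M ?W (\<lambda>\<omega>. G (Y p \<omega>))\<bar> \<le> 2 * C * (LINT \<omega>|M. Lip G * \<bar>levy_limit \<phi>' (- N) \<omega>\<bar>)"
  proof (rule covariance_approx_indep_le[where Z'="\<lambda>\<omega>. G (levy_limit \<phi>' N \<omega>)" and C'=B])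
    have "(LINT \<omega>|M. ?V \<omega> * G (levy_limit \<phi>' N \<omega>)) = (LINT \<omega>|M. ?V \<omega>) * (LINT \<omega>|M. G (levy_limit \<phi>' N \<omega>))"
      by (rule levy_limit_indep[OF \<phi>(1) \<phi>'(1) N' N _ F(1) FC Gc B]) auto
    moreover have "(LINT \<omega>|M. ?W \<omega> * G (levy_limit \<phi>' N \<omega>)) = (LINT \<omega>|M. ?V \<omega> * G (levy_limit \<phi>' N \<omega>))"
      using WV by (intro integral_cong_AE) (auto elim!: eventually_mono)
    moreover have "(LINT \<omega>|M. ?W \<omega>) = (LINT \<omega>|M. ?V \<omega>)"
      using WV by (intro integral_cong_AE) auto
    ultimately show "(LINT \<omega>|M. ?W \<omega> * G (levy_limit \<phi>' N \<omega>)) = (LINT \<omega>|M. ?W \<omega>) * (LINT \<omega>|M. G (levy_limit \<phi>' N \<omega>))" by simp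
    show "AE \<omega> in M. \<bar>G (Y p \<omega>) - G (levy_limit \<phi>' N \<omega>)\<bar> \<le> Lip G * \<bar>levy_limit \<phi>' (- N) \<omega>\<bar>"
      using Yp
    proof eventually_elim
      case (elim \<omega>)
      show ?case using Lip_bound(1)[OF G(2), of "Y p \<omega>" "levy_limit \<phi>' N \<omega>"] unfolding elim by simp
    qed
  qed (use tp in \<open>auto intro!: FC sp B integrable_mult_right\<close>)
  also have "\<dots> = 2 * C * Lip G * (LINT \<omega>|M. \<bar>levy_limit \<phi>' (- N) \<omega>\<bar>)" by simp
  also have "\<dots> \<le> 2 * C * Lip G * K"
  proof (rule mult_left_mono[OF tp(2)])
    have "0 \<le> C" using FC[OF sp[of "\<lambda>_. 0"]] abs_ge_zero order_trans by blast
    then show "0 \<le> 2 * C * Lip G" using Lip_bound(2)[OF G(2)] by simp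
  qed
  finally show ?thesis by (simp add: C_def)
qed

end

lemma theta_lex_le:
  fixes \<Lambda> :: "(real \<times> real \<times> (real ^ 'd::{finite,linorder})) set \<Rightarrow> 'w \<Rightarrow> real"
  assumes "linear_field \<gamma> S \<nu> M \<Lambda> \<pi> ker Y"
    and N: "\<And>p. N p \<in> sets borel" "\<And>p q z. q \<in> lex_past_dist p h \<Longrightarrow> z \<in> N p \<Longrightarrow> ker q z = 0"
    and tail: "\<And>p \<phi>. levy_basis_space.levy_approx M \<Lambda> \<pi> \<phi> (ker p) \<Longrightarrow>
      integrable M (levy_basis_space.levy_limit M \<Lambda> \<phi> (- N p)) \<and>
      (LINT \<omega>|M. \<bar>levy_basis_space.levy_limit M \<Lambda> \<phi> (- N p) \<omega>\<bar>) \<le> K"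
  shows "theta_lex M Y h \<le> ennreal (2 * K)"
  unfolding theta_lex_def
proof (rule SUP_least)
  interpret linear_field \<gamma> S \<nu> M \<Lambda> \<pi> ker Y by fact
  fix k :: nat assume "k \<in> {1..}"
  show "theta_lex_u M Y k h \<le> ennreal (2 * K)"
    unfolding theta_lex_u_def
  proof (rule SUP_least, safe)
    fix F G L and p :: "real \<times> (real ^ 'd::{finite,linorder})" and q :: "nat \<Rightarrow> real \<times> (real ^ 'd::{finite,linorder})"
    assume F: "F \<in> borel_measurable (borel_pow k)" "bounded (F ` space (borel_pow k))"
      and G: "bounded (range G)" "L-lipschitz_on UNIV G"
      and nz: "sup_norm_on (space (borel_pow k)) F * Lip G \<noteq> 0"
      and q: "q ` {..<k} \<subseteq> lex_past_dist p h"
    have le: "\<bar>covariance M (\<lambda>\<omega>. F (\<lambda>i\<in>{..<k}. Y (q i) \<omega>)) (\<lambda>\<omega>. G (Y p \<omega>))\<bar> \<le> 2 * sup_norm_on (space (borel_pow k)) F * Lip G * K"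
    proof (rule covariance_le_tail[OF N(1)[of p] _ tail F G])
      fix i z assume "i < k" "z \<in> N p"
      then have "q i \<in> lex_past_dist p h" using q by blast
      then show "ker (q i) z = 0" using \<open>z \<in> N p\<close> by (rule N(2))
    qed
    have "(\<lambda>i\<in>{..<k}. 0) \<in> space (borel_pow k)" by (simp add: space_PiM)
    from order_trans[OF abs_ge_zero sup_norm_on_bound[OF F(2) this]]
    have "0 \<le> sup_norm_on (space (borel_pow k)) F" .
    then have pos: "0 < sup_norm_on (space (borel_pow k)) F * Lip G" using nz Lip_bound(2)[OF G(2)] by (simp add: less_le)
    show "ennreal (\<bar>covariance M (\<lambda>\<omega>. F (\<lambda>i\<in>{..<k}. Y (q i) \<omega>)) (\<lambda>\<omega>. G (Y p \<omega>))\<bar> / (sup_norm_on (space (borel_pow k)) F * Lip G)) \<le> ennreal (2 * K)"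
      using le pos by (intro ennreal_leI) (simp add: pos_divide_le_eq mult_ac)
  qed
qed

section \<open>Geometry of the cones\<close>

lemma infnorm_prod_less:
  fixes v :: "real \<times> (real ^ 'm::finite)"
  assumes "\<bar>fst v\<bar> < h" "norm (snd v) < h"
  shows "infnorm v < h"
proof -
  have "\<bar>v \<bullet> b\<bar> < h" if "b \<in> Basis" for b
  proof -
    have "b \<in> (\<lambda>u. (u, 0)) ` Basis \<union> (\<lambda>v. (0, v)) ` Basis" using that by (simp add: Basis_prod_def)
    then consider "b = (1, 0)" | w where "w \<in> Basis" "b = (0, w)" by auto
    then show ?thesis
    proof cases
      case 1
      then show ?thesis using assms by (simp add: inner_prod_def)
    next
      case 2
      have "\<bar>snd v \<bullet> w\<bar> \<le> norm (snd v)" using 2 by (rule_tac Basis_le_norm)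
      then show ?thesis using 2 assms by (simp add: inner_prod_def)
    qed
  qed
  then show ?thesis unfolding infnorm_Max by (subst Max_less_iff) auto
qed

text \<open>
  All rates \<open>l\<close> are allowed, since the cut concerns time and space only.
\<close>
definition near_cone :: "real \<Rightarrow> real \<Rightarrow> real \<times> (real ^ 'm::finite) \<Rightarrow> (real \<times> real \<times> (real ^ 'm)) set" where
  "near_cone c \<tau> p = {z. fst p - \<tau> < fst (snd z) \<and> snd z \<in> ambit_set c p}"

lemma ambit_set_iff: "w \<in> ambit_set c p \<longleftrightarrow> fst w \<le> fst p \<and> norm (snd p - snd w) \<le> c * \<bar>fst p - fst w\<bar>"
  by (auto simp: ambit_set_def split_beta)

lemma near_cone_borel: "near_cone c \<tau> p \<in> sets borel"
proof -
  have eq: "near_cone c \<tau> p = {z. fst p - \<tau> < fst (snd z)} \<inter> ({z. fst (snd z) \<le> fst p} \<inter>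
     {z. norm (snd p - snd (snd z)) \<le> c * \<bar>fst p - fst (snd z)\<bar>})"
    by (auto simp: near_cone_def ambit_set_iff)
  show ?thesis unfolding eq
    by (intro sets.Int borel_open borel_closed open_Collect_less closed_Collect_le continuous_intros)
qed

text \<open>
  A common point \<open>z\<close> is later than \<open>fst p - \<tau>\<close>, so it lies within distance \<open>c * \<tau>\<close> in space of both \<open>p\<close> and \<open>q\<close>, which are then closer
  than \<open>2 * c * \<tau> \<le> h\<close> in space. As \<open>q\<close> is later than \<open>z\<close>, and by the lexicographic order not later than \<open>p\<close>, they are also closer than
  \<open>\<tau> \<le> h\<close> in time.
\<close>
lemma near_cone_disjoint:
  fixes p q :: "real \<times> (real ^ 'm::{finite,linorder})"
  assumes q: "q \<in> lex_past_dist p h" and \<tau>: "\<tau> \<le> h" "2 * c * \<tau> \<le> h" and c: "0 < c"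
    and z: "z \<in> near_cone c \<tau> p"
  shows "snd z \<notin> ambit_set c q"
proof
  assume zq: "snd z \<in> ambit_set c q"
  have le: "fst q \<le> fst p" using q by (auto simp: lex_past_dist_def lex_past_def lex_less_def)
  have inf: "h \<le> infnorm (p - q)" using q by (simp add: lex_past_dist_def)
  have s: "fst p - \<tau> < fst (snd z)" "fst (snd z) \<le> fst q" using z zq by (auto simp: near_cone_def ambit_set_iff)
  have "norm (snd p - snd q) \<le> norm (snd p - snd (snd z)) + norm (snd q - snd (snd z))"
    using norm_triangle_ineq4[of "snd p - snd (snd z)" "snd q - snd (snd z)"] by simp
  also have "\<dots> \<le> c * (fst p - fst (snd z)) + c * (fst q - fst (snd z))"
    using z zq s le by (intro add_mono) (auto simp: near_cone_def ambit_set_iff)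
  also have "\<dots> < c * \<tau> + c * \<tau>"
    using s le c by (intro add_strict_mono mult_strict_left_mono) auto
  finally have "norm (snd p - snd q) < h" using \<tau>(2) by linarith
  moreover have "\<bar>fst p - fst q\<bar> < h" using s le \<tau> by auto
  ultimately have "infnorm (p - q) < h" by (intro infnorm_prod_less) auto
  with inf show False by simp
qed

lemma mstou_kernel_eq:
  "mstou_kernel c p z = exp (- fst z * (fst p - fst (snd z))) * indicator (ambit_set c p) (snd z)"
  by (simp add: mstou_kernel_def split_beta)

section \<open>Incomplete gamma integrals\<close>

text \<open>
  The closed form of \<open>\<integral> r ^ m * exp (- a * r)\<close> over \<open>r \<ge> \<tau>\<close>, that is of \<open>\<Gamma>(m + 1, a * \<tau>) / a ^ (m + 1)\<close>.
\<close>
definition gamma_tail :: "nat \<Rightarrow> real \<Rightarrow> real \<Rightarrow> real" where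
  "gamma_tail m a \<tau> = fact m * (\<Sum>k=0..m. 1 / fact k * (a * \<tau>) ^ k) / a ^ (m + 1) * exp (- (a * \<tau>))"

lemma exp_partial_sum_le: "0 \<le> x \<Longrightarrow> (\<Sum>k=0..m. 1 / fact k * x ^ k) * exp (- x) \<le> (1::real)"
proof -
  assume x: "0 \<le> x"
  have "(\<Sum>k<Suc m. inverse (fact k) * x ^ k) \<le> (\<Sum>k. inverse (fact k) * x ^ k)"
    using x summable_exp[of x] by (intro sum_le_suminf) auto
  also have "\<dots> = exp x" by (simp add: exp_def scaleR_conv_of_real)
  finally have "(\<Sum>k=0..m. 1 / fact k * x ^ k) \<le> exp x"
    by (simp add: inverse_eq_divide atLeast0AtMost lessThan_Suc_atMost)
  then have "(\<Sum>k=0..m. 1 / fact k * x ^ k) * exp (- x) \<le> exp x * exp (- x)" by (intro mult_right_mono) auto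
  then show ?thesis by (simp flip: exp_add)
qed

lemma gamma_tail_nonneg: "0 < a \<Longrightarrow> 0 \<le> \<tau> \<Longrightarrow> 0 \<le> gamma_tail m a \<tau>"
  unfolding gamma_tail_def by (intro mult_nonneg_nonneg divide_nonneg_nonneg sum_nonneg) auto

lemma gamma_tail_le: "0 < a \<Longrightarrow> 0 \<le> \<tau> \<Longrightarrow> gamma_tail m a \<tau> \<le> fact m / a ^ (m + 1)"
proof -
  assume a: "0 < a" "0 \<le> \<tau>"
  have "gamma_tail m a \<tau> = fact m / a ^ (m + 1) * ((\<Sum>k=0..m. 1 / fact k * (a * \<tau>) ^ k) * exp (- (a * \<tau>)))"
    by (simp add: gamma_tail_def)
  also have "\<dots> \<le> fact m / a ^ (m + 1) * 1"
    using a by (intro mult_left_mono exp_partial_sum_le) auto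
  finally show ?thesis by simp
qed

lemma gamma_tail_tendsto_0: "0 < a \<Longrightarrow> (gamma_tail m a \<longlongrightarrow> 0) at_top"
proof -
  assume a: "0 < a"
  have "((\<lambda>x::real. (\<Sum>k=0..m. 1 / fact k * (x ^ k / exp x))) \<longlongrightarrow> (\<Sum>k=0..m. 1 / fact k * 0)) at_top"
    by (intro tendsto_sum tendsto_mult tendsto_const tendsto_power_div_exp_0)
  then have "((\<lambda>x::real. fact m / a ^ (m + 1) * (\<Sum>k=0..m. 1 / fact k * (x ^ k / exp x))) \<longlongrightarrow> fact m / a ^ (m + 1) * 0) at_top"
    by (intro tendsto_mult tendsto_const) simp
  then have l: "((\<lambda>x::real. fact m / a ^ (m + 1) * (\<Sum>k=0..m. 1 / fact k * (x ^ k / exp x))) \<longlongrightarrow> 0) at_top" by simp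
  have "filterlim (\<lambda>\<tau>. a * \<tau>) at_top at_top"
    by (rule filterlim_tendsto_pos_mult_at_top[OF tendsto_const a filterlim_ident])
  from filterlim_compose[OF l this] show ?thesis
    unfolding gamma_tail_def[abs_def]
    by (simp only: exp_minus divide_inverse sum_distrib_left sum_distrib_right mult_ac)
qed

lemma nn_integral_gamma_tail_unit:
  assumes b: "0 \<le> b"
  shows "(\<integral>\<^sup>+x. ennreal (x ^ m * exp (- x)) * indicator {b..} x \<partial>lborel) = ennreal (gamma_tail m 1 b)"
proof -
  define s where "s = (\<Sum>n\<le>m. (b ^ n * exp (- b)) / fact n)"
  have s: "s * fact m = gamma_tail m 1 b"
    by (simp add: s_def gamma_tail_def sum_distrib_right sum_distrib_left atLeast0AtMost mult_ac)
  have s1: "s \<le> 1"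
  proof -
    have "s = (\<Sum>k=0..m. 1 / fact k * b ^ k) * exp (- b)"
      unfolding s_def sum_distrib_right atLeast0AtMost by (intro sum.cong refl) simp
    then show ?thesis using exp_partial_sum_le[OF b, of m] by simp
  qed
  have s0: "0 \<le> s" unfolding s_def using b by (intro sum_nonneg) auto
  have eqI: "(\<integral>\<^sup>+x. ennreal (x ^ m * exp (- x)) * indicator {b..} x \<partial>lborel) = (\<integral>\<^sup>+x. ennreal (x ^ m * exp (- x)) * indicator {b<..} x \<partial>lborel)"
    by (rule nn_integral_cong_AE, rule AE_mp[OF AE_lborel_singleton[of b]]) (auto simp: indicator_def)
  have "(\<integral>\<^sup>+x. ennreal (x ^ m * exp (- x)) * indicator {0..} x \<partial>lborel) =
     (\<integral>\<^sup>+x. ennreal (x ^ m * exp (- x)) * indicator {0..b} x + ennreal (x ^ m * exp (- x)) * indicator {b<..} x \<partial>lborel)"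
    using b by (intro nn_integral_cong) (auto simp: indicator_def)
  also have "\<dots> = (\<integral>\<^sup>+x. ennreal (x ^ m * exp (- x)) * indicator {0..b} x \<partial>lborel) + (\<integral>\<^sup>+x. ennreal (x ^ m * exp (- x)) * indicator {b<..} x \<partial>lborel)"
    by (rule nn_integral_add) auto
  finally have "ennreal (fact m) = ennreal ((1 - s) * fact m) + (\<integral>\<^sup>+x. ennreal (x ^ m * exp (- x)) * indicator {b<..} x \<partial>lborel)"
    unfolding nn_intergal_power_times_exp_Icc[OF b] nn_intergal_power_times_exp_Ici s_def by simp
  moreover have "ennreal (fact m) = ennreal ((1 - s) * fact m) + ennreal (s * fact m)"
    using s0 s1 by (subst ennreal_plus[symmetric]) (auto simp: algebra_simps)
  ultimately have "ennreal ((1 - s) * fact m) + (\<integral>\<^sup>+x. ennreal (x ^ m * exp (- x)) * indicator {b<..} x \<partial>lborel) =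
      ennreal ((1 - s) * fact m) + ennreal (s * fact m)" by simp
  then show ?thesis unfolding eqI s[symmetric] by (subst (asm) ennreal_add_left_cancel) auto
qed

lemma nn_integral_gamma_tail:
  assumes a: "0 < a" and \<tau>: "0 \<le> \<tau>"
  shows "(\<integral>\<^sup>+r. ennreal (r ^ m * exp (- (a * r))) * indicator {\<tau>..} r \<partial>lborel) = ennreal (gamma_tail m a \<tau>)"
proof -
  have "ennreal (gamma_tail m 1 (a * \<tau>)) = (\<integral>\<^sup>+x. ennreal (x ^ m * exp (- x)) * indicator {a * \<tau>..} x \<partial>lborel)"
    by (rule nn_integral_gamma_tail_unit[symmetric]) (use a \<tau> in simp)
  also have "\<dots> = ennreal \<bar>a\<bar> * (\<integral>\<^sup>+x. ennreal ((0 + a * x) ^ m * exp (- (0 + a * x))) * indicator {a * \<tau>..} (0 + a * x) \<partial>lborel)"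
    using a by (intro nn_integral_real_affine) auto
  also have "(\<integral>\<^sup>+x. ennreal ((0 + a * x) ^ m * exp (- (0 + a * x))) * indicator {a * \<tau>..} (0 + a * x) \<partial>lborel) =
      (\<integral>\<^sup>+x. ennreal (a ^ m) * (ennreal (x ^ m * exp (- (a * x))) * indicator {\<tau>..} x) \<partial>lborel)"
  proof (rule nn_integral_cong)
    fix x
    show "ennreal ((0 + a * x) ^ m * exp (- (0 + a * x))) * indicator {a * \<tau>..} (0 + a * x) =
        ennreal (a ^ m) * (ennreal (x ^ m * exp (- (a * x))) * indicator {\<tau>..} x)"
    proof (cases "\<tau> \<le> x")
      case True
      then show ?thesis using a \<tau> by (simp add: power_mult_distrib ennreal_mult mult_ac)
    next
      case False
      then show ?thesis using a by simp
    qed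
  qed
  also have "\<dots> = ennreal (a ^ m) * (\<integral>\<^sup>+r. ennreal (r ^ m * exp (- (a * r))) * indicator {\<tau>..} r \<partial>lborel)"
    by (rule nn_integral_cmult) auto
  finally have 1: "ennreal (a ^ (m + 1)) * (\<integral>\<^sup>+r. ennreal (r ^ m * exp (- (a * r))) * indicator {\<tau>..} r \<partial>lborel) = ennreal (gamma_tail m 1 (a * \<tau>))"
    using a by (simp add: ennreal_mult mult_ac)
  have 2: "gamma_tail m 1 (a * \<tau>) = a ^ (m + 1) * gamma_tail m a \<tau>" using a by (simp add: gamma_tail_def)
  have "ennreal (a ^ (m + 1)) * (\<integral>\<^sup>+r. ennreal (r ^ m * exp (- (a * r))) * indicator {\<tau>..} r \<partial>lborel) = ennreal (a ^ (m + 1)) * ennreal (gamma_tail m a \<tau>)"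
    unfolding 1 2 using a gamma_tail_nonneg[OF a \<tau>] by (intro ennreal_mult) auto
  then show ?thesis using a by (subst (asm) ennreal_mult_cancel_left) auto
qed

lemma ball_volume_eq: "ball_volume m c = unit_ball_vol (real m) * c ^ m"
proof -
  have "sqrt pi ^ m = pi powr (real m / 2)"
    by (simp add: powr_half_sqrt[symmetric] powr_power)
  then show ?thesis by (simp add: ball_volume_def unit_ball_vol_def Gamma_one_half_real power_mult_distrib)
qed

lemma ball_volume_nonneg: "0 < c \<Longrightarrow> 0 \<le> ball_volume m c"
  unfolding ball_volume_eq by simp

text \<open>
  At time distance \<open>r\<close> from the apex the cone is a ball of radius \<open>c * r\<close>, which contributes the factor \<open>r ^ m\<close>.
\<close>

lemma nn_integral_cone_tail:
  fixes p :: "real \<times> (real ^ 'm::finite)"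
  assumes c: "0 < c" and \<tau>: "0 < \<tau>" and a: "0 < a"
  shows "(\<integral>\<^sup>+w. ennreal (exp (- (a * (fst p - fst w)))) * indicator {w \<in> ambit_set c p. fst w \<le> fst p - \<tau>} w \<partial>lborel) =
    ennreal (ball_volume CARD('m) c * gamma_tail CARD('m) a \<tau>)"
proof -
  let ?m = "CARD('m)"
  obtain t x where p: "p = (t, x)" by (cases p)
  define S where "S = {w \<in> ambit_set c p. fst w \<le> fst p - \<tau>}"
  have S: "S \<in> sets borel"
  proof -
    have eq: "S = {w. fst w \<le> fst p} \<inter> {w. norm (snd p - snd w) \<le> c * \<bar>fst p - fst w\<bar>} \<inter> {w. fst w \<le> fst p - \<tau>}"
      by (auto simp: S_def ambit_set_iff)
    show ?thesis unfolding eq by (intro sets.Int borel_closed closed_Collect_le continuous_intros)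
  qed
  let ?g = "\<lambda>w. ennreal (exp (- (a * (fst p - fst w)))) * indicator S w"
  have gm: "?g \<in> borel_measurable borel"
  proof -
    have "(\<lambda>w. exp (- (a * (fst p - fst w)))) \<in> borel_measurable (borel :: (real \<times> (real ^ 'm)) measure)"
      by (intro borel_measurable_continuous_onI continuous_intros)
    then show ?thesis by (intro borel_measurable_times_ennreal borel_measurable_indicator S measurable_compose[OF _ measurable_ennreal])
  qed
  have gm': "?g \<in> borel_measurable (lborel \<Otimes>\<^sub>M lborel)"
    unfolding lborel_prod measurable_cong_sets[OF sets_lborel refl] by (rule gm)
  have "(\<integral>\<^sup>+w. ?g w \<partial>lborel) = (\<integral>\<^sup>+w. ?g w \<partial>(lborel \<Otimes>\<^sub>M lborel))" by (simp only: lborel_prod)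
  also have "\<dots> = (\<integral>\<^sup>+s. \<integral>\<^sup>+\<xi>. ?g (s, \<xi>) \<partial>lborel \<partial>lborel)" by (rule lborel.nn_integral_fst[OF gm', symmetric])
  also have "\<dots> = (\<integral>\<^sup>+s. ennreal (ball_volume ?m c) * (ennreal ((t + - 1 * s) ^ ?m * exp (- (a * (t + - 1 * s)))) * indicator {\<tau>..} (t + - 1 * s)) \<partial>lborel)"
  proof (rule nn_integral_cong)
    fix s :: real
    show "(\<integral>\<^sup>+\<xi>. ?g (s, \<xi>) \<partial>lborel) = ennreal (ball_volume ?m c) * (ennreal ((t + - 1 * s) ^ ?m * exp (- (a * (t + - 1 * s)))) * indicator {\<tau>..} (t + - 1 * s))"
    proof (cases "s \<le> t - \<tau>")
      case True
      then have st: "s \<le> t" using \<tau> by simp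
      have "?g (s, \<xi>) = ennreal (exp (- (a * (t - s)))) * indicator (cball x (c * (t - s))) \<xi>" for \<xi>
        using True st by (auto simp: S_def ambit_set_iff p indicator_def dist_norm)
      then have "(\<integral>\<^sup>+\<xi>. ?g (s, \<xi>) \<partial>lborel) = (\<integral>\<^sup>+\<xi>. ennreal (exp (- (a * (t - s)))) * indicator (cball x (c * (t - s))) \<xi> \<partial>lborel)"
        by simp
      also have "\<dots> = ennreal (exp (- (a * (t - s)))) * emeasure lborel (cball x (c * (t - s)))"
        by (rule nn_integral_cmult_indicator) auto
      also have "emeasure lborel (cball x (c * (t - s))) = ennreal (unit_ball_vol (real ?m) * (c * (t - s)) ^ ?m)"
        using c st by (subst emeasure_cball) auto
      also have "ennreal (exp (- (a * (t - s)))) * ennreal (unit_ball_vol (real ?m) * (c * (t - s)) ^ ?m) =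
          ennreal (exp (- (a * (t - s))) * (unit_ball_vol (real ?m) * (c * (t - s)) ^ ?m))"
        using c st by (intro ennreal_mult[symmetric]) auto
      also have "exp (- (a * (t - s))) * (unit_ball_vol (real ?m) * (c * (t - s)) ^ ?m) = ball_volume ?m c * ((t - s) ^ ?m * exp (- (a * (t - s))))"
        by (simp add: ball_volume_eq power_mult_distrib)
      also have "ennreal \<dots> = ennreal (ball_volume ?m c) * ennreal ((t - s) ^ ?m * exp (- (a * (t - s))))"
        using c st ball_volume_nonneg[OF c] by (intro ennreal_mult) auto
      finally show ?thesis using True by simp
    next
      case False
      then have "?g (s, \<xi>) = 0" for \<xi> by (auto simp: S_def p)
      then show ?thesis using False by simp
    qed
  qed
  also have "\<dots> = ennreal (ball_volume ?m c) * (\<integral>\<^sup>+s. ennreal ((t + - 1 * s) ^ ?m * exp (- (a * (t + - 1 * s)))) * indicator {\<tau>..} (t + - 1 * s) \<partial>lborel)"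
    by (rule nn_integral_cmult) measurable
  also have "(\<integral>\<^sup>+s. ennreal ((t + - 1 * s) ^ ?m * exp (- (a * (t + - 1 * s)))) * indicator {\<tau>..} (t + - 1 * s) \<partial>lborel) =
      (\<integral>\<^sup>+r. ennreal (r ^ ?m * exp (- (a * r))) * indicator {\<tau>..} r \<partial>lborel)"
    by (subst (2) nn_integral_real_affine[where c="-1" and t=t]) auto
  also have "\<dots> = ennreal (gamma_tail ?m a \<tau>)" using \<tau> by (intro nn_integral_gamma_tail[OF a]) simp
  also have "ennreal (ball_volume ?m c) * ennreal (gamma_tail ?m a \<tau>) = ennreal (ball_volume ?m c * gamma_tail ?m a \<tau>)"
    using \<tau> by (intro ennreal_mult[symmetric] ball_volume_nonneg c gamma_tail_nonneg[OF a]) simp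
  finally show ?thesis by (simp only: S_def)
qed

section \<open>Integration over the rates\<close>

lemma gamma_tail_measurable[measurable]: "(\<lambda>l. gamma_tail m (a * l) \<tau>) \<in> borel_measurable borel"
  unfolding gamma_tail_def by measurable

lemma gamma_tail_set_integrable:
  assumes a: "0 < a" and \<tau>: "0 \<le> \<tau>" and f: "set_borel_measurable borel {0<..} f" "\<And>l. 0 < l \<Longrightarrow> 0 \<le> f l"
    and int: "set_integrable lborel {0<..} (\<lambda>l. f l / l ^ (m + 1))"
  shows "set_integrable lborel {0<..} (\<lambda>l. gamma_tail m (a * l) \<tau> * f l)"
proof -
  let ?w = "\<lambda>l. fact m / a ^ (m + 1) * (indicator {0<..} l *\<^sub>R (f l / l ^ (m + 1)))"
  have [measurable]: "(\<lambda>l. indicator {0<..} l *\<^sub>R f l) \<in> borel_measurable borel"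
    using f(1) by (simp add: set_borel_measurable_def)
  show ?thesis
    unfolding set_integrable_def
  proof (rule Bochner_Integration.integrable_bound)
    show "integrable lborel ?w" using int unfolding set_integrable_def by (rule integrable_mult_right)
    have "(\<lambda>l. gamma_tail m (a * l) \<tau> * (indicator {0<..} l *\<^sub>R f l)) \<in> borel_measurable lborel" by measurable
    then show "(\<lambda>l. indicator {0<..} l *\<^sub>R (gamma_tail m (a * l) \<tau> * f l)) \<in> borel_measurable lborel"
      by (simp add: mult_ac)
    show "AE l in lborel. norm (indicator {0<..} l *\<^sub>R (gamma_tail m (a * l) \<tau> * f l)) \<le> norm (?w l)"
    proof (rule AE_I2)
      fix l :: real
      show "norm (indicator {0<..} l *\<^sub>R (gamma_tail m (a * l) \<tau> * f l)) \<le> norm (?w l)"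
      proof (cases "0 < l")
        case True
        then have "gamma_tail m (a * l) \<tau> * f l \<le> fact m / (a * l) ^ (m + 1) * f l"
          using a \<tau> f(2) by (intro mult_right_mono gamma_tail_le) auto
        also have "\<dots> = ?w l" using True by (simp add: power_mult_distrib field_simps)
        finally show ?thesis using True a \<tau> f(2)[OF True] gamma_tail_nonneg[of "a * l" \<tau> m] by simp
      qed simp
    qed
  qed
qed

text \<open>
  Dominated convergence with the bound \<open>gamma_tail m a \<tau> \<le> fact m / a ^ (m + 1)\<close>.
\<close>
lemma gamma_tail_integral_tendsto_0:
  assumes a: "0 < a" and f: "set_borel_measurable borel {0<..} f" "\<And>l. 0 < l \<Longrightarrow> 0 \<le> f l"
    and int: "set_integrable lborel {0<..} (\<lambda>l. f l / l ^ (m + 1))"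
  shows "((\<lambda>\<tau>. LBINT l:{0<..}. gamma_tail m (a * l) \<tau> * f l) \<longlongrightarrow> 0) at_top"
proof -
  let ?w = "\<lambda>l. fact m / a ^ (m + 1) * (indicator {0<..} l *\<^sub>R (f l / l ^ (m + 1)))"
  have [measurable]: "(\<lambda>l. indicator {0<..} l *\<^sub>R f l) \<in> borel_measurable borel"
    using f(1) by (simp add: set_borel_measurable_def)
  have "((\<lambda>\<tau>. LINT l|lborel. indicator {0<..} l *\<^sub>R (gamma_tail m (a * l) \<tau> * f l)) \<longlongrightarrow> (LINT l|(lborel::real measure). 0)) at_top"
  proof (rule integral_dominated_convergence_at_top)
    show "integrable lborel ?w" using int unfolding set_integrable_def by (rule integrable_mult_right)
    have "(\<lambda>l. gamma_tail m (a * l) \<tau> * (indicator {0<..} l *\<^sub>R f l)) \<in> borel_measurable lborel" for \<tau> by measurable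
    then show "(\<lambda>l. indicator {0<..} l *\<^sub>R (gamma_tail m (a * l) \<tau> * f l)) \<in> borel_measurable lborel" for \<tau>
      by (simp add: mult_ac)
    show "\<forall>\<^sub>F \<tau> in at_top. AE l in lborel. norm (indicator {0<..} l *\<^sub>R (gamma_tail m (a * l) \<tau> * f l)) \<le> ?w l"
      using eventually_ge_at_top[of 0]
    proof eventually_elim
      case (elim \<tau>)
      show ?case
      proof (rule AE_I2)
        fix l :: real
        show "norm (indicator {0<..} l *\<^sub>R (gamma_tail m (a * l) \<tau> * f l)) \<le> ?w l"
        proof (cases "0 < l")
          case True
          then have "gamma_tail m (a * l) \<tau> * f l \<le> fact m / (a * l) ^ (m + 1) * f l"
            using a elim f(2) by (intro mult_right_mono gamma_tail_le) auto
          also have "\<dots> = ?w l" using True by (simp add: power_mult_distrib field_simps)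
          finally show ?thesis using True a elim f(2)[OF True] gamma_tail_nonneg[of "a * l" \<tau> m] by simp
        qed simp
      qed
    qed
    show "AE l in lborel. ((\<lambda>\<tau>. indicator {0<..} l *\<^sub>R (gamma_tail m (a * l) \<tau> * f l)) \<longlongrightarrow> 0) at_top"
    proof (rule AE_I2)
      fix l :: real
      show "((\<lambda>\<tau>. indicator {0<..} l *\<^sub>R (gamma_tail m (a * l) \<tau> * f l)) \<longlongrightarrow> 0) at_top"
      proof (cases "0 < l")
        case True
        have "((\<lambda>\<tau>. gamma_tail m (a * l) \<tau> * f l) \<longlongrightarrow> 0 * f l) at_top"
          using a True by (intro tendsto_mult tendsto_const gamma_tail_tendsto_0) simp
        then show ?thesis using True by simp
      qed simp
    qed
  qed simp
  then show ?thesis by (simp add: set_lebesgue_integral_def)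
qed

text \<open>
  The integrals in the statement, with \<open>a = 1\<close> for first moments and \<open>a = 2\<close> for second moments of the kernel.
\<close>
definition rate_integral :: "nat \<Rightarrow> (real \<Rightarrow> real) \<Rightarrow> real \<Rightarrow> real \<Rightarrow> real" where
  "rate_integral m f a \<tau> = (LBINT l:{0<..}. gamma_tail m (a * l) \<tau> * f l)"

context levy_basis_space
begin

lemma kernel_tail_integral:
  fixes f :: "real \<Rightarrow> real" and p :: "real \<times> (real ^ 'm)"
  assumes c: "0 < c" and \<tau>: "0 < \<tau>" and j: "0 < j"
    and pi: "\<pi> = density lborel (\<lambda>l. ennreal (indicator {0<..} l * f l))"
    and f: "set_borel_measurable borel {0<..} f" "\<And>l. 0 < l \<Longrightarrow> 0 \<le> f l"
    and int: "set_integrable lborel {0<..} (\<lambda>l. f l / l ^ (CARD('m) + 1))"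
    and ker: "mstou_kernel c p \<in> borel_measurable borel"
  shows "set_integrable \<mu> (- near_cone c \<tau> p) (\<lambda>z. mstou_kernel c p z ^ j)"
    "(LINT z:- near_cone c \<tau> p|\<mu>. mstou_kernel c p z ^ j) =
      ball_volume CARD('m) c * rate_integral CARD('m) f (real j) \<tau>"
proof -
  let ?m = "CARD('m)"
  let ?N = "near_cone c \<tau> p"
  let ?S = "{w \<in> ambit_set c p. fst w \<le> fst p - \<tau>}"
  define k where "k z = indicator (- ?N) z *\<^sub>R mstou_kernel c p z ^ j" for z
  have N: "- ?N \<in> sets borel" using near_cone_borel by (metis Compl_eq_Diff_UNIV sets.compl_sets space_borel)
  have k_m: "k \<in> borel_measurable borel"
    unfolding k_def[abs_def] using ker by (intro borel_measurable_scaleR borel_measurable_indicator N borel_measurable_power)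
  have k_eq: "k (l, w) = exp (- (real j * l * (fst p - fst w))) * indicator ?S w" for l w
  proof (cases "w \<in> ambit_set c p")
    case True
    then show ?thesis
      using exp_of_nat_mult[of j "- l * (fst p - fst w)"]
      by (auto simp: k_def near_cone_def mstou_kernel_eq indicator_def mult_ac)
  next
    case False
    then show ?thesis using j by (simp add: k_def mstou_kernel_eq)
  qed
  have k0: "0 \<le> k z" for z by (cases z) (simp add: k_eq)
  let ?I = "\<lambda>l. gamma_tail ?m (real j * l) \<tau> * f l"
  have j': "0 < real j" using j by simp
  have iI: "integrable lborel (\<lambda>l. indicator {0<..} l *\<^sub>R ?I l)"
    using gamma_tail_set_integrable[OF j' less_imp_le[OF \<tau>] f int] by (simp add: set_integrable_def)
  have fm: "(\<lambda>l. indicator {0<..} l * f l) \<in> borel_measurable borel"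
    using f(1) by (simp add: set_borel_measurable_def)
  have km: "(\<lambda>z. ennreal (k z)) \<in> borel_measurable \<mu>"
    unfolding measurable_cong_sets[OF sets_mu refl] using k_m by (rule measurable_compose) simp
  have inner_m: "(\<lambda>l. \<integral>\<^sup>+w. ennreal (k (l, w)) \<partial>lborel) \<in> borel_measurable borel"
    using lborel.borel_measurable_nn_integral_fst[OF km] unfolding measurable_cong_sets[OF sets_pi refl] .
  have "(\<integral>\<^sup>+z. ennreal (k z) \<partial>\<mu>) = (\<integral>\<^sup>+l. \<integral>\<^sup>+w. ennreal (k (l, w)) \<partial>lborel \<partial>\<pi>)"
    by (rule lborel.nn_integral_fst[OF km, symmetric])
  also have "\<dots> = (\<integral>\<^sup>+l. ennreal (indicator {0<..} l * f l) * (\<integral>\<^sup>+w. ennreal (k (l, w)) \<partial>lborel) \<partial>lborel)"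
    by (subst pi, rule nn_integral_density) (use fm inner_m in auto)
  also have "\<dots> = (\<integral>\<^sup>+l. ennreal (ball_volume ?m c * (indicator {0<..} l *\<^sub>R ?I l)) \<partial>lborel)"
  proof (rule nn_integral_cong)
    fix l :: real
    show "ennreal (indicator {0<..} l * f l) * (\<integral>\<^sup>+w. ennreal (k (l, w)) \<partial>lborel) =
        ennreal (ball_volume ?m c * (indicator {0<..} l *\<^sub>R ?I l))"
    proof (cases "0 < l")
      case True
      have jl: "0 < real j * l" using True j' by simp
      have "(\<integral>\<^sup>+w. ennreal (k (l, w)) \<partial>lborel) = (\<integral>\<^sup>+w. ennreal (exp (- (real j * l * (fst p - fst w)))) * indicator ?S w \<partial>lborel)"
        unfolding k_eq by (intro nn_integral_cong) (simp add: indicator_def)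
      also have "\<dots> = ennreal (ball_volume ?m c * gamma_tail ?m (real j * l) \<tau>)"
        by (rule nn_integral_cone_tail[OF c \<tau> jl])
      finally have eq: "(\<integral>\<^sup>+w. ennreal (k (l, w)) \<partial>lborel) = ennreal (ball_volume ?m c * gamma_tail ?m (real j * l) \<tau>)" .
      have "0 \<le> ball_volume ?m c * gamma_tail ?m (real j * l) \<tau>"
        using ball_volume_nonneg[OF c] gamma_tail_nonneg[OF jl less_imp_le[OF \<tau>]] by simp
      then show ?thesis unfolding eq using True f(2)[OF True] by (simp add: mult_ac flip: ennreal_mult)
    qed simp
  qed
  also have "\<dots> = ennreal (LINT l|lborel. ball_volume ?m c * (indicator {0<..} l *\<^sub>R ?I l))"
  proof (rule nn_integral_eq_integral)
    show "integrable lborel (\<lambda>l. ball_volume ?m c * (indicator {0<..} l *\<^sub>R ?I l))" using iI by (rule integrable_mult_right)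
    show "AE l in lborel. 0 \<le> ball_volume ?m c * (indicator {0<..} l *\<^sub>R ?I l)"
    proof (rule AE_I2)
      fix l :: real
      show "0 \<le> ball_volume ?m c * (indicator {0<..} l *\<^sub>R ?I l)"
        using ball_volume_nonneg[OF c] gamma_tail_nonneg[of "real j * l" \<tau> ?m] \<tau> j' f(2)[of l]
        by (cases "0 < l") (auto intro!: mult_nonneg_nonneg)
    qed
  qed
  also have "(LINT l|lborel. ball_volume ?m c * (indicator {0<..} l *\<^sub>R ?I l)) = ball_volume ?m c * (LBINT l:{0<..}. ?I l)"
    unfolding set_lebesgue_integral_def by (rule integral_mult_right_zero)
  finally have nn: "(\<integral>\<^sup>+z. ennreal (k z) \<partial>\<mu>) = ennreal (ball_volume ?m c * (LBINT l:{0<..}. ?I l))" .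
  have J0: "0 \<le> ball_volume ?m c * (LBINT l:{0<..}. ?I l)"
    unfolding set_lebesgue_integral_def
  proof (intro mult_nonneg_nonneg ball_volume_nonneg c integral_nonneg_AE AE_I2)
    fix l :: real
    show "0 \<le> indicator {0<..} l *\<^sub>R ?I l"
      using gamma_tail_nonneg[of "real j * l" \<tau> ?m] \<tau> j' f(2)[of l]
      by (cases "0 < l") (auto intro!: mult_nonneg_nonneg)
  qed
  have k_mu: "k \<in> borel_measurable \<mu>" unfolding measurable_mu_iff by (rule k_m)
  have hb: "has_bochner_integral \<mu> k (ball_volume ?m c * (LBINT l:{0<..}. ?I l))"
    by (rule has_bochner_integral_nn_integral[OF k_mu _ J0 nn]) (simp add: k0)
  from integrable.intros[OF hb] show "set_integrable \<mu> (- ?N) (\<lambda>z. mstou_kernel c p z ^ j)"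
    unfolding set_integrable_def k_def[abs_def] .
  from has_bochner_integral_integral_eq[OF hb]
  show "(LINT z:- ?N|\<mu>. mstou_kernel c p z ^ j) = ball_volume ?m c * rate_integral ?m f (real j) \<tau>"
    unfolding rate_integral_def set_lebesgue_integral_def k_def[abs_def] .
qed

end

section \<open>Mixed spatio-temporal Ornstein-Uhlenbeck processes\<close>

lemma levy_measure_square_integrable:
  assumes "levy_measure \<nu>" "set_integrable \<nu> {x. 1 < \<bar>x\<bar>} (\<lambda>x. x\<^sup>2)"
  shows "integrable \<nu> (\<lambda>x. x\<^sup>2)"
proof (rule Bochner_Integration.integrable_bound)
  show "integrable \<nu> (\<lambda>x. min 1 (x\<^sup>2) + indicator {x. 1 < \<bar>x\<bar>} x *\<^sub>R x\<^sup>2)"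
    using assms by (intro Bochner_Integration.integrable_add) (auto simp: levy_measure_def set_integrable_def)
  have "sets \<nu> = sets borel" using assms by (simp add: levy_measure_def)
  then have "borel_measurable \<nu> = (borel_measurable borel :: (real \<Rightarrow> real) set)" by (rule measurable_cong_sets) simp
  then show "(\<lambda>x. x\<^sup>2) \<in> borel_measurable \<nu>" by simp
  show "AE x in \<nu>. norm (x\<^sup>2) \<le> norm (min 1 (x\<^sup>2) + indicator {x. 1 < \<bar>x\<bar>} x *\<^sub>R x\<^sup>2)"
  proof (rule AE_I2)
    fix x :: real
    show "norm (x\<^sup>2) \<le> norm (min 1 (x\<^sup>2) + indicator {x. 1 < \<bar>x\<bar>} x *\<^sub>R x\<^sup>2)"
      using abs_square_le_1[of x] by (cases "1 < \<bar>x\<bar>") (auto simp: min_def)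
  qed
qed

text \<open>
  The time \<open>\<tau>\<close> at which the cone is cut.
\<close>
definition cut_depth :: "nat \<Rightarrow> real \<Rightarrow> real \<Rightarrow> real" where
  "cut_depth m c h = (if c \<le> 1 then psi m c h else psi m c h / c)"

lemma psi_eq: "psi m c h = h / (sqrt (c\<^sup>2 + 1) * sqrt (real m + 1))"
  by (simp add: psi_def)

text \<open>
  With \<open>D = sqrt ((c\<^sup>2 + 1) * (m + 1))\<close>, the assumption \<open>m \<ge> 1\<close> gives \<open>D\<^sup>2 \<ge> 2 * (c\<^sup>2 + 1)\<close>. This is at least \<open>(2 * c)\<^sup>2\<close> for
  \<open>c \<le> 1\<close>, and at least \<open>2\<^sup>2\<close> for \<open>c > 1\<close>.
\<close>
lemma cut_depth_bounds:
  assumes c: "0 < c" and h: "0 < h" and m: "1 \<le> m"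
  shows "0 < cut_depth m c h" "cut_depth m c h \<le> h" "2 * c * cut_depth m c h \<le> h"
proof -
  define D where "D = sqrt (c\<^sup>2 + 1) * sqrt (real m + 1)"
  have cpos: "0 < c\<^sup>2 + 1" using zero_le_power2[of c] by linarith
  have D0: "0 < D" unfolding D_def by (intro mult_pos_pos real_sqrt_gt_zero cpos) simp
  have "D\<^sup>2 = (sqrt (c\<^sup>2 + 1))\<^sup>2 * (sqrt (real m + 1))\<^sup>2" unfolding D_def by (rule power_mult_distrib)
  also have "\<dots> = (c\<^sup>2 + 1) * (real m + 1)" using cpos by simp
  finally have D2: "D\<^sup>2 = (c\<^sup>2 + 1) * (real m + 1)" .
  have "2 \<le> real m + 1" using m by simp
  then have "(c\<^sup>2 + 1) * 2 \<le> D\<^sup>2" unfolding D2 using cpos by (intro mult_left_mono) linarith+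
  moreover have "(c\<^sup>2 + 1) * 2 = 2 * c\<^sup>2 + 2" by simp
  ultimately have D2': "2 * c\<^sup>2 + 2 \<le> D\<^sup>2" by (simp only:)
  have "1 \<le> D\<^sup>2" using D2' zero_le_power2[of c] by linarith
  then have "1\<^sup>2 \<le> D\<^sup>2" by simp
  then have D1: "1 \<le> D" by (rule power2_le_imp_le) (use D0 in linarith)
  have "0 < cut_depth m c h \<and> cut_depth m c h \<le> h \<and> 2 * c * cut_depth m c h \<le> h"
  proof (cases "c \<le> 1")
    case True
    have "c\<^sup>2 \<le> 1" using c True by (intro power_le_one) linarith+
    then have "4 * c\<^sup>2 \<le> D\<^sup>2" using D2' by linarith
    moreover have "(2 * c)\<^sup>2 = 4 * c\<^sup>2" by simp
    ultimately have "(2 * c)\<^sup>2 \<le> D\<^sup>2" by (simp only:)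
    then have "2 * c \<le> D" by (rule power2_le_imp_le) (use D0 in linarith)
    then have 2: "h * (2 * c) \<le> h * D" using h by (intro mult_left_mono) linarith+
    have 1: "h * 1 \<le> h * D" using D1 h by (intro mult_left_mono) linarith+
    have cut: "cut_depth m c h = h / D" using True by (simp add: cut_depth_def psi_eq D_def)
    have "0 < h / D" using h D0 by (rule divide_pos_pos)
    moreover have "h / D \<le> h" unfolding pos_divide_le_eq[OF D0] using 1 by linarith
    moreover have "h * (2 * c) / D \<le> h" unfolding pos_divide_le_eq[OF D0] by (rule 2)
    moreover have "2 * c * (h / D) = h * (2 * c) / D" by simp
    ultimately show ?thesis unfolding cut by (simp only:)
  next
    case False
    then have c1: "1 < c" by simp
    then have "1 \<le> c\<^sup>2" by (intro one_le_power) linarith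
    then have "4 \<le> D\<^sup>2" using D2' by linarith
    then have "2\<^sup>2 \<le> D\<^sup>2" by simp
    then have "2 \<le> D" by (rule power2_le_imp_le) (use D0 in linarith)
    then have 2: "h * 2 \<le> h * D" using h by (intro mult_left_mono) linarith+
    have Dc: "0 < D * c" using D0 c by (rule mult_pos_pos)
    have "1 * 1 \<le> D * c" using D1 c1 by (intro mult_mono) linarith+
    then have 1: "h * 1 \<le> h * (D * c)" using h by (intro mult_left_mono) linarith+
    have cut: "cut_depth m c h = h / (D * c)" using False by (simp add: cut_depth_def psi_eq D_def)
    have "0 < h / (D * c)" using h Dc by (rule divide_pos_pos)
    moreover have "h / (D * c) \<le> h" unfolding pos_divide_le_eq[OF Dc] using 1 by linarith
    moreover have "h * 2 / D \<le> h" unfolding pos_divide_le_eq[OF D0] by (rule 2)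
    moreover have "2 * c * (h / (D * c)) = h * 2 / D" using c1 by simp
    ultimately show ?thesis unfolding cut by (simp only:)
  qed
  then show "0 < cut_depth m c h" "cut_depth m c h \<le> h" "2 * c * cut_depth m c h \<le> h" by auto
qed

lemma cut_depth_at_top: "0 < c \<Longrightarrow> filterlim (cut_depth m c) at_top at_top"
proof -
  assume c: "0 < c"
  define a where "a = (if c \<le> 1 then 1 else 1 / c) / (sqrt (c\<^sup>2 + 1) * sqrt (real m + 1))"
  have "0 < sqrt (c\<^sup>2 + 1) * sqrt (real m + 1)" by (simp add: add_nonneg_pos)
  then have a: "0 < a" unfolding a_def using c by (intro divide_pos_pos) auto
  have eq: "cut_depth m c = (\<lambda>h. a * h)" by (auto simp: fun_eq_iff cut_depth_def psi_eq a_def)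
  show ?thesis unfolding eq by (rule filterlim_tendsto_pos_mult_at_top[OF tendsto_const a filterlim_ident])
qed

lemma weakly_dependent_if_le:
  assumes le: "\<And>h. 0 < h \<Longrightarrow> theta_lex M Y h \<le> ennreal (B h)" and B: "(B \<longlongrightarrow> 0) at_top"
  shows "theta_lex_weakly_dependent M Y"
  unfolding theta_lex_weakly_dependent_def
proof (rule tendsto_sandwich[OF _ _ tendsto_const])
  show "((\<lambda>h. ennreal (B h)) \<longlongrightarrow> 0) at_top" using tendsto_ennrealI[OF B] by simp
  show "\<forall>\<^sub>F h in at_top. theta_lex M Y h \<le> ennreal (B h)"
    using eventually_gt_at_top[of 0] by eventually_elim (rule le)
qed simp

locale MSTOU =
  fixes M :: "'w measure"
    and \<Lambda> :: "(real \<times> real \<times> (real ^ 'm::{finite,linorder})) set \<Rightarrow> 'w \<Rightarrow> real"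
    and Y :: "real \<times> (real ^ 'm::{finite,linorder}) \<Rightarrow> 'w \<Rightarrow> real"
    and \<gamma> S c :: real and \<nu> \<pi> :: "real measure" and f :: "real \<Rightarrow> real"
  assumes c: "c > 0" and Y: "c_class_MSTOU M \<Lambda> \<gamma> S \<nu> \<pi> f c Y"
begin

lemmas c_class = Y[unfolded c_class_MSTOU_def]

lemma density: "\<pi> = density lborel (\<lambda>l. ennreal (indicator {0<..} l * f l))"
    "set_borel_measurable borel {0<..} f" "\<And>l. 0 < l \<Longrightarrow> 0 \<le> f l"
    "set_integrable lborel {0<..} (\<lambda>l. f l / l ^ (CARD('m) + 1))"
proof -
  note C = c_class[THEN conjunct2, THEN conjunct2]
  note D = C[THEN conjunct2, THEN conjunct2]
  show "\<pi> = density lborel (\<lambda>l. ennreal (indicator {0<..} l * f l))" by (rule D[THEN conjunct1])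
  show "set_borel_measurable borel {0<..} f" by (rule C[THEN conjunct1])
  show "0 \<le> f l" if "0 < l" for l using C[THEN conjunct2, THEN conjunct1] that by simp
  show "set_integrable lborel {0<..} (\<lambda>l. f l / l ^ (CARD('m) + 1))" by (rule D[THEN conjunct2, THEN conjunct1])
qed

lemma basis: "levy_basis_space \<gamma> S \<nu> M \<Lambda> \<pi>"
proof -
  note b = c_class[THEN conjunct1] and sq = c_class[THEN conjunct2, THEN conjunct1]
  note S = b[unfolded levy_basis_def, THEN conjunct2, THEN conjunct1]
  note \<nu> = b[unfolded levy_basis_def, THEN conjunct2, THEN conjunct2, THEN conjunct1]
  show ?thesis
    unfolding levy_basis_space_def levy_basis_space_axioms_def levy_triplet_def
    using S b levy_measure_square_integrable[OF \<nu> sq] \<nu>[unfolded levy_measure_def] by blast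
qed

lemma field: "linear_field \<gamma> S \<nu> M \<Lambda> \<pi> (mstou_kernel c) Y"
proof -
  have "\<forall>p. has_levy_integral M \<Lambda> (\<pi> \<Otimes>\<^sub>M lborel) (mstou_kernel c p) (Y p)"
    by (rule c_class[THEN conjunct2, THEN conjunct2, THEN conjunct2, THEN conjunct2, THEN conjunct2, THEN conjunct2])
  then show ?thesis
    unfolding linear_field_def linear_field_axioms_def using basis by (intro conjI) assumption+
qed

lemma kernel_vanishes:
  assumes "q \<in> lex_past_dist p h" "z \<in> near_cone c (cut_depth CARD('m) c h) p" "0 < h"
  shows "mstou_kernel c q z = 0"
proof -
  have m: "1 \<le> CARD('m)" by (simp add: Suc_le_eq)
  have "snd z \<notin> ambit_set c q"
    by (rule near_cone_disjoint[OF assms(1) cut_depth_bounds(2,3)[OF c assms(3) m] c assms(2)])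
  then show ?thesis by (simp add: mstou_kernel_eq)
qed

lemma rate_integral_tendsto_0: "0 < j \<Longrightarrow> ((\<lambda>h. rate_integral CARD('m) f j (cut_depth CARD('m) c h)) \<longlongrightarrow> 0) at_top"
  by (rule filterlim_compose[OF gamma_tail_integral_tendsto_0[OF _ density(2,3,4), folded rate_integral_def] cut_depth_at_top[OF c]])

lemma theta_lex_le_centred:
  assumes centred: "\<gamma> + (LINT x:{x. 1 < \<bar>x\<bar>}|\<nu>. x) = 0" and h: "0 < h"
  shows "theta_lex M Y h \<le> ennreal (2 * sqrt (ball_volume CARD('m) c * Sigma_L S \<nu> * rate_integral CARD('m) f 2 (cut_depth CARD('m) c h)))"
proof (rule theta_lex_le[OF field near_cone_borel kernel_vanishes[OF _ _ h]])
  interpret levy_basis_space \<gamma> S \<nu> M \<Lambda> \<pi> by (rule basis)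
  fix p \<phi> assume \<phi>: "levy_approx \<phi> (mstou_kernel c p)"
  let ?\<tau> = "cut_depth CARD('m) c h"
  have \<tau>: "0 < ?\<tau>" using cut_depth_bounds(1)[OF c h] by (simp add: Suc_le_eq)
  have N: "- near_cone c ?\<tau> p \<in> sets borel" using near_cone_borel by (metis Compl_eq_Diff_UNIV sets.compl_sets space_borel)
  note t = kernel_tail_integral[OF c \<tau> pos2 density levy_approx_measurable[OF \<phi>]]
  note b = first_moment_levy_limit_centred[OF \<phi> N centred t(1)]
  show "integrable M (levy_limit \<phi> (- near_cone c ?\<tau> p)) \<and>
      (LINT \<omega>|M. \<bar>levy_limit \<phi> (- near_cone c ?\<tau> p) \<omega>\<bar>) \<le> sqrt (ball_volume CARD('m) c * Sigma_L S \<nu> * rate_integral CARD('m) f 2 ?\<tau>)"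
  proof -
    have "(LINT z:- near_cone c ?\<tau> p|\<mu>. (mstou_kernel c p z)\<^sup>2) = ball_volume CARD('m) c * rate_integral CARD('m) f 2 ?\<tau>"
      using t(2) by (simp only: of_nat_numeral)
    then have "Sigma_L S \<nu> * (LINT z:- near_cone c ?\<tau> p|\<mu>. (mstou_kernel c p z)\<^sup>2) =
        ball_volume CARD('m) c * Sigma_L S \<nu> * rate_integral CARD('m) f 2 ?\<tau>" by (simp only: mult_ac)
    with b show ?thesis by (simp only: simp_thms)
  qed
qed

lemma theta_lex_le_finite_variation:
  assumes fv: "integrable \<nu> (\<lambda>x. \<bar>x\<bar>)" "S = 0" and h: "0 < h"
  shows "theta_lex M Y h \<le> ennreal (2 * (ball_volume CARD('m) c * gamma_abs \<gamma> \<nu> * rate_integral CARD('m) f 1 (cut_depth CARD('m) c h)))"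
proof (rule theta_lex_le[OF field near_cone_borel kernel_vanishes[OF _ _ h]])
  interpret levy_basis_space \<gamma> S \<nu> M \<Lambda> \<pi> by (rule basis)
  interpret finite_variation_basis \<gamma> S \<nu> M \<Lambda> \<pi> using fv by unfold_locales auto
  fix p \<phi> assume \<phi>: "levy_approx \<phi> (mstou_kernel c p)"
  let ?\<tau> = "cut_depth CARD('m) c h"
  have \<tau>: "0 < ?\<tau>" using cut_depth_bounds(1)[OF c h] by (simp add: Suc_le_eq)
  have N: "- near_cone c ?\<tau> p \<in> sets borel" using near_cone_borel by (metis Compl_eq_Diff_UNIV sets.compl_sets space_borel)
  note t = kernel_tail_integral[OF c \<tau> zero_less_one density levy_approx_measurable[OF \<phi>], simplified]
  have "\<bar>mstou_kernel c p z\<bar> = mstou_kernel c p z" for z by (simp add: mstou_kernel_eq)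
  then show "integrable M (levy_limit \<phi> (- near_cone c ?\<tau> p)) \<and>
      (LINT \<omega>|M. \<bar>levy_limit \<phi> (- near_cone c ?\<tau> p) \<omega>\<bar>) \<le> ball_volume CARD('m) c * gamma_abs \<gamma> \<nu> * rate_integral CARD('m) f 1 ?\<tau>"
    using first_moment_levy_limit[OF \<phi> N t(1)] by (simp add: t(2) mult_ac)
qed

lemma weakly_dependent_centred:
  assumes "\<gamma> + (LINT x:{x. 1 < \<bar>x\<bar>}|\<nu>. x) = 0"
  shows "theta_lex_weakly_dependent M Y"
proof (rule weakly_dependent_if_le[OF theta_lex_le_centred[OF assms]])
  have "((\<lambda>h. 2 * sqrt (ball_volume CARD('m) c * Sigma_L S \<nu> * rate_integral CARD('m) f 2 (cut_depth CARD('m) c h))) \<longlongrightarrow>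
      2 * sqrt (ball_volume CARD('m) c * Sigma_L S \<nu> * 0)) at_top"
    by (intro tendsto_mult tendsto_const tendsto_real_sqrt rate_integral_tendsto_0) simp
  then show "((\<lambda>h. 2 * sqrt (ball_volume CARD('m) c * Sigma_L S \<nu> * rate_integral CARD('m) f 2 (cut_depth CARD('m) c h))) \<longlongrightarrow> 0) at_top" by simp
qed

lemma weakly_dependent_finite_variation:
  assumes "integrable \<nu> (\<lambda>x. \<bar>x\<bar>)" "S = 0"
  shows "theta_lex_weakly_dependent M Y"
proof (rule weakly_dependent_if_le[OF theta_lex_le_finite_variation[OF assms]])
  have "((\<lambda>h. 2 * (ball_volume CARD('m) c * gamma_abs \<gamma> \<nu> * rate_integral CARD('m) f 1 (cut_depth CARD('m) c h))) \<longlongrightarrow>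
      2 * (ball_volume CARD('m) c * gamma_abs \<gamma> \<nu> * 0)) at_top"
    by (intro tendsto_mult tendsto_const rate_integral_tendsto_0) simp
  then show "((\<lambda>h. 2 * (ball_volume CARD('m) c * gamma_abs \<gamma> \<nu> * rate_integral CARD('m) f 1 (cut_depth CARD('m) c h))) \<longlongrightarrow> 0) at_top" by simp
qed

end

lemma ball_volume_1: "ball_volume 1 c = 2 * c"
  by (simp add: ball_volume_eq unit_ball_vol_1)

lemma set_integral_cong_mult:
  fixes F G :: "real \<Rightarrow> real"
  assumes "\<And>l. 0 < l \<Longrightarrow> F l = a * G l"
  shows "(LBINT l:{0<..}. F l) = a * (LBINT l:{0<..}. G l :: real)"
proof -
  have "(LBINT l:{0<..}. F l) = (LBINT l:{0<..}. a * G l)"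
    by (rule set_lebesgue_integral_cong) (auto simp: assms)
  then show ?thesis by simp
qed

theorem theorem3p29:
  fixes M :: "'w measure"
    and \<Lambda> :: "(real \<times> real \<times> (real ^ 'm::{finite,linorder})) set \<Rightarrow> 'w \<Rightarrow> real"
    and Y :: "real \<times> (real ^ 'm::{finite,linorder}) \<Rightarrow> 'w \<Rightarrow> real"
    and \<gamma> S c :: real
    and \<nu> \<pi> :: "real measure"
    and f :: "real \<Rightarrow> real"
    and m :: nat
  assumes m: "m = CARD('m)"
    and c: "c > 0"
    and Y: "c_class_MSTOU M \<Lambda> \<gamma> S \<nu> \<pi> f c Y"
  shows
    "(set_integrable \<nu> {x. 1 < \<bar>x\<bar>} (\<lambda>x. x\<^sup>2) \<and> \<gamma> + (LINT x:{x. 1 < \<bar>x\<bar>}|\<nu>. x) = 0 \<longrightarrow>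
        theta_lex_weakly_dependent M Y \<and>
        (\<forall>h>0.
          (c \<le> 1 \<longrightarrow>
            (m = 1 \<longrightarrow>
              theta_lex M Y h \<le> ennreal (sqrt (2 * c * Sigma_L S \<nu> *
                (LBINT l:{0<..}. (2 * l * psi m c h + 1) / l\<^sup>2 *
                   exp (- 2 * l * psi m c h) * f l)))) \<and>
            (m \<ge> 2 \<longrightarrow>
              theta_lex M Y h \<le> ennreal (2 * sqrt (ball_volume m c * Sigma_L S \<nu> *
                (LBINT l:{0<..}.
                   fact m * (\<Sum>k=0..m. 1 / fact k * (2 * l * psi m c h) ^ k) / (2 * l) ^ (m + 1) *
                   exp (- 2 * l * psi m c h) * f l))))) \<and>
          (c > 1 \<longrightarrow>
            (m = 1 \<longrightarrow>
              theta_lex M Y h \<le> ennreal (2 * sqrt (c * Sigma_L S \<nu> *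
                (LBINT l:{0<..}. (2 * l * (psi m c h / c) + 1) / (2 * l\<^sup>2) *
                   exp (- 2 * l * (psi m c h / c)) * f l)))) \<and>
            (m \<ge> 2 \<longrightarrow>
              theta_lex M Y h \<le> ennreal (2 * sqrt (ball_volume m c * Sigma_L S \<nu> *
                (LBINT l:{0<..}.
                   fact m * (\<Sum>k=0..m. 1 / fact k * (2 * (l * psi m c h / c)) ^ k) / (2 * l) ^ (m + 1) *
                   exp (- 2 * (l * psi m c h / c)) * f l)))))))
     \<and>
     (integrable \<nu> (\<lambda>x. \<bar>x\<bar>) \<and> S = 0 \<longrightarrow>
        theta_lex_weakly_dependent M Y \<and>
        (\<forall>h>0.
          (c \<le> 1 \<longrightarrow>
            theta_lex M Y h \<le> ennreal (2 * ball_volume m c * gamma_abs \<gamma> \<nu> *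
              (LBINT l:{0<..}.
                 fact m * (\<Sum>k=0..m. 1 / fact k * (l * psi m c h) ^ k) / l ^ (m + 1) *
                 exp (- l * psi m c h) * f l))) \<and>
          (c > 1 \<longrightarrow>
            theta_lex M Y h \<le> ennreal (2 * ball_volume m c * gamma_abs \<gamma> \<nu> *
              (LBINT l:{0<..}.
                 fact m * (\<Sum>k=0..m. 1 / fact k * (l * psi m c h / c) ^ k) / l ^ (m + 1) *
                 exp (- (l * psi m c h / c)) * f l)))))"
proof -
  interpret MSTOU M \<Lambda> Y \<gamma> S c \<nu> \<pi> f by (unfold_locales) (rule c, rule Y)
  let ?I = "rate_integral m f"
  have depth: "cut_depth m c h = psi m c h" if "c \<le> 1" for h using that by (simp add: cut_depth_def)
  have depth': "cut_depth m c h = psi m c h / c" if "c > 1" for h using that by (simp add: cut_depth_def)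
  \<comment> \<open>In dimension one the factor 2 in front moves under the root, and the ball has volume \<open>2 * c\<close>.\<close>
  have dim1: "2 * sqrt (ball_volume m c * Sigma_L S \<nu> * ?I 2 \<tau>) = sqrt (2 * c * Sigma_L S \<nu> *
      (LBINT l:{0<..}. (2 * l * \<tau> + 1) / l\<^sup>2 * exp (- 2 * l * \<tau>) * f l))" if "m = 1" for \<tau>
  proof -
    have "(LBINT l:{0<..}. (2 * l * \<tau> + 1) / l\<^sup>2 * exp (- 2 * l * \<tau>) * f l) = 4 * ?I 2 \<tau>"
      unfolding rate_integral_def by (rule set_integral_cong_mult) (simp add: gamma_tail_def that power2_eq_square field_simps)
    moreover have "2 * sqrt (ball_volume m c * Sigma_L S \<nu> * ?I 2 \<tau>) = sqrt (4 * (ball_volume m c * Sigma_L S \<nu> * ?I 2 \<tau>))"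
      by (simp only: real_sqrt_mult real_sqrt_four)
    ultimately show ?thesis using that by (simp add: ball_volume_1[unfolded One_nat_def] mult_ac)
  qed
  have dim1': "ball_volume m c * Sigma_L S \<nu> * ?I 2 \<tau> = c * Sigma_L S \<nu> *
      (LBINT l:{0<..}. (2 * l * \<tau> + 1) / (2 * l\<^sup>2) * exp (- 2 * l * \<tau>) * f l)" if "m = 1" for \<tau>
  proof -
    have "(LBINT l:{0<..}. (2 * l * \<tau> + 1) / (2 * l\<^sup>2) * exp (- 2 * l * \<tau>) * f l) = 2 * ?I 2 \<tau>"
      unfolding rate_integral_def by (rule set_integral_cong_mult) (simp add: gamma_tail_def that power2_eq_square field_simps)
    then show ?thesis using that by (simp add: ball_volume_1[unfolded One_nat_def])
  qed
  have dim: "?I 2 \<tau> = (LBINT l:{0<..}. fact m * (\<Sum>k=0..m. 1 / fact k * (2 * l * \<tau>) ^ k) / (2 * l) ^ (m + 1) *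
      exp (- 2 * l * \<tau>) * f l)" for \<tau>
    by (simp add: rate_integral_def gamma_tail_def)
  have dim': "?I 2 (x / c) = (LBINT l:{0<..}. fact m * (\<Sum>k=0..m. 1 / fact k * (2 * (l * x / c)) ^ k) / (2 * l) ^ (m + 1) *
      exp (- 2 * (l * x / c)) * f l)" for x
    by (simp add: rate_integral_def gamma_tail_def mult.assoc)
  have fv: "?I 1 \<tau> = (LBINT l:{0<..}. fact m * (\<Sum>k=0..m. 1 / fact k * (l * \<tau>) ^ k) / l ^ (m + 1) *
      exp (- l * \<tau>) * f l)" for \<tau>
    by (simp add: rate_integral_def gamma_tail_def)
  have fv': "?I 1 (x / c) = (LBINT l:{0<..}. fact m * (\<Sum>k=0..m. 1 / fact k * (l * x / c) ^ k) / l ^ (m + 1) *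
      exp (- (l * x / c)) * f l)" for x
    by (simp add: rate_integral_def gamma_tail_def)
  note centred = theta_lex_le_centred[folded m]
  note finite_variation = theta_lex_le_finite_variation[folded m]
  show ?thesis
  proof (intro conjI impI allI; (elim conjE)?)
    fix h :: real assume a: "\<gamma> + (LINT x:{x. 1 < \<bar>x\<bar>}|\<nu>. x) = 0" and h: "0 < h"
    note b = centred[OF a h]
    show "theta_lex M Y h \<le> ennreal (sqrt (2 * c * Sigma_L S \<nu> *
        (LBINT l:{0<..}. (2 * l * psi m c h + 1) / l\<^sup>2 * exp (- 2 * l * psi m c h) * f l)))" if "c \<le> 1" "m = 1"
      using b unfolding depth[OF that(1)] dim1[OF that(2)] .
    show "theta_lex M Y h \<le> ennreal (2 * sqrt (ball_volume m c * Sigma_L S \<nu> *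
        (LBINT l:{0<..}. fact m * (\<Sum>k=0..m. 1 / fact k * (2 * l * psi m c h) ^ k) / (2 * l) ^ (m + 1) *
           exp (- 2 * l * psi m c h) * f l)))" if "c \<le> 1"
      using b unfolding depth[OF that] dim .
    show "theta_lex M Y h \<le> ennreal (2 * sqrt (c * Sigma_L S \<nu> *
        (LBINT l:{0<..}. (2 * l * (psi m c h / c) + 1) / (2 * l\<^sup>2) * exp (- 2 * l * (psi m c h / c)) * f l)))" if "c > 1" "m = 1"
      using b unfolding depth'[OF that(1)] dim1'[OF that(2)] .
    show "theta_lex M Y h \<le> ennreal (2 * sqrt (ball_volume m c * Sigma_L S \<nu> *
        (LBINT l:{0<..}. fact m * (\<Sum>k=0..m. 1 / fact k * (2 * (l * psi m c h / c)) ^ k) / (2 * l) ^ (m + 1) *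
           exp (- 2 * (l * psi m c h / c)) * f l)))" if "c > 1"
      using b unfolding depth'[OF that] dim' .
  next
    fix h :: real assume a: "integrable \<nu> (\<lambda>x. \<bar>x\<bar>)" "S = 0" and h: "0 < h"
    note b = finite_variation[OF a h]
    show "theta_lex M Y h \<le> ennreal (2 * ball_volume m c * gamma_abs \<gamma> \<nu> *
        (LBINT l:{0<..}. fact m * (\<Sum>k=0..m. 1 / fact k * (l * psi m c h) ^ k) / l ^ (m + 1) *
           exp (- l * psi m c h) * f l))" if "c \<le> 1"
      using b unfolding depth[OF that] fv mult.assoc .
    show "theta_lex M Y h \<le> ennreal (2 * ball_volume m c * gamma_abs \<gamma> \<nu> *
        (LBINT l:{0<..}. fact m * (\<Sum>k=0..m. 1 / fact k * (l * psi m c h / c) ^ k) / l ^ (m + 1) *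
           exp (- (l * psi m c h / c)) * f l))" if "c > 1"
      using b unfolding depth'[OF that] fv' mult.assoc .
  qed (use weakly_dependent_centred weakly_dependent_finite_variation in auto)
qed

end
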